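(* Let $a,b>0$, let $n_2,n_3$ be positive integers, and let $\mathcal{F}_1,\mathcal{F}_2,\mathcal{F}_3$ be the free linkages in the plane where $\mathcal{F}_1$ has length vector $(a,b)$, $\mathcal{F}_2$ has $n_2$ edges all of length $1$, and $\mathcal{F}_3$ has $n_3$ edges all of length $1$. Suppose that any one of the following three conditions is satisfied: (1) the interval $[\,|a-b|,a+b\,]$ does not intersect the odd integers, and $\mathcal{F}_2$ and $\mathcal{F}_3$ both have an odd number of edges; (2) the interval $[\,|a-b|,a+b\,]$ does not intersect the even integers, and $\mathcal{F}_2$ and $\mathcal{F}_3$ both have an even number of edges; (3) the interval $[\,|a-b|,a+b\,]$ does not intersect the integers, and $\mathcal{F}_2$ and $\mathcal{F}_3$ have opposite parity of number of edges. Then the map $p:M(\mathcal{F}_1,\mathcal{F}_2,\mathcal{F}_3)\to S^1$ is a locally trivial fibration, and therefore $\chi(M(\mathcal{F}_1,\mathcal{F}_2,\mathcal{F}_3))=0$.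
   Context: A free linkage $\mathcal{F}$ in $\mathbb{R}^2$ with length vector $(d_1,\ldots,d_n)$, $d_i>0$, has configurations $(x_1,\ldots,x_{n+1})\in(\mathbb{R}^2)^{n+1}$ with $|x_i-x_{i+1}|=d_i$ for $i=1,\ldots,n$; $x_1$ is the initial and $x_{n+1}$ the terminal vertex. $C(\mathcal{F}_1,\mathcal{F}_2,\mathcal{F}_3)$ is the space of triples of configurations of $\mathcal{F}_1,\mathcal{F}_2,\mathcal{F}_3$ with all initial vertices at the origin and all terminal vertices coinciding, and $M(\mathcal{F}_1,\mathcal{F}_2,\mathcal{F}_3)=C(\mathcal{F}_1,\mathcal{F}_2,\mathcal{F}_3)/SO(2)$. It is identified with the set of triples in which the first edge of $\mathcal{F}_1$ (of length $a$) lies on the positive $x$-axis. Let $\theta\in\mathbb{R}/2\pi\mathbb{Z}$ be the angle from the positive $x$-axis to the second edge of $\mathcal{F}_1$ (of length $b$, directed from the second to the third vertex), and let $\theta_1=\pi-\theta$ be the angle from $b$ to $a$. The map $p$ sends a configuration to its angle $\theta_1$. $\chi$ denotes the Euler characteristic. *)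

theory Defs
  imports "HOL-Analysis.Analysis" "HOL-Homology.Homology"
begin

section \<open>Linkages in the plane\<close>

text \<open>
  The plane is \<^typ>\<open>complex\<close>, so that \<open>SO(2)\<close> is the unit circle acting by multiplication. A free
  linkage is given by its list of edge lengths; vertices are numbered from \<open>0\<close>, so a
  configuration of a linkage with \<open>n\<close> edges is a point of the \<open>(n+1)\<close>-fold power of the plane,
  an extensional function on \<open>{..n}\<close>.
\<close>

type_synonym vertices = "nat \<Rightarrow> complex"
type_synonym triple = "vertices \<times> vertices \<times> vertices"

definition linkage_configs :: "real list \<Rightarrow> vertices set" where
  "linkage_configs d =
     {x \<in> {..length d} \<rightarrow>\<^sub>E UNIV. \<forall>i<length d. dist (x i) (x (Suc i)) = d ! i}"

definition plane_power :: "nat \<Rightarrow> vertices topology" where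
  "plane_power n = product_topology (\<lambda>_. euclidean) {..n}"

definition C_set :: "real list \<Rightarrow> real list \<Rightarrow> real list \<Rightarrow> triple set" where
  "C_set d1 d2 d3 =
     {(x, y, z). x \<in> linkage_configs d1 \<and> y \<in> linkage_configs d2 \<and> z \<in> linkage_configs d3 \<and>
        x 0 = 0 \<and> y 0 = 0 \<and> z 0 = 0 \<and>
        x (length d1) = y (length d2) \<and> y (length d2) = z (length d3)}"

definition C_space :: "real list \<Rightarrow> real list \<Rightarrow> real list \<Rightarrow> triple topology" where
  "C_space d1 d2 d3 =
     subtopology
       (prod_topology (plane_power (length d1))
         (prod_topology (plane_power (length d2)) (plane_power (length d3))))
       (C_set d1 d2 d3)"

definition rotate_triple ::
  "real list \<Rightarrow> real list \<Rightarrow> real list \<Rightarrow> complex \<Rightarrow> triple \<Rightarrow> triple" where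
  "rotate_triple d1 d2 d3 w = (\<lambda>(x, y, z).
     (\<lambda>i\<in>{..length d1}. w * x i, \<lambda>i\<in>{..length d2}. w * y i, \<lambda>i\<in>{..length d3}. w * z i))"

definition orbit ::
  "real list \<Rightarrow> real list \<Rightarrow> real list \<Rightarrow> triple \<Rightarrow> triple set" where
  "orbit d1 d2 d3 t = {rotate_triple d1 d2 d3 w t | w. w \<in> sphere 0 1}"

definition quotient_topology :: "'a topology \<Rightarrow> ('a \<Rightarrow> 'b) \<Rightarrow> 'b topology" where
  "quotient_topology X q =
     topology (\<lambda>U. U \<subseteq> q ` topspace X \<and> openin X {x \<in> topspace X. q x \<in> U})"

lemma openin_quotient_topology:
  "openin (quotient_topology X q) U \<longleftrightarrow>
     U \<subseteq> q ` topspace X \<and> openin X {x \<in> topspace X. q x \<in> U}"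
proof -
  have "istopology (\<lambda>U. U \<subseteq> q ` topspace X \<and> openin X {x \<in> topspace X. q x \<in> U})"
    unfolding istopology_def
  proof (intro conjI allI impI)
    fix S T
    assume S: "S \<subseteq> q ` topspace X \<and> openin X {x \<in> topspace X. q x \<in> S}"
      and T: "T \<subseteq> q ` topspace X \<and> openin X {x \<in> topspace X. q x \<in> T}"
    from S show "S \<inter> T \<subseteq> q ` topspace X" by blast
    have "{x \<in> topspace X. q x \<in> S \<inter> T} =
        {x \<in> topspace X. q x \<in> S} \<inter> {x \<in> topspace X. q x \<in> T}" by auto
    then show "openin X {x \<in> topspace X. q x \<in> S \<inter> T}"
      using openin_Int[OF conjunct2[OF S] conjunct2[OF T]] by (simp only:)
  next
    fix \<K>
    assume *: "\<forall>K\<in>\<K>. K \<subseteq> q ` topspace X \<and> openin X {x \<in> topspace X. q x \<in> K}"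
    then show "\<Union> \<K> \<subseteq> q ` topspace X" by blast
    have "{x \<in> topspace X. q x \<in> \<Union> \<K>} = (\<Union>K\<in>\<K>. {x \<in> topspace X. q x \<in> K})" by auto
    moreover have "openin X (\<Union>K\<in>\<K>. {x \<in> topspace X. q x \<in> K})"
      using * by (intro openin_Union) blast
    ultimately show "openin X {x \<in> topspace X. q x \<in> \<Union> \<K>}" by (simp only:)
  qed
  then show ?thesis by (simp only: quotient_topology_def topology_inverse')
qed

lemma topspace_quotient_topology [simp]: "topspace (quotient_topology X q) = q ` topspace X"
proof
  show "topspace (quotient_topology X q) \<subseteq> q ` topspace X"
    using openin_topspace[of "quotient_topology X q"] unfolding openin_quotient_topology
    by (rule conjunct1)
  have "{x \<in> topspace X. q x \<in> q ` topspace X} = topspace X" by auto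
  then have "openin (quotient_topology X q) (q ` topspace X)"
    unfolding openin_quotient_topology by (simp only: order_refl openin_topspace simp_thms)
  then show "q ` topspace X \<subseteq> topspace (quotient_topology X q)"
    by (rule openin_subset)
qed

lemma quotient_map_quotient_topology: "quotient_map X (quotient_topology X q) q"
  by (simp only: quotient_map_def topspace_quotient_topology openin_quotient_topology) simp

definition M_space :: "real list \<Rightarrow> real list \<Rightarrow> real list \<Rightarrow> triple set topology" where
  "M_space d1 d2 d3 = quotient_topology (C_space d1 d2 d3) (orbit d1 d2 d3)"

text \<open>
  An orbit contains exactly one triple whose first linkage has its first edge on the positive
  \<open>x\<close>-axis (lemma \<open>ex1_normalized\<close> below); the angle \<open>\<theta>\<close> is read off from that triple.
  The group of reals modulo \<open>2\<pi>\<close> is identified with the unit circle by \<^const>\<open>cis\<close>.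
\<close>

definition normalized :: "triple \<Rightarrow> bool" where
  "normalized = (\<lambda>(x, y, z). Im (x 1 - x 0) = 0 \<and> Re (x 1 - x 0) > 0)"

definition theta :: "triple set \<Rightarrow> real" where
  "theta u = (case the_elem {t \<in> u. normalized t} of (x, y, z) \<Rightarrow> Arg (x 2 - x 1))"

definition p_map :: "triple set \<Rightarrow> complex" where
  "p_map u = cis (pi - theta u)"

lemma ex1_normalized:
  assumes "d1 \<noteq> []" "d1 ! 0 > 0" "u \<in> topspace (M_space d1 d2 d3)"
  shows "\<exists>!t. t \<in> u \<and> normalized t"
proof -
  have "u \<in> orbit d1 d2 d3 ` topspace (C_space d1 d2 d3)"
    using assms(3) by (simp only: M_space_def topspace_quotient_topology)
  then obtain s where "s \<in> C_set d1 d2 d3" "u = orbit d1 d2 d3 s"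
    unfolding C_space_def topspace_subtopology by blast
  then obtain x y z where t: "(x, y, z) \<in> C_set d1 d2 d3" and u: "u = orbit d1 d2 d3 (x, y, z)"
    by (cases s) blast
  have len: "Suc 0 \<le> length d1" using assms(1) by (cases d1) auto
  have x: "x \<in> linkage_configs d1" and x0: "x 0 = 0"
    using t by (simp_all add: C_set_def)
  from x len have "dist (x 0) (x (Suc 0)) = d1 ! 0"
    unfolding linkage_configs_def Suc_le_eq by blast
  then have x1: "cmod (x 1) > 0" using assms(2) x0 by simp
  have norm_iff: "normalized (rotate_triple d1 d2 d3 w (x, y, z)) \<longleftrightarrow>
      Im (w * x 1) = 0 \<and> Re (w * x 1) > 0" for w
    using len x0 by (simp add: normalized_def rotate_triple_def)
  have eq: "cnj (sgn (x 1)) * x 1 = of_real (cmod (x 1))"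
  proof -
    have "cnj (sgn (x 1)) * x 1 = (x 1 * cnj (x 1)) / of_real (cmod (x 1))"
      by (simp add: sgn_eq)
    also have "\<dots> = of_real (cmod (x 1))"
      using x1 by (simp only: complex_norm_square[symmetric]) (simp add: power2_eq_square)
    finally show ?thesis .
  qed
  have unique: "w = cnj (sgn (x 1))"
    if "cmod w = 1" "Im (w * x 1) = 0" "Re (w * x 1) > 0" for w
  proof -
    have "cmod (w * x 1) = Re (w * x 1)"
      using cmod_eq_Re[OF that(2)] abs_of_pos[OF that(3)] by (rule trans)
    then have "Re (w * x 1) = cmod (x 1)"
      using that(1) by (metis norm_mult mult_1)
    then have "w * x 1 = of_real (cmod (x 1))"
      using that(2) by (simp only: complex_eq_iff Re_complex_of_real Im_complex_of_real)
    then have "w * x 1 = cnj (sgn (x 1)) * x 1" by (simp only: eq)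
    moreover have "x 1 \<noteq> 0" using x1 by auto
    ultimately show ?thesis by (rule mult_right_cancel[THEN iffD1, rotated])
  qed
  show ?thesis
  proof (rule ex1I[of _ "rotate_triple d1 d2 d3 (cnj (sgn (x 1))) (x, y, z)"])
    show "rotate_triple d1 d2 d3 (cnj (sgn (x 1))) (x, y, z) \<in> u \<and>
        normalized (rotate_triple d1 d2 d3 (cnj (sgn (x 1))) (x, y, z))"
    proof
      have "cnj (sgn (x 1)) \<in> sphere 0 1"
        using x1 by (simp add: norm_sgn)
      then show "rotate_triple d1 d2 d3 (cnj (sgn (x 1))) (x, y, z) \<in> u"
        unfolding u orbit_def by blast
      show "normalized (rotate_triple d1 d2 d3 (cnj (sgn (x 1))) (x, y, z))"
        using x1 unfolding norm_iff eq by simp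
    qed
  next
    fix t assume t': "t \<in> u \<and> normalized t"
    then obtain w where w: "cmod w = 1" "t = rotate_triple d1 d2 d3 w (x, y, z)"
      unfolding u orbit_def by auto
    with t' have "Im (w * x 1) = 0 \<and> Re (w * x 1) > 0" by (simp only: norm_iff)
    then show "t = rotate_triple d1 d2 d3 (cnj (sgn (x 1))) (x, y, z)"
      using w unique by blast
  qed
qed

section \<open>Locally trivial fibrations\<close>

text \<open>
  The model fibre over a neighbourhood of \<open>b\<close> is the actual fibre over \<open>b\<close>; this is no
  restriction, since any trivialization over a neighbourhood of \<open>b\<close> identifies its model
  fibre with that one. Fibres may be empty.
\<close>

definition locally_trivial_fibration ::
  "'e topology \<Rightarrow> 'b topology \<Rightarrow> ('e \<Rightarrow> 'b) \<Rightarrow> bool" where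
  "locally_trivial_fibration E B p \<longleftrightarrow>
     continuous_map E B p \<and>
     (\<forall>b\<in>topspace B. \<exists>U h. openin B U \<and> b \<in> U \<and>
        homeomorphic_map
          (subtopology E {e \<in> topspace E. p e \<in> U})
          (prod_topology (subtopology B U) (subtopology E {e \<in> topspace E. p e = b})) h \<and>
        (\<forall>e\<in>topspace E. p e \<in> U \<longrightarrow> fst (h e) = p e))"

section \<open>Euler characteristic\<close>

text \<open>Independence over the integers in an abelian group, which is written multiplicatively.\<close>

definition int_independent :: "('a, 'm) monoid_scheme \<Rightarrow> 'a set \<Rightarrow> bool" where
  "int_independent G S \<longleftrightarrow> finite S \<and> S \<subseteq> carrier G \<and>
     (\<forall>c :: 'a \<Rightarrow> int. finprod G (\<lambda>x. x [^]\<^bsub>G\<^esub> c x) S = \<one>\<^bsub>G\<^esub> \<longrightarrow> (\<forall>x\<in>S. c x = 0))"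

definition has_rank :: "('a, 'm) monoid_scheme \<Rightarrow> nat \<Rightarrow> bool" where
  "has_rank G n \<longleftrightarrow>
     (\<exists>S. int_independent G S \<and> card S = n) \<and> (\<forall>S. int_independent G S \<longrightarrow> card S \<le> n)"

text \<open>
  A relation rather than a function: it holds only if all Betti numbers are finite and almost
  all of them vanish, so the alternating sum is meaningful. Singular homology vanishes in
  negative degrees.
\<close>

definition has_euler_characteristic :: "'a topology \<Rightarrow> int \<Rightarrow> bool" where
  "has_euler_characteristic X k \<longleftrightarrow>
     (\<exists>\<beta> :: nat \<Rightarrow> nat. (\<forall>i. has_rank (homology_group (int i) X) (\<beta> i)) \<and>
        finite {i. \<beta> i \<noteq> 0} \<and> k = (\<Sum>i | \<beta> i \<noteq> 0. (-1) ^ i * int (\<beta> i)))"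

lemma has_euler_characteristic_unique:
  assumes "has_euler_characteristic X k" "has_euler_characteristic X l"
  shows "k = l"
proof -
  obtain \<beta> \<gamma> where \<beta>: "\<And>i. has_rank (homology_group (int i) X) (\<beta> i)"
      "k = (\<Sum>i | \<beta> i \<noteq> 0. (-1) ^ i * int (\<beta> i))"
    and \<gamma>: "\<And>i. has_rank (homology_group (int i) X) (\<gamma> i)"
      "l = (\<Sum>i | \<gamma> i \<noteq> 0. (-1) ^ i * int (\<gamma> i))"
    using assms unfolding has_euler_characteristic_def by blast
  have "\<beta> i = \<gamma> i" for i
    using \<beta>(1)[of i] \<gamma>(1)[of i] unfolding has_rank_def by (metis order_antisym)
  then have "\<beta> = \<gamma>" by auto
  then show ?thesis using \<beta>(2) \<gamma>(2) by simp
qed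

end

theory Submission
  imports Defs
begin

text \<open>
  Rotate every configuration so that the first edge of the two-bar linkage lies on the positive
  real axis, and let \<open>c\<close> be the value of the projection. The common terminal vertex is then
  \<open>P c = a - b * cnj c\<close>, and what remains of the configuration is a pair of chains of unit edges from
  \<open>0\<close> to \<open>P c\<close>. So the space is the pullback along \<open>P\<close> of the fibre product of two endpoint maps
  \<open>(u\<^sub>1, \<dots>, u\<^sub>n) \<mapsto> u\<^sub>1 + \<dots> + u\<^sub>n\<close> on tori. A chain is a critical point of its endpoint map only if
  all its edges are parallel, and then the modulus of the endpoint is an integer of the parity
  of \<open>n\<close>. Since \<open>\<bar>P c\<bar>\<close> ranges over \<open>[\<bar>a - b\<bar>, a + b]\<close>, each of the three conditions keeps the curve
  \<open>P\<close> away from the critical values of both endpoint maps.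

  Local triviality is then Ehresmann's theorem, but no vector field is integrated. The Moebius maps
  \<open>g\<^sub>l z = (z + l) / (1 + cnj l * z)\<close> with \<open>\<bar>l\<bar> < 1\<close> permute the unit circle, and the inverse of \<open>g\<^sub>l\<close> is
  \<open>g\<^bsub>-l\<^esub>\<close>. Applied to all edges of a chain at once, they move its endpoint with derivative
  \<open>l \<mapsto> n * l - q * cnj l\<close> at \<open>l = 0\<close>, where \<open>q\<close> is the sum of the squares of the edges. This is invertible
  because \<open>\<bar>q\<bar> < n\<close> unless all edges are parallel. Hence every prescribed endpoint close to the given
  one is reached for exactly one small \<open>l\<close> (lemma \<open>moebius_chart\<close>); moving chains by this \<open>l\<close>
  identifies nearby fibres (theorem \<open>chain_fibre_chart\<close>). Normalizing the edges beforehand turns the same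
  construction into a retraction of a neighbourhood onto a fibre.

  The second assertion follows from the first once the homology of the fibres is known to have finite
  total rank. It does, because a fibre is compact and is a retract of an open set, hence a retract of
  a finite union of open boxes (theorem \<open>euler_characteristic_compact_neighbourhood_retract\<close>).
  The Euler characteristic is additive for open covers (theorem \<open>has_euler_characteristic_Un\<close>), so that
  the part of the total space over any open arc has the Euler characteristic \<open>k\<close> of the fibre. The
  circle is the union of two arcs that meet in two disjoint arcs, which gives \<open>k + k - 2 * k = 0\<close>
  (theorem \<open>euler_characteristic_fibration_over_circle\<close>).
\<close>

section \<open>Ranks of abelian groups\<close>

definition int_comb :: "('a, 'm) monoid_scheme \<Rightarrow> ('j \<Rightarrow> int) \<Rightarrow> ('j \<Rightarrow> 'a) \<Rightarrow> 'j set \<Rightarrow> 'a" where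
  "int_comb G c v J = finprod G (\<lambda>j. v j [^]\<^bsub>G\<^esub> c j) J"

context comm_group
begin

lemma int_comb_closed [simp]: "v \<in> J \<rightarrow> carrier G \<Longrightarrow> int_comb G c v J \<in> carrier G"
  unfolding int_comb_def by (rule finprod_closed) auto

lemma int_comb_empty [simp]: "int_comb G c v {} = \<one>"
  by (simp add: int_comb_def)

lemma int_comb_insert [simp]:
  assumes "finite J" "j \<notin> J" "v j \<in> carrier G" "v \<in> J \<rightarrow> carrier G"
  shows "int_comb G c v (insert j J) = v j [^] c j \<otimes> int_comb G c v J"
  unfolding int_comb_def using assms by (intro finprod_insert) auto

lemma int_comb_cong:
  assumes "\<And>j. j \<in> J \<Longrightarrow> c j = d j" "\<And>j. j \<in> J \<Longrightarrow> v j = w j" "w \<in> J \<rightarrow> carrier G"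
  shows "int_comb G c v J = int_comb G d w J"
  unfolding int_comb_def using assms by (intro finprod_cong') auto

lemma int_comb_add:
  assumes "finite J" "v \<in> J \<rightarrow> carrier G"
  shows "int_comb G (\<lambda>j. c j + d j) v J = int_comb G c v J \<otimes> int_comb G d v J"
proof -
  have "int_comb G (\<lambda>j. c j + d j) v J = finprod G (\<lambda>j. v j [^] c j \<otimes> v j [^] d j) J"
    unfolding int_comb_def using assms by (intro finprod_cong') (auto simp: int_pow_mult Pi_iff)
  also have "\<dots> = int_comb G c v J \<otimes> int_comb G d v J"
    unfolding int_comb_def using assms by (intro finprod_multf) auto
  finally show ?thesis .
qed

lemma int_comb_pow:
  assumes "finite J" "v \<in> J \<rightarrow> carrier G"
  shows "int_comb G c v J [^] (k::int) = int_comb G (\<lambda>j. k * c j) v J"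
  using assms
proof (induction J rule: finite_induct)
  case empty
  then show ?case by simp
next
  case (insert j J)
  then have "v j \<in> carrier G" "v \<in> J \<rightarrow> carrier G" by auto
  with insert show ?case by (simp add: int_pow_distrib int_pow_pow mult.commute)
qed

lemma int_comb_0: "v \<in> J \<rightarrow> carrier G \<Longrightarrow> (\<And>j. j \<in> J \<Longrightarrow> c j = 0) \<Longrightarrow> int_comb G c v J = \<one>"
  unfolding int_comb_def by (intro finprod_one_eqI) auto

lemma int_comb_int_comb:
  assumes "finite S" "finite J" "v \<in> J \<rightarrow> carrier G"
  shows "finprod G (\<lambda>s. int_comb G (c s) v J [^] (x s :: int)) S =
    int_comb G (\<lambda>j. \<Sum>s\<in>S. x s * c s j) v J"
  using assms(1)
proof (induction S rule: finite_induct)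
  case empty
  show ?case using assms by (simp add: int_comb_0)
next
  case (insert s S)
  then show ?case using assms by (simp add: int_comb_add int_comb_pow)
qed

lemma int_comb_Un:
  assumes "finite I" "finite J" "I \<inter> J = {}" "v \<in> I \<union> J \<rightarrow> carrier G"
  shows "int_comb G c v (I \<union> J) = int_comb G c v I \<otimes> int_comb G c v J"
  unfolding int_comb_def using assms by (intro finprod_Un_disjoint) auto

lemma int_comb_reindex:
  assumes "inj_on h J" "v \<in> h ` J \<rightarrow> carrier G"
  shows "int_comb G c v (h ` J) = int_comb G (c \<circ> h) (v \<circ> h) J"
  unfolding int_comb_def using assms by (subst finprod_reindex) auto

end

lemma hom_int_comb:
  assumes "comm_group G" "comm_group H" "h \<in> hom G H" "finite J" "v \<in> J \<rightarrow> carrier G"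
  shows "h (int_comb G c v J) = int_comb H c (\<lambda>j. h (v j)) J"
proof -
  interpret G: comm_group G by fact
  interpret H: comm_group H by fact
  interpret group_hom G H h
    by (simp add: group_hom_def group_hom_axioms_def assms G.is_group H.is_group)
  show ?thesis using assms(4,5)
  proof (induction J rule: finite_induct)
    case (insert j J)
    then have "v j \<in> carrier G" "v \<in> J \<rightarrow> carrier G" by auto
    moreover then have "(\<lambda>j. h (v j)) \<in> J \<rightarrow> carrier H" by (simp add: Pi_iff)
    ultimately show ?case using insert by (simp add: hom_int_pow)
  qed simp
qed

text \<open>
  Gaussian elimination without division: the pivot row \<open>k\<close> is used to clear the last coordinate of
  all the other rows, which are multiplied by the pivot entry instead of being divided by it.
\<close>

lemma integer_linear_dependence:
  fixes c :: "'j \<Rightarrow> nat \<Rightarrow> int"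
  assumes "finite J" "n < card J"
  shows "\<exists>x. (\<exists>j\<in>J. x j \<noteq> 0) \<and> (\<forall>i<n. (\<Sum>j\<in>J. x j * c j i) = 0)"
  using assms
proof (induction n arbitrary: J c)
  case 0
  then obtain j where "j \<in> J" by fastforce
  then show ?case by (intro exI[of _ "\<lambda>_. 1"]) auto
next
  case (Suc n)
  show ?case
  proof (cases "\<forall>j\<in>J. c j n = 0")
    case True
    obtain x where "\<exists>j\<in>J. x j \<noteq> 0" "\<forall>i<n. (\<Sum>j\<in>J. x j * c j i) = 0"
      using Suc.IH[of J c] Suc.prems by auto
    with True show ?thesis
      by (intro exI[of _ x]) (auto simp: less_Suc_eq)
  next
    case False
    then obtain k where k: "k \<in> J" "c k n \<noteq> 0" by blast
    let ?J = "J - {k}"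
    let ?c = "\<lambda>j i. c k n * c j i - c j n * c k i"
    have "finite ?J" "n < card ?J" using Suc.prems k by auto
    from Suc.IH[OF this, of ?c] obtain x where x: "\<exists>j\<in>?J. x j \<noteq> 0"
      "\<And>i. i < n \<Longrightarrow> (\<Sum>j\<in>?J. x j * ?c j i) = 0" by blast
    define y where "y j = (if j = k then - (\<Sum>j\<in>?J. x j * c j n) else x j * c k n)" for j
    have "(\<Sum>j\<in>J. y j * c j i) = (\<Sum>j\<in>?J. x j * ?c j i)" for i
    proof -
      have "(\<Sum>j\<in>J. y j * c j i) = y k * c k i + (\<Sum>j\<in>?J. y j * c j i)"
        using k Suc.prems by (simp add: sum.remove)
      also have "\<dots> = - (\<Sum>j\<in>?J. x j * c j n * c k i) + (\<Sum>j\<in>?J. x j * c k n * c j i)"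
        by (auto simp: y_def sum_distrib_right intro!: sum.cong)
      also have "\<dots> = (\<Sum>j\<in>?J. x j * ?c j i)"
        by (simp add: sum_subtractf algebra_simps)
      finally show ?thesis .
    qed
    then have "(\<Sum>j\<in>J. y j * c j i) = 0" if "i < Suc n" for i
      using that x(2)[of i] by (cases "i = n") (auto simp: algebra_simps)
    moreover have "\<exists>j\<in>J. y j \<noteq> 0" using x(1) k by (auto simp: y_def)
    ultimately show ?thesis by blast
  qed
qed

text \<open>
  Only a nonzero multiple of each element has to be a combination of the family. This is spanning
  after tensoring with the rationals, and it makes torsion invisible.
\<close>

definition rational_span :: "('a, 'm) monoid_scheme \<Rightarrow> (nat \<Rightarrow> 'a) \<Rightarrow> nat \<Rightarrow> bool" where
  "rational_span G v n \<longleftrightarrow> v \<in> {..<n} \<rightarrow> carrier G \<and>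
     (\<forall>g\<in>carrier G. \<exists>m::int. m \<noteq> 0 \<and> (\<exists>c. g [^]\<^bsub>G\<^esub> m = int_comb G c v {..<n}))"

definition rational_basis :: "('a, 'm) monoid_scheme \<Rightarrow> (nat \<Rightarrow> 'a) \<Rightarrow> nat \<Rightarrow> bool" where
  "rational_basis G v n \<longleftrightarrow> rational_span G v n \<and>
     (\<forall>c. int_comb G c v {..<n} = \<one>\<^bsub>G\<^esub> \<longrightarrow> (\<forall>j<n. c j = 0))"

context comm_group
begin

lemma int_independent_iff:
  "int_independent G S \<longleftrightarrow> finite S \<and> S \<subseteq> carrier G \<and>
     (\<forall>c. int_comb G c (\<lambda>x. x) S = \<one> \<longrightarrow> (\<forall>x\<in>S. c x = 0))"
  by (simp add: int_independent_def int_comb_def)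

text \<open>
  Multiples of the elements of \<open>S\<close> have integer coordinates with respect to \<open>v\<close>; more than \<open>n\<close> vectors
  of \<open>n\<close> integer coordinates are linearly dependent.
\<close>

lemma card_int_independent_le:
  assumes v: "rational_span G v n" and S: "int_independent G S"
  shows "card S \<le> n"
proof (rule ccontr)
  assume "\<not> card S \<le> n"
  have fin: "finite S" and sub: "S \<subseteq> carrier G" using S by (auto simp: int_independent_def)
  have vc: "v \<in> {..<n} \<rightarrow> carrier G" using v by (simp add: rational_span_def)
  have "\<forall>s\<in>S. \<exists>m::int. \<exists>c. m \<noteq> 0 \<and> s [^] m = int_comb G c v {..<n}"
    using v sub by (auto simp: rational_span_def)
  then obtain m c where mc: "\<And>s. s \<in> S \<Longrightarrow> m s \<noteq> (0::int)"
    "\<And>s. s \<in> S \<Longrightarrow> s [^] m s = int_comb G (c s) v {..<n}" by metis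
  obtain x where x: "\<exists>s\<in>S. x s \<noteq> 0" "\<And>i. i < n \<Longrightarrow> (\<Sum>s\<in>S. x s * c s i) = 0"
    using integer_linear_dependence[OF fin, of n c] \<open>\<not> card S \<le> n\<close> by auto
  have "int_comb G (\<lambda>s. m s * x s) (\<lambda>x. x) S = finprod G (\<lambda>s. int_comb G (c s) v {..<n} [^] x s) S"
    unfolding int_comb_def[of _ "\<lambda>s. m s * x s"] using sub vc
    by (intro finprod_cong') (auto simp: mc(2)[symmetric] int_pow_pow)
  also have "\<dots> = int_comb G (\<lambda>j. \<Sum>s\<in>S. x s * c s j) v {..<n}"
    using fin vc by (intro int_comb_int_comb) auto
  also have "\<dots> = \<one>" using vc x(2) by (intro int_comb_0) auto
  finally have "\<forall>s\<in>S. m s * x s = 0" using S unfolding int_independent_iff by blast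
  with mc(1) x(1) show False by auto
qed

lemma has_rank_if_bounded:
  assumes "\<And>S. int_independent G S \<Longrightarrow> card S \<le> N"
  shows "\<exists>k\<le>N. has_rank G k"
proof -
  define P where "P k \<longleftrightarrow> (\<exists>S. int_independent G S \<and> card S = k)" for k
  have "P 0" unfolding P_def by (intro exI[of _ "{}"]) (simp add: int_independent_def)
  moreover have "\<forall>k. P k \<longrightarrow> k \<le> N" using assms by (auto simp: P_def)
  ultimately have "P (Greatest P)" "\<And>k. P k \<Longrightarrow> k \<le> Greatest P" "Greatest P \<le> N"
    using GreatestI_nat[of P 0 N] Greatest_le_nat[of P _ N] by auto
  then show ?thesis unfolding has_rank_def by (intro exI[of _ "Greatest P"]) (auto simp: P_def)
qed

lemma rational_basis_imp_has_rank:
  assumes "rational_basis G v n"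
  shows "has_rank G n"
proof -
  have span: "rational_span G v n" and vc: "v \<in> {..<n} \<rightarrow> carrier G"
    and ind: "\<And>c. int_comb G c v {..<n} = \<one> \<Longrightarrow> \<forall>j<n. c j = 0"
    using assms by (auto simp: rational_basis_def rational_span_def)
  have inj: "inj_on v {..<n}"
  proof (rule inj_onI, rule ccontr)
    fix i j assume ij: "i \<in> {..<n}" "j \<in> {..<n}" "v i = v j" "i \<noteq> j"
    define c :: "nat \<Rightarrow> int" where "c = (\<lambda>k. if k = i then 1 else if k = j then -1 else 0)"
    have eq: "{..<n} = insert i (insert j ({..<n} - {i, j}))" using ij by auto
    have "int_comb G c v ({..<n} - {i, j}) = \<one>"
      using vc by (intro int_comb_0) (auto simp: c_def)
    moreover have "v i \<in> carrier G" "v j \<in> carrier G" "v \<in> {..<n} - {i, j} \<rightarrow> carrier G"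
      using vc ij by auto
    ultimately have "int_comb G c v {..<n} = \<one>"
      using ij by (subst eq) (simp add: c_def int_pow_neg)
    from ind[OF this] ij show False by (auto simp: c_def)
  qed
  have "int_independent G (v ` {..<n})"
    unfolding int_independent_iff
  proof (intro conjI allI impI)
    fix c assume "int_comb G c (\<lambda>x. x) (v ` {..<n}) = \<one>"
    then have "int_comb G (c \<circ> v) v {..<n} = \<one>"
      using vc by (subst (asm) int_comb_reindex) (auto simp: inj comp_def)
    from ind[OF this] show "\<forall>x\<in>v ` {..<n}. c x = 0" by auto
  qed (use vc in auto)
  moreover have "card (v ` {..<n}) = n" using inj by (simp add: card_image)
  ultimately show ?thesis
    unfolding has_rank_def using card_int_independent_le[OF span] by blast
qed

text \<open>
  An independent set of maximal size works: adding any further element \<open>g\<close> creates a relation, and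
  \<open>g\<close> must occur in it because the set itself admits none.
\<close>

lemma has_rank_imp_rational_basis:
  assumes "has_rank G n"
  shows "\<exists>v. rational_basis G v n"
proof -
  obtain S where S: "int_independent G S" "card S = n" and max: "\<And>T. int_independent G T \<Longrightarrow> card T \<le> n"
    using assms unfolding has_rank_def by blast
  have fin: "finite S" and sub: "S \<subseteq> carrier G"
    and ind: "\<And>c. int_comb G c (\<lambda>x. x) S = \<one> \<Longrightarrow> \<forall>x\<in>S. c x = 0"
    using S by (auto simp: int_independent_iff)
  obtain v where v: "bij_betw v {..<n} S"
    using ex_bij_betw_nat_finite[OF fin] S(2) by (auto simp: atLeast0LessThan)
  have vc: "v \<in> {..<n} \<rightarrow> carrier G" using v sub by (auto simp: bij_betw_def)
  have comb: "int_comb G c (\<lambda>x. x) S = int_comb G (c \<circ> v) v {..<n}" for c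
    using v int_comb_reindex[of v "{..<n}" "\<lambda>x. x" c] sub
    by (auto simp: bij_betw_def comp_def)
  have comb': "int_comb G c v {..<n} = int_comb G (c \<circ> inv_into {..<n} v) (\<lambda>x. x) S" for c
    unfolding comb using vc v
    by (intro int_comb_cong) (auto simp: bij_betw_def)
  have "\<exists>m::int. m \<noteq> 0 \<and> (\<exists>c. g [^] m = int_comb G c v {..<n})" if g: "g \<in> carrier G" for g
  proof (cases "g \<in> S")
    case True
    let ?c = "\<lambda>x. if x = g then 1 else (0::int)"
    have "int_comb G ?c (\<lambda>x. x) (S - {g}) = \<one>"
      using sub by (intro int_comb_0) auto
    then have "int_comb G ?c (\<lambda>x. x) (insert g (S - {g})) = g"
      using fin g sub by (subst int_comb_insert) (auto simp: Pi_iff)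
    then have "g [^] (1::int) = int_comb G ?c (\<lambda>x. x) S"
      using True g by (simp add: insert_absorb)
    moreover have "(1::int) \<noteq> 0" by simp
    ultimately show ?thesis unfolding comb by blast
  next
    case False
    have "\<not> int_independent G (insert g S)"
      using max[of "insert g S"] False fin S(2) by auto
    then obtain c where c: "int_comb G c (\<lambda>x. x) (insert g S) = \<one>" "\<exists>x\<in>insert g S. c x \<noteq> 0"
      using fin sub g unfolding int_independent_iff by auto
    then have c': "g [^] c g \<otimes> int_comb G c (\<lambda>x. x) S = \<one>"
      using fin sub g False by (subst (asm) int_comb_insert) auto
    have "c g \<noteq> 0"
    proof
      assume "c g = 0"
      with c' ind[of c] sub have "\<forall>x\<in>S. c x = 0" by (auto simp: subset_iff Pi_def)
      with c(2) \<open>c g = 0\<close> show False by auto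
    qed
    have "int_comb G c (\<lambda>x. x) S \<in> carrier G"
      using sub by (intro int_comb_closed) auto
    then have Sc: "int_comb G c (\<lambda>x. x) S \<in> carrier G" .
    then have "g [^] c g = inv (int_comb G c (\<lambda>x. x) S)"
      using c' g by (metis int_pow_closed inv_equality)
    also have "\<dots> = int_comb G c (\<lambda>x. x) S [^] (-1::int)"
      using Sc by (simp add: int_pow_neg)
    also have "\<dots> = int_comb G (\<lambda>x. - c x) (\<lambda>x. x) S"
      using fin sub by (subst int_comb_pow) auto
    finally show ?thesis unfolding comb using \<open>c g \<noteq> 0\<close> by blast
  qed
  then have "rational_span G v n" using vc by (auto simp: rational_span_def)
  moreover have "\<forall>j<n. c j = 0" if "int_comb G c v {..<n} = \<one>" for c
  proof (intro allI impI)
    fix j assume "j < n"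
    then have "v j \<in> S" "inv_into {..<n} v (v j) = j" using v by (auto simp: bij_betw_def)
    then show "c j = 0" using ind[OF that[unfolded comb']] by auto
  qed
  ultimately show ?thesis unfolding rational_basis_def by blast
qed

lemma has_rank_unique: "has_rank G m \<Longrightarrow> has_rank G n \<Longrightarrow> m = n"
  unfolding has_rank_def by (metis order_antisym)

end

lemma (in comm_group) comm_group_subgroup:
  assumes "subgroup H G"
  shows "comm_group (G\<lparr>carrier := H\<rparr>)"
proof -
  interpret K: group "G\<lparr>carrier := H\<rparr>"
    using assms by (simp add: subgroup.subgroup_is_group is_group)
  show ?thesis
    using subgroup.subset[OF assms] by unfold_locales (auto intro: m_comm)
qed

lemma (in comm_group) subgroup_inclusion_hom:
  assumes "subgroup H G" shows "(\<lambda>x. x) \<in> hom (G\<lparr>carrier := H\<rparr>) G"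
  using subgroup.subset[OF assms] by (auto simp: hom_def)

lemma (in comm_group) int_comb_subgroup:
  assumes "subgroup H G" "finite J" "v \<in> J \<rightarrow> H"
  shows "int_comb (G\<lparr>carrier := H\<rparr>) c v J = int_comb G c v J"
  using hom_int_comb[OF comm_group_subgroup[OF assms(1)] comm_group_axioms
      subgroup_inclusion_hom[OF assms(1)] assms(2), of v c] assms(3) by simp

lemma (in comm_group) has_rank_subgroup:
  assumes "has_rank G n" "subgroup H G"
  shows "\<exists>k\<le>n. has_rank (G\<lparr>carrier := H\<rparr>) k"
proof -
  interpret K: comm_group "G\<lparr>carrier := H\<rparr>" using comm_group_subgroup[OF assms(2)] .
  have sub: "H \<subseteq> carrier G" using subgroup.subset[OF assms(2)] .
  show ?thesis
  proof (rule K.has_rank_if_bounded)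
    fix S assume S: "int_independent (G\<lparr>carrier := H\<rparr>) S"
    then have SH: "finite S" "S \<subseteq> H" by (auto simp: int_independent_def)
    have "int_independent G S"
      using S SH sub unfolding int_independent_iff K.int_independent_iff
      by (auto simp: int_comb_subgroup[OF assms(2)] Pi_iff subset_iff)
    then show "card S \<le> n" using assms(1) by (auto simp: has_rank_def)
  qed
qed

lemma (in comm_group) has_rank_trivial:
  assumes "carrier G = {\<one>}"
  shows "has_rank G 0"
proof (rule rational_basis_imp_has_rank)
  have "\<one> [^] (1::int) = int_comb G undefined undefined {..<0::nat}" by simp
  then show "rational_basis G undefined 0"
    using assms unfolding rational_basis_def rational_span_def
    by (auto intro!: exI[of _ "1::int"])
qed

text \<open>
  The kernel and the image are regarded as groups of their own, so that exactness, an equation between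
  subsets, becomes an equation between groups.
\<close>

locale comm_group_hom = A: comm_group A + B: comm_group B
  for A :: "('a, 'm) monoid_scheme" and B :: "('b, 'n) monoid_scheme" +
  fixes f
  assumes hom: "f \<in> hom A B"
begin

sublocale group_hom A B f
  by (simp add: group_hom_def group_hom_axioms_def hom)

abbreviation "Krn \<equiv> A\<lparr>carrier := kernel A B f\<rparr>"
abbreviation "Img \<equiv> B\<lparr>carrier := f ` carrier A\<rparr>"

lemma comm_Krn: "comm_group Krn" by (rule A.comm_group_subgroup) (rule subgroup_kernel)
lemma comm_Img: "comm_group Img" by (rule B.comm_group_subgroup) (rule img_is_subgroup)

text \<open>
  A basis of the kernel followed by a lift \<open>l\<close> of a basis \<open>w\<close> of the image is a basis of the whole group.
  For spanning, a multiple of \<open>f g\<close> is a combination of \<open>w\<close>; subtracting the lifted combination leaves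
  an element of the kernel, of which again only a multiple is a combination of \<open>u\<close>.
\<close>

lemma has_rank_extension:
  assumes k: "has_rank Krn k" and r: "has_rank Img r"
  shows "has_rank A (k + r)"
proof -
  interpret K: comm_group Krn by (rule comm_Krn)
  interpret I: comm_group Img by (rule comm_Img)
  obtain u where u: "rational_basis Krn u k" using K.has_rank_imp_rational_basis[OF k] by blast
  obtain w where w: "rational_basis Img w r" using I.has_rank_imp_rational_basis[OF r] by blast
  have uc: "u \<in> {..<k} \<rightarrow> kernel A B f" and wc: "w \<in> {..<r} \<rightarrow> f ` carrier A"
    using u w by (auto simp: rational_basis_def rational_span_def)
  then obtain l where l: "\<And>j. j < r \<Longrightarrow> l j \<in> carrier A" "\<And>j. j < r \<Longrightarrow> f (l j) = w j"
    unfolding Pi_iff image_iff by (metis lessThan_iff)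
  have wcB: "w \<in> {..<r} \<rightarrow> carrier B"
    using wc subgroup.subset[OF img_is_subgroup] by blast
  have uc': "u \<in> {..<k} \<rightarrow> carrier A" using uc by (auto simp: kernel_def)
  have lc: "l \<in> {..<r} \<rightarrow> carrier A" using l by auto
  define v where "v j = (if j < k then u j else l (j - k))" for j
  have vc: "v \<in> {..<k + r} \<rightarrow> carrier A" using uc' l(1) by (auto simp: v_def)
  have split: "int_comb A c v {..<k + r} =
      int_comb A c u {..<k} \<otimes>\<^bsub>A\<^esub> int_comb A (\<lambda>j. c (k + j)) l {..<r}" for c
  proof -
    have eq: "{..<k + r} = {..<k} \<union> (\<lambda>j. k + j) ` {..<r}"
      by (simp add: lessThan_atLeast0 ivl_disj_un_two(3) add.commute[of r k])
    have "int_comb A c v {..<k + r} = int_comb A c v {..<k} \<otimes>\<^bsub>A\<^esub> int_comb A c v ((\<lambda>j. k + j) ` {..<r})"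
      using vc unfolding eq by (intro A.int_comb_Un) auto
    also have "int_comb A c v {..<k} = int_comb A c u {..<k}"
      using uc' by (intro A.int_comb_cong) (auto simp: v_def)
    also have "int_comb A c v ((\<lambda>j. k + j) ` {..<r}) = int_comb A (\<lambda>j. c (k + j)) l {..<r}"
      using l(1) by (subst A.int_comb_reindex) (auto simp: v_def comp_def)
    finally show ?thesis .
  qed
  have fl: "f (int_comb A c l {..<r}) = int_comb Img c w {..<r}" for c
  proof -
    have "f (int_comb A c l {..<r}) = int_comb B c (\<lambda>j. f (l j)) {..<r}"
      using hom_int_comb[OF A.comm_group_axioms B.comm_group_axioms hom _ lc] by simp
    also have "\<dots> = int_comb B c w {..<r}"
      using wcB l by (intro B.int_comb_cong) auto
    also have "\<dots> = int_comb Img c w {..<r}"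
      using B.int_comb_subgroup[OF img_is_subgroup _ wc] by simp
    finally show ?thesis .
  qed
  have fu: "int_comb A c u {..<k} \<in> kernel A B f" for c
    using K.int_comb_closed[of u "{..<k}" c] uc A.int_comb_subgroup[OF subgroup_kernel _ uc] by simp
  have "rational_basis A v (k + r)"
    unfolding rational_basis_def rational_span_def
  proof (intro conjI ballI allI impI)
    fix g assume g: "g \<in> carrier A"
    then have "f g \<in> carrier Img" by simp
    then obtain m c where m: "m \<noteq> 0" "f g [^]\<^bsub>Img\<^esub> (m::int) = int_comb Img c w {..<r}"
      using w unfolding rational_basis_def rational_span_def by blast
    let ?h = "g [^]\<^bsub>A\<^esub> m \<otimes>\<^bsub>A\<^esub> inv\<^bsub>A\<^esub> (int_comb A c l {..<r})"
    have hl: "int_comb A c l {..<r} \<in> carrier A" using lc by simp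
    have "f g [^]\<^bsub>Img\<^esub> m = f g [^]\<^bsub>B\<^esub> m"
      using B.int_pow_consistent[OF img_is_subgroup] g by simp
    then have "f ?h = \<one>\<^bsub>B\<^esub>"
      using g hl m(2) by (simp add: fl[symmetric] hom_int_pow)
    then have "?h \<in> carrier Krn" using g hl by (simp add: kernel_def)
    then obtain m' d where m': "m' \<noteq> 0" "?h [^]\<^bsub>Krn\<^esub> (m'::int) = int_comb Krn d u {..<k}"
      using u unfolding rational_basis_def rational_span_def by blast
    have "?h [^]\<^bsub>Krn\<^esub> m' = ?h [^]\<^bsub>A\<^esub> m'"
      using A.int_pow_consistent[OF subgroup_kernel] \<open>?h \<in> carrier Krn\<close> by simp
    then have h: "?h [^]\<^bsub>A\<^esub> m' = int_comb A d u {..<k}"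
      using m'(2) A.int_comb_subgroup[OF subgroup_kernel _ uc] by simp
    have gm: "g [^]\<^bsub>A\<^esub> m = ?h \<otimes>\<^bsub>A\<^esub> int_comb A c l {..<r}"
      using g hl by (simp add: A.m_assoc)
    have "g [^]\<^bsub>A\<^esub> (m * m') = (g [^]\<^bsub>A\<^esub> m) [^]\<^bsub>A\<^esub> m'"
      using g by (simp add: A.int_pow_pow)
    also have "\<dots> = ?h [^]\<^bsub>A\<^esub> m' \<otimes>\<^bsub>A\<^esub> int_comb A c l {..<r} [^]\<^bsub>A\<^esub> m'"
      using g hl by (subst gm) (intro A.int_pow_distrib; simp)
    also have "\<dots> = int_comb A d u {..<k} \<otimes>\<^bsub>A\<^esub> int_comb A (\<lambda>j. m' * c j) l {..<r}"
      using lc by (simp only: h A.int_comb_pow[OF finite_lessThan])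
    also have "\<dots> = int_comb A (\<lambda>j. if j < k then d j else m' * c (j - k)) v {..<k + r}"
      unfolding split using uc' lc by (intro arg_cong2[where f = "(\<otimes>\<^bsub>A\<^esub>)"] A.int_comb_cong) auto
    finally show "\<exists>m. m \<noteq> 0 \<and> (\<exists>c. g [^]\<^bsub>A\<^esub> (m::int) = int_comb A c v {..<k + r})"
      using m(1) m'(1) by (intro exI[of _ "m * m'"]) auto
  next
    fix c j assume c: "int_comb A c v {..<k + r} = \<one>\<^bsub>A\<^esub>" and j: "j < k + r"
    have l_in: "int_comb A (\<lambda>j. c (k + j)) l {..<r} \<in> carrier A" using lc by simp
    have u_in: "int_comb A c u {..<k} \<in> carrier A" using uc' by simp
    have "f (int_comb A c u {..<k}) \<otimes>\<^bsub>B\<^esub> f (int_comb A (\<lambda>j. c (k + j)) l {..<r}) = \<one>\<^bsub>B\<^esub>"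
      using c l_in u_in by (simp add: split hom_mult[symmetric] del: hom_mult)
    moreover have "f (int_comb A c u {..<k}) = \<one>\<^bsub>B\<^esub>" using fu[of c] by (simp add: kernel_def)
    ultimately have "f (int_comb A (\<lambda>j. c (k + j)) l {..<r}) = \<one>\<^bsub>B\<^esub>" using l_in by simp
    then have "int_comb Img (\<lambda>j. c (k + j)) w {..<r} = \<one>\<^bsub>Img\<^esub>" by (simp add: fl)
    then have w0: "\<And>j. j < r \<Longrightarrow> c (k + j) = 0" using w by (auto simp: rational_basis_def)
    then have "int_comb A (\<lambda>j. c (k + j)) l {..<r} = \<one>\<^bsub>A\<^esub>" using lc by (intro A.int_comb_0) auto
    then have "int_comb A c u {..<k} = \<one>\<^bsub>A\<^esub>" using c u_in by (simp add: split)
    then have "int_comb Krn c u {..<k} = \<one>\<^bsub>Krn\<^esub>"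
      using A.int_comb_subgroup[OF subgroup_kernel _ uc] by simp
    then have "\<And>j. j < k \<Longrightarrow> c j = 0" using u by (auto simp: rational_basis_def)
    with w0 j show "c j = 0" by (metis add_diff_inverse_nat nat_add_left_cancel_less)
  qed (use vc in auto)
  then show ?thesis by (rule A.rational_basis_imp_has_rank)
qed

lemma has_rank_Img:
  assumes "has_rank A n"
  shows "\<exists>r. has_rank Img r"
proof -
  interpret I: comm_group Img by (rule comm_Img)
  obtain v where v: "rational_basis A v n" using A.has_rank_imp_rational_basis[OF assms] by blast
  then have vc: "v \<in> {..<n} \<rightarrow> carrier A" by (auto simp: rational_basis_def rational_span_def)
  have comb: "f (int_comb A c v {..<n}) = int_comb Img c (\<lambda>j. f (v j)) {..<n}" for c
    using hom_int_comb[OF A.comm_group_axioms B.comm_group_axioms hom _ vc]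
      B.int_comb_subgroup[OF img_is_subgroup, of "{..<n}" "\<lambda>j. f (v j)" c] vc by (auto simp: Pi_iff)
  have "rational_span Img (\<lambda>j. f (v j)) n"
    unfolding rational_span_def
  proof (intro conjI ballI)
    fix y assume "y \<in> carrier Img"
    then obtain g where g: "g \<in> carrier A" "y = f g" by auto
    then obtain m c where m: "m \<noteq> 0" "g [^]\<^bsub>A\<^esub> (m::int) = int_comb A c v {..<n}"
      using v unfolding rational_basis_def rational_span_def by blast
    have "f g [^]\<^bsub>Img\<^esub> m = f (g [^]\<^bsub>A\<^esub> m)"
      using B.int_pow_consistent[OF img_is_subgroup] g by (simp add: hom_int_pow)
    then show "\<exists>m. m \<noteq> 0 \<and> (\<exists>c. y [^]\<^bsub>Img\<^esub> (m::int) = int_comb Img c (\<lambda>j. f (v j)) {..<n})"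
      using m g comb by auto
  qed (use vc in auto)
  then show ?thesis using I.has_rank_if_bounded[of n] I.card_int_independent_le by blast
qed

lemma rank_nullity:
  assumes "has_rank A n"
  shows "\<exists>k r. n = k + r \<and> has_rank Krn k \<and> has_rank Img r"
proof -
  obtain r where r: "has_rank Img r" using has_rank_Img[OF assms] by blast
  obtain k where k: "has_rank Krn k" using A.has_rank_subgroup[OF assms subgroup_kernel] by blast
  show ?thesis using r k A.has_rank_unique[OF assms has_rank_extension[OF k r]] by blast
qed

lemma has_rank_inj:
  assumes "has_rank B n" "inj_on f (carrier A)"
  shows "\<exists>k\<le>n. has_rank A k"
proof -
  interpret K: comm_group Krn by (rule comm_Krn)
  have "carrier Krn = {\<one>\<^bsub>Krn\<^esub>}"
    using assms(2) inj_iff_trivial_ker by auto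
  then have "has_rank Krn 0" by (rule K.has_rank_trivial)
  moreover obtain k where "k \<le> n" "has_rank Img k"
    using B.has_rank_subgroup[OF assms(1) img_is_subgroup] by blast
  ultimately show ?thesis using has_rank_extension[of 0 k] by auto
qed

end

lemma has_rank_iso:
  assumes "comm_group A" "comm_group B" "A \<cong> B" "has_rank A n"
  shows "has_rank B n"
proof -
  have *: "\<exists>k\<le>m. has_rank H k" if GH: "comm_group G" "comm_group H" "H \<cong> G" "has_rank G m"
    for G :: "('x, 'm) monoid_scheme" and H :: "('y, 'n) monoid_scheme" and m
  proof -
    obtain h where h: "h \<in> iso H G" using GH(3) by (auto simp: is_iso_def)
    interpret comm_group_hom H G h
      using GH h by (simp add: comm_group_hom_def comm_group_hom_axioms_def iso_def)
    show ?thesis using has_rank_inj[OF GH(4)] h by (auto simp: iso_def bij_betw_def)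
  qed
  interpret A: comm_group A by fact
  have "B \<cong> A" using assms(3) by (rule A.iso_sym)
  from *[OF assms(1,2) this assms(4)] obtain k where k: "k \<le> n" "has_rank B k" by blast
  from *[OF assms(2,1,3) k(2)] obtain l where l: "l \<le> k" "has_rank A l" by blast
  from A.has_rank_unique[OF assms(4) l(2)] k l show ?thesis by simp
qed

section \<open>Euler characteristics in long exact sequences\<close>

lemma has_rank_exact:
  assumes "comm_group_hom A B f" "comm_group_hom B C g"
    and exact: "f ` carrier A = kernel B C g"
    and "has_rank A a" "has_rank C c"
  shows "\<exists>b\<le>a + c. has_rank B b"
proof -
  interpret f: comm_group_hom A B f by fact
  interpret g: comm_group_hom B C g by fact
  obtain k r where "a = k + r" "has_rank (B\<lparr>carrier := f ` carrier A\<rparr>) r"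
    using f.rank_nullity[OF assms(4)] by blast
  moreover obtain s where "s \<le> c" "has_rank (C\<lparr>carrier := g ` carrier B\<rparr>) s"
    using g.B.has_rank_subgroup[OF assms(5) g.img_is_subgroup] by blast
  ultimately show ?thesis using g.has_rank_extension[of r s]
    by (intro exI[of _ "r + s"]) (auto simp: exact)
qed

text \<open>
  The formula that defines the Euler characteristic of a space, for an arbitrary graded group, so that
  it applies to relative homology as well.
\<close>

definition graded_euler :: "(int \<Rightarrow> ('a, 'm) monoid_scheme) \<Rightarrow> int \<Rightarrow> bool" where
  "graded_euler G k \<longleftrightarrow>
     (\<exists>\<beta> :: nat \<Rightarrow> nat. (\<forall>i. has_rank (G (int i)) (\<beta> i)) \<and>
        finite {i. \<beta> i \<noteq> 0} \<and> k = (\<Sum>i | \<beta> i \<noteq> 0. (-1) ^ i * int (\<beta> i)))"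

lemma graded_euler_iff:
  "graded_euler G k \<longleftrightarrow> (\<exists>\<beta> N. (\<forall>i. has_rank (G (int i)) (\<beta> i)) \<and> (\<forall>i\<ge>N. \<beta> i = 0) \<and>
     k = (\<Sum>i<N. (-1) ^ i * int (\<beta> i)))"
proof
  assume "graded_euler G k"
  then obtain \<beta> where \<beta>: "\<forall>i. has_rank (G (int i)) (\<beta> i)" "finite {i. \<beta> i \<noteq> 0}"
    "k = (\<Sum>i | \<beta> i \<noteq> 0. (-1) ^ i * int (\<beta> i))" unfolding graded_euler_def by blast
  obtain N where N: "\<And>i. \<beta> i \<noteq> 0 \<Longrightarrow> i < N"
    using \<beta>(2) by (auto simp: finite_nat_set_iff_bounded)
  have "k = (\<Sum>i<N. (-1) ^ i * int (\<beta> i))"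
    unfolding \<beta>(3) using N by (intro sum.mono_neutral_left) auto
  moreover have "\<forall>i\<ge>N. \<beta> i = 0" using N leD by blast
  ultimately show "\<exists>\<beta> N. (\<forall>i. has_rank (G (int i)) (\<beta> i)) \<and> (\<forall>i\<ge>N. \<beta> i = 0) \<and>
      k = (\<Sum>i<N. (-1) ^ i * int (\<beta> i))" using \<beta>(1) by blast
next
  assume "\<exists>\<beta> N. (\<forall>i. has_rank (G (int i)) (\<beta> i)) \<and> (\<forall>i\<ge>N. \<beta> i = 0) \<and>
      k = (\<Sum>i<N. (-1) ^ i * int (\<beta> i))"
  then obtain \<beta> N where \<beta>: "\<forall>i. has_rank (G (int i)) (\<beta> i)" "\<And>i. i \<ge> N \<Longrightarrow> \<beta> i = 0"
    "k = (\<Sum>i<N. (-1) ^ i * int (\<beta> i))" by blast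
  have "i < N" if "\<beta> i \<noteq> 0" for i using \<beta>(2)[of i] that by (cases "i < N") auto
  then have sub: "{i. \<beta> i \<noteq> 0} \<subseteq> {..<N}" by blast
  then have "k = (\<Sum>i | \<beta> i \<noteq> 0. (-1) ^ i * int (\<beta> i))"
    unfolding \<beta>(3) by (intro sum.mono_neutral_right) auto
  moreover have "finite {i. \<beta> i \<noteq> 0}" using sub finite_subset by blast
  ultimately show "graded_euler G k" unfolding graded_euler_def using \<beta>(1) by blast
qed

lemma graded_euler_iso:
  assumes "\<And>p. comm_group (G p)" "\<And>p. comm_group (H p)" "\<And>p. G p \<cong> H p" "graded_euler G k"
  shows "graded_euler H k"
  using assms(4) has_rank_iso[OF assms(1-3)] unfolding graded_euler_def by blast

text \<open>
  The sequence \<open>\<dots> \<rightarrow> A p \<rightarrow> B p \<rightarrow> C p \<rightarrow> A (p - 1) \<rightarrow> \<dots>\<close>, indexed by the integers as homology is. That \<open>A\<close>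
  vanishes in degree \<open>-1\<close> is what makes the alternating sums start without a boundary term.
\<close>

locale long_exact_sequence =
  fixes A B C :: "int \<Rightarrow> 'a monoid" and f g d :: "int \<Rightarrow> 'a \<Rightarrow> 'a"
  assumes f: "\<And>p. comm_group_hom (A p) (B p) (f p)"
    and g: "\<And>p. comm_group_hom (B p) (C p) (g p)"
    and d: "\<And>p. comm_group_hom (C p) (A (p - 1)) (d p)"
    and exact_B: "\<And>p. f p ` carrier (A p) = kernel (B p) (C p) (g p)"
    and exact_C: "\<And>p. g p ` carrier (B p) = kernel (C p) (A (p - 1)) (d p)"
    and exact_A: "\<And>p. d p ` carrier (C p) = kernel (A (p - 1)) (B (p - 1)) (f (p - 1))"
    and bounded: "carrier (A (-1)) = {\<one>\<^bsub>A (-1)\<^esub>}"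
begin

text \<open>
  The rank of each term is the sum of the ranks of the images of the two adjacent maps. In the
  alternating sum the images into \<open>B\<close> and into \<open>C\<close> cancel at once, and those of the boundary maps
  cancel by telescoping.
\<close>

lemma alternating_sum:
  assumes a: "\<And>i. has_rank (A (int i)) (a i)" and b: "\<And>i. has_rank (B (int i)) (b i)"
    and c: "\<And>i. has_rank (C (int i)) (c i)" and N: "c N = 0"
  shows "(\<Sum>i<N. (-1) ^ i * int (b i)) =
    (\<Sum>i<N. (-1) ^ i * int (a i)) + (\<Sum>i<N. (-1) ^ i * int (c i))"
proof -
  interpret f: comm_group_hom "A p" "B p" "f p" for p by (rule f)
  interpret g: comm_group_hom "B p" "C p" "g p" for p by (rule g)
  interpret d: comm_group_hom "C p" "A (p - 1)" "d p" for p by (rule d)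
  have "\<exists>r. has_rank (f.Img (int i)) r" for i using f.has_rank_Img[OF a[of i]] .
  then obtain r where r: "\<And>i. has_rank (f.Img (int i)) (r i)" by metis
  have "\<exists>s. has_rank (g.Img (int i)) s" for i using g.has_rank_Img[OF b[of i]] .
  then obtain s where s: "\<And>i. has_rank (g.Img (int i)) (s i)" by metis
  have "\<exists>t. has_rank (d.Img (int i)) t" for i using d.has_rank_Img[OF c[of i]] .
  then obtain t where t: "\<And>i. has_rank (d.Img (int i)) (t i)" by metis
  have a_eq: "a i = t (Suc i) + r i" for i
  proof -
    have "has_rank (f.Krn (int i)) (t (Suc i))"
      using t[of "Suc i"] exact_A[of "int (Suc i)"] by (simp add: add.commute)
    from f.has_rank_extension[OF this r] f.A.has_rank_unique[OF a] show ?thesis by blast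
  qed
  have b_eq: "b i = r i + s i" for i
    using g.has_rank_extension[OF r[of i, unfolded exact_B] s] f.B.has_rank_unique[OF b] by blast
  have c_eq: "c i = s i + t i" for i
    using d.has_rank_extension[OF s[of i, unfolded exact_C] t] g.B.has_rank_unique[OF c] by blast
  have t0: "t 0 = 0"
  proof -
    have A1: "comm_group (A (-1))" using f[of "-1"] by (simp add: comm_group_hom_def)
    have "has_rank (A (-1)) 0" using A1 bounded by (rule comm_group.has_rank_trivial)
    then obtain k where "k \<le> 0" "has_rank (d.Img 0) k"
      using comm_group.has_rank_subgroup[OF A1, of 0] d.img_is_subgroup[of 0] by auto
    moreover have "comm_group (d.Img 0)" by (rule d.comm_Img)
    ultimately show ?thesis using t[of 0] comm_group.has_rank_unique[of "d.Img 0" 0 "t 0"] by simp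
  qed
  have "(\<Sum>i<n. (-1) ^ i * int (b i)) = (\<Sum>i<n. (-1) ^ i * int (a i)) +
      (\<Sum>i<n. (-1) ^ i * int (c i)) + (-1) ^ n * int (t n)" for n
    by (induction n) (simp_all add: a_eq b_eq c_eq t0 algebra_simps)
  moreover have "t N = 0" using N c_eq[of N] by simp
  ultimately show ?thesis by simp
qed

lemma graded_euler_middle:
  assumes "graded_euler A k" "graded_euler C l"
  shows "graded_euler B (k + l)"
proof -
  obtain a M where a: "\<And>i. has_rank (A (int i)) (a i)" "\<And>i. i \<ge> M \<Longrightarrow> a i = 0"
    "k = (\<Sum>i<M. (-1) ^ i * int (a i))" using assms(1) unfolding graded_euler_iff by blast
  obtain c N where c: "\<And>i. has_rank (C (int i)) (c i)" "\<And>i. i \<ge> N \<Longrightarrow> c i = 0"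
    "l = (\<Sum>i<N. (-1) ^ i * int (c i))" using assms(2) unfolding graded_euler_iff by blast
  have "\<exists>b\<le>a i + c i. has_rank (B (int i)) b" for i
    using has_rank_exact[OF f g exact_B a(1) c(1)] .
  then obtain b where b: "\<And>i. b i \<le> a i + c i" "\<And>i. has_rank (B (int i)) (b i)" by metis
  let ?N = "max M N"
  have "k = (\<Sum>i<?N. (-1) ^ i * int (a i))"
    unfolding a(3) by (rule sum.mono_neutral_left) (auto simp: a(2) not_less)
  moreover have "l = (\<Sum>i<?N. (-1) ^ i * int (c i))"
    unfolding c(3) by (rule sum.mono_neutral_left) (auto simp: c(2) not_less)
  ultimately have "k + l = (\<Sum>i<?N. (-1) ^ i * int (b i))"
    using alternating_sum[OF a(1) b(2) c(1), of ?N] c(2)[of ?N] by simp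
  moreover have "b i = 0" if "i \<ge> ?N" for i using b(1)[of i] a(2)[of i] c(2)[of i] that by simp
  ultimately show ?thesis unfolding graded_euler_iff using b(2) by blast
qed

lemma graded_euler_right:
  assumes "graded_euler A k" "graded_euler B l"
  shows "graded_euler C (l - k)"
proof -
  obtain a M where a: "\<And>i. has_rank (A (int i)) (a i)" "\<And>i. i \<ge> M \<Longrightarrow> a i = 0"
    "k = (\<Sum>i<M. (-1) ^ i * int (a i))" using assms(1) unfolding graded_euler_iff by blast
  obtain b N where b: "\<And>i. has_rank (B (int i)) (b i)" "\<And>i. i \<ge> N \<Longrightarrow> b i = 0"
    "l = (\<Sum>i<N. (-1) ^ i * int (b i))" using assms(2) unfolding graded_euler_iff by blast
  define a' where "a' i = (case i of 0 \<Rightarrow> 0 | Suc j \<Rightarrow> a j)" for i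
  have a': "has_rank (A (int i - 1)) (a' i)" for i
  proof (cases i)
    case 0
    have "comm_group (A (-1))" using f[of "-1"] by (simp add: comm_group_hom_def)
    then show ?thesis using comm_group.has_rank_trivial[OF _ bounded] 0 by (simp add: a'_def)
  qed (use a(1) in \<open>simp add: a'_def\<close>)
  have "\<exists>c\<le>b i + a' i. has_rank (C (int i)) c" for i
    using has_rank_exact[OF g d exact_C b(1) a'] .
  then obtain c where c: "\<And>i. c i \<le> b i + a' i" "\<And>i. has_rank (C (int i)) (c i)" by metis
  let ?N = "max (Suc M) N"
  have c0: "c i = 0" if "i \<ge> ?N" for i
    using c(1)[of i] a(2)[of "i - 1"] b(2)[of i] that by (cases i) (auto simp: a'_def)
  have "k = (\<Sum>i<?N. (-1) ^ i * int (a i))"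
    unfolding a(3) by (rule sum.mono_neutral_left) (auto simp: a(2) not_less)
  moreover have "l = (\<Sum>i<?N. (-1) ^ i * int (b i))"
    unfolding b(3) by (rule sum.mono_neutral_left) (auto simp: b(2) not_less)
  ultimately have "l - k = (\<Sum>i<?N. (-1) ^ i * int (c i))"
    using alternating_sum[OF a(1) b(1) c(2), of ?N] c0[of ?N] by simp
  then show ?thesis unfolding graded_euler_iff using c(2) c0 by blast
qed

end

abbreviation rel_euler :: "'a topology \<Rightarrow> 'a set \<Rightarrow> int \<Rightarrow> bool" where
  "rel_euler X S \<equiv> graded_euler (\<lambda>p. relative_homology_group p X S)"

lemma has_euler_characteristic_iff: "has_euler_characteristic X k \<longleftrightarrow> rel_euler X {} k"
  by (simp add: has_euler_characteristic_def graded_euler_def)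

lemma long_exact_sequence_of_pair:
  "long_exact_sequence (\<lambda>p. homology_group p (subtopology X S)) (\<lambda>p. homology_group p X)
     (\<lambda>p. relative_homology_group p X S)
     (\<lambda>p. hom_induced p (subtopology X S) {} X {} id) (\<lambda>p. hom_induced p X {} X S id)
     (\<lambda>p. hom_boundary p X S)"
proof (intro long_exact_sequence.intro)
  show "carrier (homology_group (- 1) (subtopology X S)) =
      {\<one>\<^bsub>homology_group (- 1) (subtopology X S)\<^esub>}"
    using trivial_homology_group[of "-1" "subtopology X S"] by (simp add: trivial_group_def)
  fix p
  show "hom_induced p (subtopology X S) {} X {} id ` carrier (homology_group p (subtopology X S)) =
      kernel (homology_group p X) (relative_homology_group p X S) (hom_induced p X {} X S id)"
    using homology_exactness_axiom_3[of p X S] by simp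
  show "hom_induced p X {} X S id ` carrier (homology_group p X) =
      kernel (relative_homology_group p X S) (homology_group (p - 1) (subtopology X S)) (hom_boundary p X S)"
    using homology_exactness_axiom_1[of p X S] by simp
  show "hom_boundary p X S ` carrier (relative_homology_group p X S) =
      kernel (homology_group (p - 1) (subtopology X S)) (homology_group (p - 1) X)
        (hom_induced (p - 1) (subtopology X S) {} X {} id)"
    using homology_exactness_axiom_2[of p X S] by simp
qed (simp_all add: comm_group_hom_def comm_group_hom_axioms_def hom_induced_hom hom_boundary_hom)

lemma has_euler_characteristic_homotopy_equivalent:
  assumes "X homotopy_equivalent_space Y" "has_euler_characteristic X k"
  shows "has_euler_characteristic Y k"
  using graded_euler_iso[OF _ _ homotopy_equivalent_space_imp_isomorphic_homology_groups[OF assms(1)]]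
    assms(2) unfolding has_euler_characteristic_iff by (simp add: abelian_homology_group)

lemma has_euler_characteristic_homeomorphic:
  "X homeomorphic_space Y \<Longrightarrow> has_euler_characteristic X k \<Longrightarrow> has_euler_characteristic Y k"
  using has_euler_characteristic_homotopy_equivalent homeomorphic_imp_homotopy_equivalent_space by blast

text \<open>
  Excision identifies the homology of \<open>(V, U \<inter> V)\<close> with that of \<open>(X, U)\<close>. Two long exact sequences then
  give \<open>v - w\<close> for the former pair and \<open>u + (v - w)\<close> for \<open>X\<close>.
\<close>

theorem has_euler_characteristic_Un:
  assumes UV: "openin X U" "openin X V" "U \<union> V = topspace X"
    and u: "has_euler_characteristic (subtopology X U) u"
    and v: "has_euler_characteristic (subtopology X V) v"
    and w: "has_euler_characteristic (subtopology X (U \<inter> V)) w"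
  shows "has_euler_characteristic X (u + v - w)"
proof -
  interpret V: long_exact_sequence "\<lambda>p. homology_group p (subtopology (subtopology X V) (U \<inter> V))"
    "\<lambda>p. homology_group p (subtopology X V)" "\<lambda>p. relative_homology_group p (subtopology X V) (U \<inter> V)"
    "\<lambda>p. hom_induced p (subtopology (subtopology X V) (U \<inter> V)) {} (subtopology X V) {} id"
    "\<lambda>p. hom_induced p (subtopology X V) {} (subtopology X V) (U \<inter> V) id"
    "\<lambda>p. hom_boundary p (subtopology X V) (U \<inter> V)"
    by (rule long_exact_sequence_of_pair)
  interpret U: long_exact_sequence "\<lambda>p. homology_group p (subtopology X U)"
    "\<lambda>p. homology_group p X" "\<lambda>p. relative_homology_group p X U"
    "\<lambda>p. hom_induced p (subtopology X U) {} X {} id" "\<lambda>p. hom_induced p X {} X U id"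
    "\<lambda>p. hom_boundary p X U"
    by (rule long_exact_sequence_of_pair)
  have sub: "U \<subseteq> topspace X" "V \<subseteq> topspace X" using UV openin_subset by auto
  have "subtopology (subtopology X V) (U \<inter> V) = subtopology X (U \<inter> V)"
    by (simp add: subtopology_subtopology Int_absorb1 inf_commute)
  with v w have "rel_euler (subtopology X V) (U \<inter> V) (v - w)"
    by (intro V.graded_euler_right) (simp_all add: has_euler_characteristic_iff)
  moreover have "relative_homology_group p (subtopology X V) (U \<inter> V) \<cong> relative_homology_group p X U" for p
  proof -
    let ?Z = "topspace X - V"
    have "closedin X ?Z" by (rule closedin_diff) (auto simp: UV)
    then have "X closure_of ?Z \<subseteq> X interior_of U"
      using UV openin_subset[OF UV(1)] by (simp add: closure_of_closedin interior_of_openin) blast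
    from homology_excision_axiom[OF this sub(1), of p]
    have "relative_homology_group p (subtopology X (topspace X - ?Z)) (U - ?Z)
        \<cong> relative_homology_group p (subtopology X (topspace X)) U"
      by (rule is_isoI)
    moreover have "topspace X - ?Z = V" "U - ?Z = U \<inter> V" using sub by auto
    ultimately show ?thesis by simp
  qed
  moreover note graded_euler_iso[of "\<lambda>p. relative_homology_group p (subtopology X V) (U \<inter> V)"
      "\<lambda>p. relative_homology_group p X U" "v - w"]
  ultimately have "rel_euler X U (v - w)" using abelian_relative_homology_group by blast
  with u have "rel_euler X {} (u + (v - w))"
    by (intro U.graded_euler_middle) (simp_all add: has_euler_characteristic_iff)
  then show ?thesis by (simp add: has_euler_characteristic_iff algebra_simps)
qed

lemma has_euler_characteristic_empty:
  assumes "topspace X = {}"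
  shows "has_euler_characteristic X 0"
proof -
  have "has_rank (homology_group (int i) X) 0" for i
    using trivial_homology_group_empty[OF assms, of "int i"] abelian_homology_group
    by (intro comm_group.has_rank_trivial) (auto simp: trivial_group_def)
  then show ?thesis unfolding has_euler_characteristic_def by (intro exI[of _ "\<lambda>_. 0"]) auto
qed

lemma has_rank_integer_group: "has_rank integer_group 1"
proof -
  interpret comm_group integer_group by (rule abelian_integer_group)
  have comb: "int_comb integer_group c (\<lambda>_. 1) {..<1::nat} = c 0" for c
    using int_comb_insert[of "{}" "0::nat" "\<lambda>_. 1" c] by (simp add: lessThan_Suc)
  have "rational_basis integer_group (\<lambda>_. 1) 1"
    unfolding rational_basis_def rational_span_def comb
  proof (intro conjI ballI)
    fix g :: int
    show "\<exists>m. m \<noteq> 0 \<and> (\<exists>c. g [^]\<^bsub>integer_group\<^esub> (m::int) = (c (0::nat)))"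
      by (intro exI[of _ 1] conjI exI[of _ "\<lambda>_. g"]) auto
  qed auto
  then show ?thesis by (rule rational_basis_imp_has_rank)
qed

lemma has_euler_characteristic_contractible:
  assumes "contractible_space X" "topspace X \<noteq> {}"
  shows "has_euler_characteristic X 1"
proof -
  obtain a where a: "a \<in> topspace X" "X homotopy_equivalent_space subtopology X {a}"
    using assms contractible_eq_homotopy_equivalent_singleton_subtopology[of X] by auto
  let ?Y = "subtopology X {a}"
  have top: "topspace ?Y = {a}" using a by auto
  have "has_rank (homology_group (int i) ?Y) (if i = 0 then 1 else 0)" for i
  proof (cases "i = 0")
    case True
    interpret comm_group "homology_group 0 ?Y" by (rule abelian_homology_group)
    have "path_connected_space ?Y"
      by (simp add: contractible_imp_path_connected_space)
    then have "homology_group 0 ?Y \<cong> integer_group"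
      using isomorphic_integer_zeroth_homology_group[of ?Y] top by blast
    then have "integer_group \<cong> homology_group 0 ?Y" by (rule iso_sym)
    then show ?thesis
      using has_rank_iso[OF abelian_integer_group abelian_homology_group _ has_rank_integer_group] True
      by simp
  next
    case False
    then have "trivial_group (homology_group (int i) ?Y)"
      using homology_dimension_axiom[OF top, of "int i"] by simp
    then show ?thesis using False abelian_homology_group
      by (auto intro!: comm_group.has_rank_trivial simp: trivial_group_def)
  qed
  moreover have "{i. (if i = 0 then 1 else 0 :: nat) \<noteq> 0} = {0::nat}" by auto
  ultimately have "has_euler_characteristic ?Y 1"
    unfolding has_euler_characteristic_def by (intro exI[of _ "\<lambda>i. if i = 0 then 1 else 0"]) auto
  then show ?thesis
    using has_euler_characteristic_homotopy_equivalent a homotopy_equivalent_space_sym by blast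
qed

text \<open>
  Induction on the number of sets: if \<open>C\<close> is one of them, then \<open>C\<close> meets the union of the others in a
  union of at most as many sets of \<open>\<C>\<close> as there are others.
\<close>

theorem euler_characteristic_finite_Union:
  assumes \<C>: "\<And>C. C \<in> \<C> \<Longrightarrow> openin X C" "\<And>C. C \<in> \<C> \<Longrightarrow> contractible_space (subtopology X C)"
    "\<And>C D. C \<in> \<C> \<Longrightarrow> D \<in> \<C> \<Longrightarrow> C \<inter> D \<in> \<C>"
    and "finite \<D>" "\<D> \<subseteq> \<C>"
  shows "\<exists>k. has_euler_characteristic (subtopology X (\<Union>\<D>)) k"
proof -
  have "\<exists>k. has_euler_characteristic (subtopology X (\<Union>\<D>)) k"
    if "finite \<D>" "\<D> \<subseteq> \<C>" "card \<D> \<le> n" for n \<D>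
    using that
  proof (induction n arbitrary: \<D>)
    case 0
    then show ?case using has_euler_characteristic_empty[of "subtopology X {}"] by auto
  next
    case (Suc n)
    show ?case
    proof (cases "\<D> = {}")
      case True
      then show ?thesis using has_euler_characteristic_empty[of "subtopology X {}"] by auto
    next
      case False
      then obtain C where C: "C \<in> \<D>" by blast
      let ?E = "\<D> - {C}"
      let ?U = "\<Union>?E"
      let ?X = "subtopology X (\<Union>\<D>)"
      have E: "finite ?E" "?E \<subseteq> \<C>" "card ?E \<le> n" using Suc.prems C by auto
      have sub: "?U \<subseteq> \<Union>\<D>" "C \<subseteq> \<Union>\<D>" "?U \<union> C = \<Union>\<D>" using C by blast+
      obtain u where u: "has_euler_characteristic (subtopology X ?U) u" using Suc.IH[OF E] by blast
      obtain v where v: "has_euler_characteristic (subtopology X C) v"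
      proof (cases "topspace (subtopology X C) = {}")
        case True
        then show ?thesis using has_euler_characteristic_empty that by blast
      next
        case False
        moreover have "contractible_space (subtopology X C)" using \<C>(2) C Suc.prems(2) by blast
        ultimately show ?thesis using has_euler_characteristic_contractible that by blast
      qed
      have "card ((\<lambda>D. D \<inter> C) ` ?E) \<le> n" using E card_image_le[OF E(1)] le_trans by blast
      then obtain w where "has_euler_characteristic (subtopology X (\<Union>((\<lambda>D. D \<inter> C) ` ?E))) w"
        using Suc.IH[of "(\<lambda>D. D \<inter> C) ` ?E"] E \<C>(3) C Suc.prems(2) by blast
      moreover have "\<Union>((\<lambda>D. D \<inter> C) ` ?E) = ?U \<inter> C" by auto
      ultimately have w: "has_euler_characteristic (subtopology X (?U \<inter> C)) w" by simp
      have "openin X ?U" "openin X C" using \<C>(1) Suc.prems(2) C by (auto intro!: openin_Union)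
      then have op: "openin ?X ?U" "openin ?X C"
        unfolding openin_subtopology
        by (rule_tac exI[of _ ?U], use sub in blast, rule_tac exI[of _ C], use sub in blast)
      moreover have "?U \<union> C = topspace ?X"
        using sub(3) openin_subset[OF \<open>openin X ?U\<close>] openin_subset[OF \<open>openin X C\<close>] by auto
      moreover have "subtopology ?X S = subtopology X S" if "S \<subseteq> \<Union>\<D>" for S
        using that by (simp add: subtopology_subtopology Int_absorb1)
      ultimately show ?thesis
        using has_euler_characteristic_Un[OF op] u v w sub by (metis inf.coboundedI2)
    qed
  qed
  then show ?thesis using assms(4,5) by blast
qed

text \<open>
  The homology of a retract embeds into that of the whole space, so that its
  ranks are finite and almost all of them vanish.
\<close>

lemma euler_characteristic_retract:
  assumes "section_map Y X f" "has_euler_characteristic X k"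
  shows "\<exists>l. has_euler_characteristic Y l"
proof -
  obtain \<beta> N where \<beta>: "\<And>i. has_rank (homology_group (int i) X) (\<beta> i)" "\<And>i. i \<ge> N \<Longrightarrow> \<beta> i = 0"
    using assms(2) unfolding has_euler_characteristic_iff graded_euler_iff by blast
  have "\<exists>m\<le>\<beta> i. has_rank (homology_group (int i) Y) m" for i
  proof -
    interpret comm_group_hom "homology_group (int i) Y" "homology_group (int i) X"
      "hom_induced (int i) Y {} X {} f"
      by (simp add: comm_group_hom_def comm_group_hom_axioms_def hom_induced_hom)
    show ?thesis using has_rank_inj[OF \<beta>(1)] inj_on_hom_induced_section_map[OF assms(1)] by blast
  qed
  then obtain \<gamma> where "\<And>i. \<gamma> i \<le> \<beta> i" "\<And>i. has_rank (homology_group (int i) Y) (\<gamma> i)" by metis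
  moreover then have "\<forall>i\<ge>N. \<gamma> i = 0" using \<beta>(2) by (metis le_zero_eq)
  ultimately show ?thesis unfolding has_euler_characteristic_iff graded_euler_iff by blast
qed

section \<open>Fibrations over the circle\<close>

lemma prod_contractible_homotopy_equivalent:
  assumes "contractible_space X" "topspace X \<noteq> {}"
  shows "prod_topology X Y homotopy_equivalent_space Y"
proof -
  obtain a where a: "a \<in> topspace X" "homotopic_with (\<lambda>x. True) X X id (\<lambda>x. a)"
    using assms by (auto simp: contractible_space null_topspace_iff_trivial)
  have "homotopic_with (\<lambda>x. True) Y Y id id" by (simp add: homotopic_with_refl)
  from homotopic_with_prod_topology[OF a(2) this, of "\<lambda>_. True"]
  have "homotopic_with (\<lambda>x. True) (prod_topology X Y) (prod_topology X Y) (\<lambda>z. z) (\<lambda>z. (a, snd z))"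
    by simp
  then have "homotopic_with (\<lambda>x. True) (prod_topology X Y) (prod_topology X Y) ((\<lambda>y. (a, y)) \<circ> snd) id"
    by (simp add: homotopic_with_sym comp_def id_def)
  moreover have "homotopic_with (\<lambda>x. True) Y Y (snd \<circ> (\<lambda>y. (a, y))) id"
    by (simp add: comp_def id_def[symmetric] homotopic_with_refl)
  moreover have "continuous_map Y (prod_topology X Y) (\<lambda>y. (a, y))"
    using a(1) by (intro continuous_map_pairedI) auto
  ultimately show ?thesis
    unfolding homotopy_equivalent_space_def using continuous_map_snd by blast
qed

lemma inj_on_cis_open_interval:
  assumes "t - s \<le> 2 * pi"
  shows "inj_on cis {s<..<t}"
proof (rule inj_onI)
  fix x y assume xy: "x \<in> {s<..<t}" "y \<in> {s<..<t}" "cis x = cis y"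
  then have "cis (x - y) = 1" by (simp add: cis_divide[symmetric])
  then have "cos (x - y) = 1" by (simp add: complex_eq_iff)
  then obtain n :: int where n: "x - y = of_int n * 2 * pi" using cos_one_2pi_int by blast
  have "\<bar>of_int n * (2 * pi)\<bar> < 1 * (2 * pi)" using xy assms n by auto
  then have "\<bar>real_of_int n\<bar> < 1" by (simp add: abs_mult)
  then have "n = 0" by linarith
  then show "x = y" using n by simp
qed

text \<open>
  The arc is the part on the unit circle of the image of a horizontal strip under the exponential
  function, which is a covering map and therefore open.
\<close>

lemma openin_cis_image: "openin (top_of_set (sphere 0 1)) (cis ` {s<..<t})"
proof -
  let ?S = "{z. s < Im z \<and> Im z < t}"
  have "open ?S" by (intro open_Collect_conj open_Collect_less continuous_intros)
  then have "openin (top_of_set (- {0})) (exp ` ?S)"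
    by (intro covering_space_open_map[OF covering_space_exp_punctured_plane]) auto
  then have "open (exp ` ?S)"
    using openin_open_trans[of "- {0}" "exp ` ?S"] by (simp add: open_Compl)
  then have "openin (top_of_set (sphere 0 1)) (sphere 0 1 \<inter> exp ` ?S)"
    by (rule openin_open_Int)
  also have "sphere 0 1 \<inter> exp ` ?S = cis ` {s<..<t}"
  proof
    show "sphere 0 1 \<inter> exp ` ?S \<subseteq> cis ` {s<..<t}"
    proof
      fix z assume "z \<in> sphere 0 1 \<inter> exp ` ?S"
      then obtain w where w: "z = exp w" "cmod z = 1" "s < Im w" "Im w < t" by auto
      then have "exp (Re w) = 1" by simp
      with w(1) have "z = cis (Im w)" by (simp add: exp_eq_polar)
      then show "z \<in> cis ` {s<..<t}" using w by auto
    qed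
    show "cis ` {s<..<t} \<subseteq> sphere 0 1 \<inter> exp ` ?S"
    proof
      fix z assume "z \<in> cis ` {s<..<t}"
      then obtain x where "z = exp (\<i> * of_real x)" "s < x" "x < t" "cmod z = 1"
        by (auto simp: cis_conv_exp)
      then show "z \<in> sphere 0 1 \<inter> exp ` ?S" by (auto intro!: image_eqI[of _ _ "\<i> * of_real x"])
    qed
  qed
  finally show ?thesis .
qed

text \<open>
  An arc of length at most \<open>2 * pi\<close> is homeomorphic to an open interval. The inverse of \<^const>\<open>cis\<close> is the
  argument, turned by the midpoint \<open>m\<close> so that its branch cut lies opposite to \<open>m\<close>, outside the arc.
\<close>

lemma contractible_cis_image:
  assumes "t - s \<le> 2 * pi"
  shows "contractible (cis ` {s<..<t})"
proof -
  define m where "m = (s + t) / 2"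
  have arg: "Arg (cis x * cis (- m)) + m = x" if "x \<in> {s<..<t}" for x
  proof -
    have "\<bar>x - m\<bar> < pi" using that assms by (auto simp: m_def field_simps abs_less_iff)
    then show ?thesis by (simp add: cis_mult Arg_cis abs_less_iff)
  qed
  have nonpos: "cis x * cis (- m) \<notin> \<real>\<^sub>\<le>\<^sub>0" if "x \<in> {s<..<t}" for x
  proof
    assume n: "cis x * cis (- m) \<in> \<real>\<^sub>\<le>\<^sub>0"
    have "\<bar>x - m\<bar> < pi" using that assms by (auto simp: m_def field_simps abs_less_iff)
    moreover have "Arg (cis x * cis (- m)) = pi"
      using n by (metis Arg_eq_pi complex_nonpos_Reals_iff cis_mult cis_neq_zero complex_eq_iff
          order_le_less zero_complex.sel)
    ultimately show False using arg[OF that] by auto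
  qed
  have "homeomorphism {s<..<t} (cis ` {s<..<t}) cis (\<lambda>z. Arg (z * cis (- m)) + m)"
    unfolding homeomorphism_def using arg nonpos
    by (auto intro!: continuous_intros simp: image_image image_iff)
  then have "{s<..<t} homeomorphic cis ` {s<..<t}" unfolding homeomorphic_def by blast
  moreover have "contractible {s<..<t}" by (simp add: convex_imp_contractible)
  ultimately show ?thesis using homeomorphic_contractible by blast
qed

text \<open>
  Over a short arc the total space is a product of the arc and a fibre. Longer arcs are built up by
  bisection from overlapping shorter ones; the overlap forces the local values to agree, and
  \<open>k + k - k = k\<close> shows that the value persists.
\<close>

theorem euler_characteristic_fibration_over_circle:
  fixes p :: "'a \<Rightarrow> complex"
  assumes lt: "locally_trivial_fibration E (top_of_set (sphere 0 1)) p"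
    and fib: "\<And>b. b \<in> sphere 0 1 \<Longrightarrow> \<exists>k. has_euler_characteristic (subtopology E {e \<in> topspace E. p e = b}) k"
  shows "has_euler_characteristic E 0"
proof -
  let ?B = "top_of_set (sphere 0 1 :: complex set)"
  define R where "R S = {e \<in> topspace E. p e \<in> S}" for S
  define arc where "arc s t = cis ` {s<..<t}" for s t
  define euler_over where "euler_over S k \<longleftrightarrow> has_euler_characteristic (subtopology E (R S)) k" for S k
  have cont: "continuous_map E ?B p" using lt by (simp add: locally_trivial_fibration_def)
  have pE: "p e \<in> sphere 0 1" if "e \<in> topspace E" for e
    using cont that by (auto simp: continuous_map_def)
  have R_open: "openin E (R S)" if "openin ?B S" for S
    using openin_continuous_map_preimage[OF cont that] by (simp add: R_def)
  have arc_open: "openin ?B (arc s t)" for s t unfolding arc_def by (rule openin_cis_image)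
  have Un: "euler_over (S \<union> T) (k + l - m)"
    if S: "openin ?B S" "openin ?B T" "euler_over S k" "euler_over T l" "euler_over (S \<inter> T) m" for S T k l m
  proof -
    let ?X = "subtopology E (R (S \<union> T))"
    have eq: "R (S \<union> T) = R S \<union> R T" "R (S \<inter> T) = R S \<inter> R T" by (auto simp: R_def)
    have sub: "subtopology ?X A = subtopology E A" if "A \<subseteq> R (S \<union> T)" for A
      using that by (simp add: subtopology_subtopology Int_absorb1)
    have "openin ?X (R S)" "openin ?X (R T)"
      using R_open[OF S(1)] R_open[OF S(2)] unfolding eq
      by (metis Int_absorb2 openin_subtopology sup_ge1, metis Int_absorb2 openin_subtopology sup_ge2)
    moreover have "R S \<union> R T = topspace ?X" unfolding eq by (auto simp: R_def)
    moreover have "has_euler_characteristic (subtopology ?X (R S)) k"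
      "has_euler_characteristic (subtopology ?X (R T)) l"
      using S(3,4) sub[of "R S"] sub[of "R T"] unfolding euler_over_def eq by simp_all
    moreover have "has_euler_characteristic (subtopology ?X (R S \<inter> R T)) m"
      using S(5) sub[of "R S \<inter> R T"] unfolding euler_over_def eq by (simp add: le_supI1)
    ultimately show ?thesis
      unfolding euler_over_def by (rule has_euler_characteristic_Un)
  qed
  have loc: "\<exists>d>0. \<exists>k. \<forall>s t. x - d \<le> s \<and> s < t \<and> t \<le> x + d \<longrightarrow> euler_over (arc s t) k" for x
  proof -
    have b: "cis x \<in> sphere 0 1" by simp
    let ?F = "subtopology E {e \<in> topspace E. p e = cis x}"
    have "cis x \<in> topspace ?B" by simp
    note bspec[OF conjunct2[OF lt[unfolded locally_trivial_fibration_def]] this, folded R_def]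
    then obtain U h where U: "openin ?B U" "cis x \<in> U"
      and h: "homeomorphic_map (subtopology E (R U)) (prod_topology (subtopology ?B U) ?F) h"
      and fst_h: "\<And>e. e \<in> topspace E \<Longrightarrow> p e \<in> U \<Longrightarrow> fst (h e) = p e"
      by blast
    obtain k where k: "has_euler_characteristic ?F k" using fib[OF b] by blast
    obtain W where W: "open W" "U = sphere 0 1 \<inter> W" using U(1) by (auto simp: openin_open)
    have "open (cis -` W)" using W(1) by (intro open_vimage continuous_intros)
    moreover have "x \<in> cis -` W" using U(2) W(2) by simp
    ultimately obtain d where d: "d > 0" "ball x d \<subseteq> cis -` W"
      using openE by blast
    define \<delta> where "\<delta> = min d pi"
    have "euler_over (arc s t) k" if st: "x - \<delta> \<le> s" "s < t" "t \<le> x + \<delta>" for s t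
    proof -
      have "{s<..<t} \<subseteq> ball x d" using st by (auto simp: \<delta>_def dist_real_def)
      then have sub: "arc s t \<subseteq> U" using d(2) W(2) by (auto simp: arc_def)
      have "t - s \<le> 2 * pi" using st by (auto simp: \<delta>_def)
      then have con: "contractible_space (top_of_set (arc s t))"
        unfolding arc_def by (simp add: contractible_cis_image)
      have "h ` (topspace (subtopology E (R U)) \<inter> R (arc s t)) =
          topspace (prod_topology (subtopology ?B U) ?F) \<inter> (arc s t \<times> topspace ?F)"
        (is "?l = ?r")
      proof
        have surj: "h ` topspace (subtopology E (R U)) = topspace (prod_topology (subtopology ?B U) ?F)"
          using homeomorphic_imp_surjective_map[OF h] .
        show "?l \<subseteq> ?r"
        proof
          fix y assume "y \<in> ?l"
          then obtain e where e: "y = h e" "e \<in> topspace E" "p e \<in> U" "p e \<in> arc s t"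
            by (auto simp: R_def)
          then have "h e \<in> topspace (prod_topology (subtopology ?B U) ?F)"
            unfolding surj[symmetric] by (auto simp: R_def)
          then show "y \<in> ?r" using e fst_h[of e] by auto
        qed
        show "?r \<subseteq> ?l"
        proof
          fix y assume y: "y \<in> ?r"
          then obtain e where e: "y = h e" "e \<in> topspace (subtopology E (R U))"
            unfolding surj[symmetric] by blast
          then have "p e \<in> arc s t" using y fst_h[of e] by (auto simp: R_def)
          then show "y \<in> ?l" using e by (auto simp: R_def)
        qed
      qed
      from homeomorphic_map_subtopologies[OF h this]
      have "subtopology (subtopology E (R U)) (R (arc s t)) homeomorphic_space
          subtopology (prod_topology (subtopology ?B U) ?F) (arc s t \<times> topspace ?F)"
        unfolding homeomorphic_space using homeomorphic_map_imp_homeomorphic_space by blast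
      moreover have "subtopology (subtopology E (R U)) (R (arc s t)) = subtopology E (R (arc s t))"
        using sub by (auto simp: subtopology_subtopology R_def intro!: arg_cong[of _ _ "subtopology E"])
      moreover have "subtopology (prod_topology (subtopology ?B U) ?F) (arc s t \<times> topspace ?F) =
          prod_topology (top_of_set (arc s t)) ?F"
        using sub openin_subset[OF arc_open[of s t]]
        by (simp add: subtopology_Times subtopology_subtopology Int_absorb1 subtopology_topspace)
      ultimately have "subtopology E (R (arc s t)) homeomorphic_space prod_topology (top_of_set (arc s t)) ?F"
        by simp
      then have "subtopology E (R (arc s t)) homotopy_equivalent_space prod_topology (top_of_set (arc s t)) ?F"
        by (rule homeomorphic_imp_homotopy_equivalent_space)
      also have "prod_topology (top_of_set (arc s t)) ?F homotopy_equivalent_space ?F"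
        using st(2) by (intro prod_contractible_homotopy_equivalent con) (auto simp: arc_def)
      finally show ?thesis
        unfolding euler_over_def using has_euler_characteristic_homotopy_equivalent k
          homotopy_equivalent_space_sym by blast
    qed
    moreover have "\<delta> > 0" using d(1) by (simp add: \<delta>_def)
    ultimately show ?thesis by blast
  qed
  \<comment> \<open>The margin \<open>d\<close> makes the families for adjacent intervals overlap; arcs are at most one full turn,\<close>
  \<comment> \<open>so that \<^const>\<open>cis\<close> is injective on them and intersections can be computed on the line.\<close>
  define P where "P a b \<longleftrightarrow> (\<exists>d>0. \<exists>k. \<forall>s t. a - d \<le> s \<and> s < t \<and> t \<le> b + d \<and> t - s \<le> 2 * pi
    \<longrightarrow> euler_over (arc s t) k)" for a b
  have "- (pi / 2) \<le> 2 * pi" using pi_gt_zero by linarith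
  then have "P (- (pi / 2)) (2 * pi)"
  proof (induction rule: Bolzano)
    case (local x)
    obtain d k where d: "d > 0" "\<And>s t. x - d \<le> s \<Longrightarrow> s < t \<Longrightarrow> t \<le> x + d \<Longrightarrow> euler_over (arc s t) k"
      using loc[of x] by blast
    have "P a b" if "a \<le> x" "x \<le> b" "b - a < d / 2" for a b
      unfolding P_def
    proof (intro exI[of _ "d / 2"] exI[of _ k] conjI allI impI)
      fix s t assume st: "a - d / 2 \<le> s \<and> s < t \<and> t \<le> b + d / 2 \<and> t - s \<le> 2 * pi"
      show "euler_over (arc s t) k" using st that by (intro d(2)) (auto simp: field_simps)
    qed (use d in auto)
    then show ?case using d(1) by (intro exI[of _ "d / 2"]) auto
  next
    case (trans a b c)
    obtain d1 k1 where d1: "d1 > 0"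
      "\<And>s t. a - d1 \<le> s \<Longrightarrow> s < t \<Longrightarrow> t \<le> b + d1 \<Longrightarrow> t - s \<le> 2 * pi \<Longrightarrow> euler_over (arc s t) k1"
      using trans(1) unfolding P_def by blast
    obtain d2 k2 where d2: "d2 > 0"
      "\<And>s t. b - d2 \<le> s \<Longrightarrow> s < t \<Longrightarrow> t \<le> c + d2 \<Longrightarrow> t - s \<le> 2 * pi \<Longrightarrow> euler_over (arc s t) k2"
      using trans(2) unfolding P_def by blast
    define d where "d = min (min d1 d2) pi"
    have d: "d > 0" "d \<le> d1" "d \<le> d2" "d \<le> pi" using d1 d2 by (auto simp: d_def)
    have mid: "euler_over (arc (b - d) (b + d)) k1" "euler_over (arc (b - d) (b + d)) k2"
      using d trans(3,4) by (intro d1 d2; simp)+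
    have "k1 = k2"
      using mid has_euler_characteristic_unique unfolding euler_over_def by blast
    have "euler_over (arc s t) k1" if st: "a - d \<le> s" "s < t" "t \<le> c + d" "t - s \<le> 2 * pi" for s t
    proof -
      consider "t \<le> b + d" | "s \<ge> b - d" | "s < b - d" "t > b + d" by linarith
      then show ?thesis
      proof cases
        case 1
        then show ?thesis using st d by (intro d1) auto
      next
        case 2
        then show ?thesis unfolding \<open>k1 = k2\<close> using st d by (intro d2) auto
      next
        case 3
        have "euler_over (arc s (b + d)) k1" using st d 3 by (intro d1) auto
        moreover have "euler_over (arc (b - d) t) k1"
          unfolding \<open>k1 = k2\<close> using st d 3 by (intro d2) auto
        moreover have "arc s (b + d) \<inter> arc (b - d) t = arc (b - d) (b + d)"
        proof -
          have "cis ` ({s<..<b + d} \<inter> {b - d<..<t}) = cis ` {s<..<b + d} \<inter> cis ` {b - d<..<t}"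
            using 3 by (intro inj_on_image_Int[OF inj_on_cis_open_interval[OF st(4)]]) auto
          moreover have "{s<..<b + d} \<inter> {b - d<..<t} = {b - d<..<b + d}" using 3 by auto
          ultimately show ?thesis by (simp add: arc_def)
        qed
        moreover have "arc s (b + d) \<union> arc (b - d) t = arc s t"
        proof -
          have "{s<..<b + d} \<union> {b - d<..<t} = {s<..<t}" using 3 d by auto
          then show ?thesis by (simp add: arc_def image_Un[symmetric])
        qed
        ultimately show ?thesis
          using Un[OF arc_open arc_open, of s "b + d" k1 "b - d" t k1 k1] mid(1) by simp
      qed
    qed
    then show ?case unfolding P_def using d(1) by blast
  qed
  then obtain d k where d: "d > 0" and "\<And>s t. - (pi / 2) - d \<le> s \<Longrightarrow> s < t \<Longrightarrow> t \<le> 2 * pi + d \<Longrightarrow>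
      t - s \<le> 2 * pi \<Longrightarrow> euler_over (arc s t) k"
    unfolding P_def by blast
  then have k: "euler_over (arc s t) k"
    if "- (pi / 2) \<le> s" "s < t" "t \<le> 2 * pi" "t - s \<le> 2 * pi" for s t
    using that by simp
  \<comment> \<open>The circle without the point \<open>1\<close>, and a short arc around that point.\<close>
  let ?U = "arc 0 (2 * pi)" and ?V = "arc (- (pi / 2)) (pi / 2)"
  have one: "1 \<notin> ?U"
  proof
    assume "1 \<in> ?U"
    then obtain x where x: "0 < x" "x < 2 * pi" "cis x = 1" unfolding arc_def by force
    then have "cos x = 1" by (simp add: complex_eq_iff)
    then obtain n :: int where n: "x = of_int n * 2 * pi" using cos_one_2pi_int by blast
    with x(1,2) have "0 < real_of_int n" "real_of_int n < 1"
      by (auto simp: zero_less_mult_iff)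
    then have "0 < n" "n < 1" by simp_all
    then show False by simp
  qed
  have UV: "?U \<union> ?V = sphere 0 1"
  proof
    show "?U \<union> ?V \<subseteq> sphere 0 1" by (auto simp: arc_def)
    show "sphere 0 1 \<subseteq> ?U \<union> ?V"
    proof
      fix z :: complex assume z: "z \<in> sphere 0 1"
      then have eq: "cis (Arg2pi z) = z" using Arg2pi_eq[of z] by (simp add: cis_conv_exp)
      show "z \<in> ?U \<union> ?V"
      proof (cases "Arg2pi z = 0")
        case True
        then show ?thesis using eq by (auto simp: arc_def intro!: image_eqI[of _ _ 0])
      next
        case False
        then have "0 < Arg2pi z" "Arg2pi z < 2 * pi"
          using Arg2pi_ge_0[of z] Arg2pi_lt_2pi[of z] by auto
        then show ?thesis using eq by (auto simp: arc_def intro!: image_eqI[of _ _ "Arg2pi z"])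
      qed
    qed
  qed
  let ?L = "arc (- (pi / 2)) 0" and ?R = "arc 0 (pi / 2)"
  have V: "?V = insert 1 (?L \<union> ?R)"
  proof -
    have "{- (pi / 2)<..<pi / 2} = insert 0 ({- (pi / 2)<..<0} \<union> {0<..<pi / 2})" by auto
    then show ?thesis by (simp add: arc_def image_Un)
  qed
  have inj: "inj_on cis {- (pi / 2)<..<pi / 2}" by (intro inj_on_cis_open_interval) auto
  have RU: "?R \<subseteq> ?U" unfolding arc_def by (intro image_mono) auto
  have LU: "?L \<subseteq> ?U"
  proof
    fix z assume "z \<in> ?L"
    then obtain x where "z = cis x" "- (pi / 2) < x" "x < 0" by (auto simp: arc_def)
    moreover have "cis x = cis (x + 2 * pi)" by (simp add: complex_eq_iff)
    ultimately show "z \<in> ?U" unfolding arc_def by (intro image_eqI[of _ _ "x + 2 * pi"]) auto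
  qed
  have int: "?U \<inter> ?V = ?L \<union> ?R" using one RU LU unfolding V by blast
  have "?L \<inter> ?R = {}"
  proof -
    have "cis ` ({- (pi / 2)<..<0} \<inter> {0<..<pi / 2}) = cis ` {- (pi / 2)<..<0} \<inter> cis ` {0<..<pi / 2}"
      by (intro inj_on_image_Int[OF inj]) auto
    then show ?thesis by (auto simp: arc_def)
  qed
  moreover have "euler_over {} 0"
    unfolding euler_over_def by (rule has_euler_characteristic_empty) (simp add: R_def)
  ultimately have "euler_over (?L \<union> ?R) (k + k - 0)"
    by (intro Un arc_open k) auto
  then have "euler_over (?U \<union> ?V) (k + k - (k + k))"
    by (intro Un arc_open k) (auto simp: int)
  then have "has_euler_characteristic (subtopology E (R (sphere 0 1))) 0" by (simp add: UV euler_over_def)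
  moreover have "R (sphere 0 1) = topspace E" using pE by (auto simp: R_def)
  ultimately show ?thesis by simp
qed

section \<open>Moebius maps acting on sums of unit vectors\<close>

definition moebius :: "complex \<Rightarrow> complex \<Rightarrow> complex" where
  "moebius l z = (z + l) / (1 + cnj l * z)"

lemma moebius_denominator_norm:
  assumes "cmod z = 1"
  shows "1 - cmod l \<le> cmod (1 + cnj l * z)"
proof -
  have "cmod 1 - cmod (cnj l * z) \<le> cmod (1 + cnj l * z)" by (rule norm_diff_ineq)
  then show ?thesis using assms by (simp add: norm_mult)
qed

lemma moebius_denominator_nonzero: "cmod z = 1 \<Longrightarrow> cmod l < 1 \<Longrightarrow> 1 + cnj l * z \<noteq> 0"
  using moebius_denominator_norm[of z l] by auto

lemma moebius_0 [simp]: "moebius 0 z = z"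
  by (simp add: moebius_def)

lemma norm_moebius:
  assumes "cmod z = 1" "cmod l < 1"
  shows "cmod (moebius l z) = 1"
proof -
  have zz: "z * cnj z = 1" using assms(1) complex_norm_square[of z] by simp
  have "z + l = z * cnj (1 + cnj l * z)" using zz by (simp add: algebra_simps)
  then have "cmod (z + l) = cmod (1 + cnj l * z)"
    using assms(1) by (metis complex_mod_cnj mult_1 norm_mult)
  then show ?thesis
    using moebius_denominator_nonzero[OF assms] by (simp add: moebius_def norm_divide)
qed

lemma moebius_inverse:
  assumes "cmod z = 1" "cmod l < 1"
  shows "moebius (- l) (moebius l z) = z"
proof -
  let ?D = "1 + cnj l * z"
  have D: "?D \<noteq> 0" by (rule moebius_denominator_nonzero[OF assms])
  have E: "1 - cnj l * l \<noteq> 0"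
  proof
    assume "1 - cnj l * l = 0"
    then have "complex_of_real ((cmod l)\<^sup>2) = 1" using complex_norm_square[of l] by (simp add: mult.commute)
    then have "(cmod l)\<^sup>2 = 1" using of_real_eq_1_iff by blast
    then show False using assms(2) norm_ge_zero[of l] by (auto simp: power2_eq_1_iff)
  qed
  have num: "moebius l z - l = z * (1 - cnj l * l) / ?D"
    using D by (simp add: moebius_def divide_simps) (simp add: algebra_simps)
  have den: "1 - cnj l * moebius l z = (1 - cnj l * l) / ?D"
    using D by (simp add: moebius_def divide_simps) (simp add: algebra_simps)
  have "moebius (- l) (moebius l z) = (moebius l z - l) / (1 - cnj l * moebius l z)"
    unfolding moebius_def[of "- l"] by simp
  also have "\<dots> = z" unfolding num den using D E by simp
  finally show ?thesis .
qed

text \<open>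
  To first order \<open>moebius l z - moebius m z\<close> is \<open>(l - m) - cnj (l - m) * z\<^sup>2\<close>, uniformly in \<open>z\<close>. The constant
  is crude: with \<open>T\<close> the linear part, the exact difference is \<open>(T + N) / D\<close>, where \<open>N\<close> and \<open>D - 1\<close> are
  of order \<open>r\<close> and \<open>D\<close> has modulus at least a quarter.
\<close>

lemma moebius_linearization:
  assumes z: "cmod z = 1" and r: "r \<le> 1 / 2" and l: "cmod l \<le> r" and m: "cmod m \<le> r"
  shows "cmod (moebius l z - moebius m z - ((l - m) - cnj (l - m) * z\<^sup>2)) \<le> 32 * r * cmod (l - m)"
proof -
  define d where "d = l - m"
  define D where "D = (1 + cnj l * z) * (1 + cnj m * z)"
  define T where "T = d - cnj d * z\<^sup>2"
  define N where "N = z * (d * cnj m - cnj d * m)"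
  have r0: "0 \<le> r" using l norm_ge_zero[of l] by linarith
  have half: "1 / 2 \<le> cmod (1 + cnj l * z)" "1 / 2 \<le> cmod (1 + cnj m * z)"
    using moebius_denominator_norm[OF z, of l] moebius_denominator_norm[OF z, of m] r l m by linarith+
  then have "1 / 2 * (1 / 2) \<le> cmod D" unfolding D_def norm_mult by (intro mult_mono) auto
  then have D: "1 / 4 \<le> cmod D" "D \<noteq> 0" by auto
  have "moebius l z - moebius m z = (T + N) / D"
    using half unfolding D_def T_def N_def d_def moebius_def
    by (auto simp: divide_simps) (auto simp: algebra_simps power2_eq_square)
  then have eq: "moebius l z - moebius m z - T = (N - T * (D - 1)) / D"
    using D(2) by (simp add: divide_simps) (simp add: algebra_simps)
  have N: "cmod N \<le> 2 * r * cmod d"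
  proof -
    have "cmod N \<le> cmod (d * cnj m) + cmod (cnj d * m)"
      unfolding N_def norm_mult z using norm_triangle_ineq4[of "d * cnj m" "cnj d * m"]
      by (simp add: norm_mult)
    also have "\<dots> = 2 * cmod m * cmod d" by (simp add: norm_mult)
    also have "\<dots> \<le> 2 * r * cmod d" using m by (intro mult_right_mono) auto
    finally show ?thesis .
  qed
  have T: "cmod T \<le> 2 * cmod d"
    unfolding T_def using norm_triangle_ineq4[of d "cnj d * z\<^sup>2"] z by (simp add: norm_mult norm_power)
  have D1: "cmod (D - 1) \<le> 3 * r"
  proof -
    have "D - 1 = cnj l * z + cnj m * z + cnj l * z * (cnj m * z)"
      by (simp add: D_def algebra_simps)
    then have "cmod (D - 1) \<le> cmod (cnj l * z) + cmod (cnj m * z) + cmod (cnj l * z * (cnj m * z))"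
      using norm_triangle_ineq[of "cnj l * z + cnj m * z" "cnj l * z * (cnj m * z)"]
        norm_triangle_ineq[of "cnj l * z" "cnj m * z"] by simp
    also have "\<dots> = cmod l + cmod m + cmod l * cmod m" using z by (simp add: norm_mult)
    also have "\<dots> \<le> r + r + 1 * r" using l m r by (intro add_mono mult_mono) auto
    finally show ?thesis by simp
  qed
  have "cmod (N - T * (D - 1)) \<le> cmod N + cmod T * cmod (D - 1)"
    using norm_triangle_ineq4[of N "T * (D - 1)"] by (simp add: norm_mult)
  also have "\<dots> \<le> 2 * r * cmod d + 2 * cmod d * (3 * r)"
    using N T D1 r0 by (intro add_mono mult_mono) auto
  finally have num: "cmod (N - T * (D - 1)) \<le> 8 * r * cmod d" by simp
  have "cmod (moebius l z - moebius m z - T) = cmod (N - T * (D - 1)) / cmod D"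
    unfolding eq by (simp add: norm_divide)
  also have "\<dots> \<le> (8 * r * cmod d) / (1 / 4)"
    using num D r0 by (intro frac_le) auto
  finally show ?thesis by (simp add: T_def d_def)
qed

definition moebius_sum :: "nat \<Rightarrow> (nat \<Rightarrow> complex) \<Rightarrow> complex \<Rightarrow> complex" where
  "moebius_sum n u l = (\<Sum>j<n. moebius l (u j))"

lemma moebius_sum_linearization:
  assumes "\<And>j. j < n \<Longrightarrow> cmod (u j) = 1" "r \<le> 1 / 2" "cmod l \<le> r" "cmod m \<le> r"
  shows "cmod (moebius_sum n u l - moebius_sum n u m -
      (of_nat n * (l - m) - (\<Sum>j<n. (u j)\<^sup>2) * cnj (l - m))) \<le> 32 * real n * r * cmod (l - m)"
proof -
  have "moebius_sum n u l - moebius_sum n u m - (of_nat n * (l - m) - (\<Sum>j<n. (u j)\<^sup>2) * cnj (l - m)) =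
      (\<Sum>j<n. moebius l (u j) - moebius m (u j) - ((l - m) - cnj (l - m) * (u j)\<^sup>2))"
    by (simp add: moebius_sum_def sum_subtractf sum_distrib_left sum_distrib_right mult.commute)
  also have "cmod \<dots> \<le> (\<Sum>j<n. 32 * r * cmod (l - m))"
    using assms by (intro sum_norm_le moebius_linearization) auto
  finally show ?thesis by (simp add: mult_ac)
qed

text \<open>
  The linear part expands by at least \<open>n - \<bar>q\<bar> \<ge> \<eta>\<close>, where \<open>q\<close> is the sum of the squares, and for this
  small \<open>r\<close> the error is at most half of that.
\<close>

lemma moebius_sum_lower_bound:
  assumes "\<And>j. j < n \<Longrightarrow> cmod (u j) = 1" "r \<le> 1 / 2" "cmod l \<le> r" "cmod m \<le> r"
    and \<eta>: "\<eta> \<le> real n - cmod (\<Sum>j<n. (u j)\<^sup>2)" "64 * real n * r \<le> \<eta>"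
  shows "\<eta> / 2 * cmod (l - m) \<le> cmod (moebius_sum n u l - moebius_sum n u m)"
proof -
  let ?q = "\<Sum>j<n. (u j)\<^sup>2"
  let ?L = "of_nat n * (l - m) - ?q * cnj (l - m)"
  let ?S = "moebius_sum n u l - moebius_sum n u m"
  have "\<eta> * cmod (l - m) \<le> (real n - cmod ?q) * cmod (l - m)" using \<eta> by (intro mult_right_mono) auto
  also have "\<dots> = cmod (of_nat n * (l - m)) - cmod (?q * cnj (l - m))"
    by (simp only: norm_mult complex_mod_cnj norm_of_nat left_diff_distrib)
  also have "\<dots> \<le> cmod ?L" by (rule norm_triangle_ineq2)
  finally have 1: "\<eta> * cmod (l - m) \<le> cmod ?L" .
  have "cmod (?S - ?L) \<le> 32 * real n * r * cmod (l - m)"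
    using moebius_sum_linearization[OF assms(1-4)] .
  also have "\<dots> \<le> \<eta> / 2 * cmod (l - m)" using \<eta>(2) by (intro mult_right_mono) auto
  finally have 2: "cmod (?S - ?L) \<le> \<eta> / 2 * cmod (l - m)" .
  have "cmod ?L \<le> cmod ?S + cmod (?S - ?L)"
    using norm_triangle_ineq4[of ?S "?S - ?L"] by simp
  with 1 2 show ?thesis by (simp add: field_simps)
qed

text \<open>
  Brouwer's fixed point theorem for one step of a simplified Newton iteration. The real-linear map
  \<open>x \<mapsto> n * x - q * cnj x\<close> has determinant \<open>n\<^sup>2 - \<bar>q\<bar>\<^sup>2\<close>, and \<open>L_inv\<close> in the proof is its inverse.
\<close>

lemma moebius_sum_surjective:
  assumes u: "\<And>j. j < n \<Longrightarrow> cmod (u j) = 1" and r: "0 < r" "r \<le> 1 / 2"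
    and \<eta>: "0 < \<eta>" "\<eta> \<le> real n - cmod (\<Sum>j<n. (u j)\<^sup>2)" "64 * real n * r \<le> \<eta>"
    and P: "cmod (P - (\<Sum>j<n. u j)) \<le> \<eta> * r / 2"
  shows "\<exists>l. cmod l \<le> r \<and> moebius_sum n u l = P"
proof -
  let ?q = "\<Sum>j<n. (u j)\<^sup>2"
  define A where "A = complex_of_real ((real n)\<^sup>2 - (cmod ?q)\<^sup>2)"
  define L_inv where "L_inv x = (of_nat n * x + ?q * cnj x) / A" for x
  have A_factor: "(real n)\<^sup>2 - (cmod ?q)\<^sup>2 = (real n - cmod ?q) * (real n + cmod ?q)"
    by (simp add: power2_eq_square algebra_simps)
  have pos: "0 < real n - cmod ?q" using \<eta> by linarith
  then have npos: "0 < real n + cmod ?q" using norm_ge_zero[of ?q] by linarith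
  have A_pos: "0 < (real n)\<^sup>2 - (cmod ?q)\<^sup>2" unfolding A_factor using pos npos by simp
  then have A0: "A \<noteq> 0" unfolding A_def of_real_eq_0_iff by linarith
  have A_eq: "A = of_nat n * of_nat n - ?q * cnj ?q"
    unfolding A_def of_real_diff complex_norm_square by (simp add: power2_eq_square)
  have inv_L: "L_inv (of_nat n * x - ?q * cnj x) = x" for x
  proof -
    have "of_nat n * (of_nat n * x - ?q * cnj x) + ?q * cnj (of_nat n * x - ?q * cnj x) = A * x"
      unfolding A_eq by (simp add: algebra_simps del: cnj_sum)
    then show ?thesis unfolding L_inv_def by (simp only: nonzero_mult_div_cancel_left[OF A0])
  qed
  have L_L_inv: "of_nat n * L_inv x - ?q * cnj (L_inv x) = x" for x
  proof -
    have "cnj A = A" by (simp add: A_def)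
    then have "of_nat n * L_inv x - ?q * cnj (L_inv x) =
        (of_nat n * (of_nat n * x + ?q * cnj x) - ?q * (of_nat n * cnj x + cnj ?q * x)) / A"
      by (simp add: L_inv_def diff_divide_distrib del: cnj_sum)
    also have "\<dots> = A * x / A" unfolding A_eq by (simp add: algebra_simps del: cnj_sum)
    finally show ?thesis using A0 by simp
  qed
  have inv_add: "L_inv (x + y) = L_inv x + L_inv y" for x y
    by (simp add: L_inv_def add_divide_distrib algebra_simps)
  have norm_inv: "cmod (L_inv x) \<le> cmod x / \<eta>" for x
  proof -
    have tri: "cmod (of_nat n * x + ?q * cnj x) \<le> (real n + cmod ?q) * cmod x"
      using norm_triangle_ineq[of "of_nat n * x" "?q * cnj x"] by (simp add: norm_mult algebra_simps)
    have A_norm: "cmod A = (real n - cmod ?q) * (real n + cmod ?q)"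
      unfolding A_def norm_of_real using A_pos A_factor by simp
    have "cmod (L_inv x) = cmod (of_nat n * x + ?q * cnj x) / cmod A"
      unfolding L_inv_def by (rule norm_divide)
    also have "\<dots> \<le> ((real n + cmod ?q) * cmod x) / cmod A"
      by (rule divide_right_mono[OF tri]) simp
    also have "\<dots> = cmod x / (real n - cmod ?q)" unfolding A_norm using pos npos by simp
    also have "\<dots> \<le> cmod x / \<eta>" using \<eta> by (intro divide_left_mono) auto
    finally show ?thesis .
  qed
  define h where "h l = l - L_inv (moebius_sum n u l - P)" for l
  have "continuous_on (cball 0 r) (moebius_sum n u)"
    unfolding moebius_sum_def moebius_def
    using u r moebius_denominator_nonzero by (intro continuous_intros) auto
  then have "continuous_on (cball 0 r) h"
    unfolding h_def L_inv_def using A0 by (intro continuous_intros) auto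
  moreover have "h l \<in> cball 0 r" if "l \<in> cball 0 r" for l
  proof -
    let ?S0 = "\<Sum>j<n. u j"
    have S0: "moebius_sum n u 0 = ?S0" by (simp add: moebius_sum_def)
    let ?x = "of_nat n * l - ?q * cnj l"
    have "h l = L_inv (?x + - (moebius_sum n u l - P))"
      unfolding h_def inv_add inv_L by (simp add: L_inv_def algebra_simps diff_divide_distrib add_divide_distrib)
    also have "?x + - (moebius_sum n u l - P) =
        - (moebius_sum n u l - moebius_sum n u 0 - (of_nat n * (l - 0) - ?q * cnj (l - 0))) + (P - ?S0)"
      by (simp add: S0)
    finally have "cmod (h l) \<le> cmod (- (moebius_sum n u l - moebius_sum n u 0 -
        (of_nat n * (l - 0) - ?q * cnj (l - 0))) + (P - ?S0)) / \<eta>"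
      using norm_inv by simp
    also have "\<dots> \<le> (32 * real n * r * cmod (l - 0) + \<eta> * r / 2) / \<eta>"
    proof (intro divide_right_mono norm_triangle_le add_mono P)
      show "cmod (- (moebius_sum n u l - moebius_sum n u 0 - (of_nat n * (l - 0) - ?q * cnj (l - 0))))
          \<le> 32 * real n * r * cmod (l - 0)"
        unfolding norm_minus_cancel using u r that by (intro moebius_sum_linearization) auto
    qed (use \<eta> in auto)
    also have "\<dots> \<le> (\<eta> / 2 * r + \<eta> * r / 2) / \<eta>"
    proof (intro divide_right_mono add_mono)
      show "32 * real n * r * cmod (l - 0) \<le> \<eta> / 2 * r"
        using that \<eta> r by (intro mult_mono) auto
    qed (use \<eta> in auto)
    also have "\<dots> = r" using \<eta>(1) by (simp add: field_simps)
    finally show ?thesis by simp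
  qed
  ultimately obtain l where l: "l \<in> cball 0 r" "h l = l"
    using brouwer_ball[OF r(1), of 0 h] by blast
  then have "L_inv (moebius_sum n u l - P) = 0" by (simp add: h_def)
  with L_L_inv[of "moebius_sum n u l - P"] have "moebius_sum n u l = P" by simp
  with l(1) show ?thesis by auto
qed

text \<open>
  Turn the vectors so that the sum \<open>q\<close> of their squares becomes nonnegative. Then \<open>n - \<bar>q\<bar>\<close> is twice the
  sum of the squared imaginary parts, so each vector is within the square root of \<open>n - \<bar>q\<bar>\<close> of \<open>1\<close> or \<open>-1\<close>,
  and a sum of \<open>n\<close> signs is an integer of the parity of \<open>n\<close>.
\<close>

lemma near_collinear_sum:
  fixes u :: "nat \<Rightarrow> complex"
  assumes u: "\<And>j. j < n \<Longrightarrow> cmod (u j) = 1"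
  shows "\<exists>k::int. even k = even n \<and>
    \<bar>cmod (\<Sum>j<n. u j) - real_of_int k\<bar> \<le> real n * sqrt (real n - cmod (\<Sum>j<n. (u j)\<^sup>2))"
proof -
  let ?q = "\<Sum>j<n. (u j)\<^sup>2"
  let ?\<eta> = "real n - cmod ?q"
  define c where "c = cis (- Arg ?q / 2)"
  have c: "cmod c = 1" "?q * c\<^sup>2 = of_real (cmod ?q)"
  proof -
    have "?q * c\<^sup>2 = of_real (cmod ?q) * cis (Arg ?q) * cis (- Arg ?q)"
    proof -
      have "c\<^sup>2 = cis (- Arg ?q)" by (simp add: c_def Complex.DeMoivre)
      moreover have "?q = of_real (cmod ?q) * cis (Arg ?q)" by (metis rcis_cmod_Arg rcis_def)
      ultimately show ?thesis by simp
    qed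
    also have "\<dots> = of_real (cmod ?q)" by (simp add: cis_mult mult.assoc)
    finally show "?q * c\<^sup>2 = of_real (cmod ?q)" .
  qed (simp add: c_def)
  define v where "v j = u j * c" for j
  have v: "cmod (v j) = 1" if "j < n" for j using u that c by (simp add: v_def norm_mult)
  have "(\<Sum>j<n. (v j)\<^sup>2) = ?q * c\<^sup>2" by (simp add: v_def power_mult_distrib sum_distrib_right)
  then have "Re (\<Sum>j<n. (v j)\<^sup>2) = cmod ?q" using c by simp
  then have sum_re: "(\<Sum>j<n. 1 - Re ((v j)\<^sup>2)) = ?\<eta>" by (simp add: sum_subtractf)
  define s :: "nat \<Rightarrow> int" where "s j = (if Re (v j) \<ge> 0 then 1 else -1)" for j
  have dev: "(cmod (v j - of_int (s j)))\<^sup>2 \<le> 1 - Re ((v j)\<^sup>2)" if "j < n" for j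
  proof -
    let ?x = "Re (v j)" and ?y = "Im (v j)"
    have xy: "?x\<^sup>2 + ?y\<^sup>2 = 1" using v[OF that] by (metis cmod_power2 power_one)
    then have x1: "\<bar>?x\<bar> \<le> 1" by (metis abs_square_le_1 le_add_same_cancel1 zero_le_power2)
    have "(cmod (v j - of_int (s j)))\<^sup>2 = (\<bar>?x\<bar> - 1)\<^sup>2 + ?y\<^sup>2"
      by (simp add: cmod_power2 s_def) (simp add: power2_eq_square algebra_simps)
    also have "\<dots> = 2 - 2 * \<bar>?x\<bar>" using xy by (simp add: power2_diff)
    also have "\<dots> \<le> 2 - 2 * (\<bar>?x\<bar> * \<bar>?x\<bar>)"
      using mult_right_mono[OF x1, of "\<bar>?x\<bar>"] by linarith
    also have "\<dots> = 1 - Re ((v j)\<^sup>2)" using xy by (simp add: power2_eq_square)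
    finally show ?thesis .
  qed
  have each: "cmod (v j - of_int (s j)) \<le> sqrt ?\<eta>" if "j < n" for j
  proof (rule real_le_rsqrt)
    have "(cmod (v j - of_int (s j)))\<^sup>2 \<le> 1 - Re ((v j)\<^sup>2)" by (rule dev[OF that])
    also have "\<dots> \<le> (\<Sum>j<n. 1 - Re ((v j)\<^sup>2))"
    proof (rule member_le_sum)
      fix i assume "i \<in> {..<n} - {j}"
      then have "i < n" by simp
      show "0 \<le> 1 - Re ((v i)\<^sup>2)" by (rule order_trans[OF zero_le_power2 dev[OF \<open>i < n\<close>]])
    qed (use that in auto)
    finally show "(cmod (v j - of_int (s j)))\<^sup>2 \<le> ?\<eta>" unfolding sum_re .
  qed
  let ?k = "\<bar>\<Sum>j<n. s j\<bar>"
  have "even (\<Sum>j<m. s j) = even m" for m by (induction m) (auto simp: s_def)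
  then have par: "even ?k = even n" by simp
  have "cmod (\<Sum>j<n. u j) = cmod (\<Sum>j<n. v j)"
    using c by (simp add: v_def sum_distrib_right[symmetric] norm_mult)
  moreover have "real_of_int ?k = cmod (of_int (\<Sum>j<n. s j))" by (simp only: norm_of_int of_int_abs)
  ultimately have "\<bar>cmod (\<Sum>j<n. u j) - real_of_int ?k\<bar> \<le> cmod ((\<Sum>j<n. v j) - of_int (\<Sum>j<n. s j))"
    using norm_triangle_ineq3[of "\<Sum>j<n. v j" "of_int (\<Sum>j<n. s j)"] by (simp only:)
  also have "\<dots> = cmod (\<Sum>j<n. v j - of_int (s j))" by (simp add: sum_subtractf)
  also have "\<dots> \<le> (\<Sum>j<n. sqrt ?\<eta>)" using each by (intro sum_norm_le) auto
  also have "\<dots> = real n * sqrt ?\<eta>" by simp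
  finally show ?thesis using par by (intro exI conjI)
qed

text \<open>
  A sum of \<open>n\<close> signs has the parity of \<open>n\<close>. So this keeps every chain of \<open>n\<close> unit edges from \<open>0\<close> to \<open>P\<close>
  from lying on a line.
\<close>

definition noncollinear_value :: "nat \<Rightarrow> complex \<Rightarrow> bool" where
  "noncollinear_value n P \<longleftrightarrow> (\<forall>k::int. even k = even n \<longrightarrow> cmod P \<noteq> real_of_int k)"

text \<open>
  By \<open>near_collinear_sum\<close>, the distance from \<open>\<bar>P\<bar>\<close> to the integers of the forbidden parity bounds \<open>n - \<bar>q\<bar>\<close>
  away from \<open>0\<close> for all sums near \<open>P\<close>. So one radius \<open>r\<close> and one expansion constant \<open>\<kappa>\<close> serve all
  of them.
\<close>

lemma moebius_chart:
  assumes n: "n > 0" and P: "noncollinear_value n P"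
  obtains \<epsilon> r \<kappa> where "\<epsilon> > 0" "0 < r" "r < 1" "\<kappa> > 0"
    "\<And>u l m. (\<And>j. j < n \<Longrightarrow> cmod (u j) = 1) \<Longrightarrow> cmod ((\<Sum>j<n. u j) - P) < \<epsilon> \<Longrightarrow>
       cmod l \<le> r \<Longrightarrow> cmod m \<le> r \<Longrightarrow>
       \<kappa> * cmod (l - m) \<le> cmod (moebius_sum n u l - moebius_sum n u m)"
    "\<And>u Q. (\<And>j. j < n \<Longrightarrow> cmod (u j) = 1) \<Longrightarrow> cmod ((\<Sum>j<n. u j) - P) < \<epsilon> \<Longrightarrow>
       cmod (Q - P) < \<epsilon> \<Longrightarrow> \<exists>l. cmod l \<le> r \<and> moebius_sum n u l = Q"
proof -
  let ?K = "real_of_int ` {k. even k = even n}"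
  have "closed ?K" by (rule closed_of_int_image)
  moreover have "cmod P \<notin> ?K" using P by (auto simp: noncollinear_value_def)
  ultimately have "\<exists>d>0. \<forall>x\<in>?K. d \<le> dist (cmod P) x" by (rule separate_point_closed)
  then obtain e where e: "e > 0" "\<And>x. x \<in> ?K \<Longrightarrow> e \<le> dist (cmod P) x" by metis
  define \<eta> where "\<eta> = (e / 2 / real n)\<^sup>2"
  define r where "r = min (1 / 2) (\<eta> / (64 * real n))"
  define \<epsilon> where "\<epsilon> = min (e / 2) (\<eta> * r / 4)"
  have \<eta>0: "\<eta> > 0" using e n by (simp add: \<eta>_def)
  have r: "r > 0" "r \<le> 1 / 2" using \<eta>0 n by (simp_all add: r_def)
  have "r \<le> \<eta> / (64 * real n)" by (simp add: r_def)
  then have r_le: "64 * real n * r \<le> \<eta>" using n by (simp add: pos_le_divide_eq mult_ac)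
  have \<epsilon>: "\<epsilon> > 0" "\<epsilon> \<le> e / 2" "\<epsilon> \<le> \<eta> * r / 4" using e(1) \<eta>0 r by (auto simp: \<epsilon>_def)
  have \<eta>: "\<eta> \<le> real n - cmod (\<Sum>j<n. (u j)\<^sup>2)"
    if u: "\<And>j. j < n \<Longrightarrow> cmod (u j) = 1" "cmod ((\<Sum>j<n. u j) - P) < \<epsilon>" for u
  proof -
    let ?x = "real n - cmod (\<Sum>j<n. (u j)\<^sup>2)"
    have "\<exists>k::int. even k = even n \<and> \<bar>cmod (\<Sum>j<n. u j) - real_of_int k\<bar> \<le> real n * sqrt ?x"
      by (rule near_collinear_sum) (rule u(1))
    then obtain k :: int where k: "even k = even n"
      "\<bar>cmod (\<Sum>j<n. u j) - real_of_int k\<bar> \<le> real n * sqrt ?x" by (elim exE conjE)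
    have "e \<le> \<bar>cmod P - real_of_int k\<bar>" using e(2)[of "real_of_int k"] k(1) by (simp add: dist_real_def)
    moreover have "\<bar>cmod (\<Sum>j<n. u j) - cmod P\<bar> < e / 2"
      using u(2) \<epsilon>(2) norm_triangle_ineq3[of "\<Sum>j<n. u j" P] by linarith
    ultimately have "e / 2 \<le> real n * sqrt ?x" using k(2) by linarith
    then have "e / 2 / real n \<le> sqrt ?x" using n by (simp add: field_simps)
    then have "\<eta> \<le> (sqrt ?x)\<^sup>2" unfolding \<eta>_def using e(1) by (intro power_mono) auto
    moreover have "0 \<le> ?x"
    proof -
      have "cmod (\<Sum>j<n. (u j)\<^sup>2) \<le> (\<Sum>j<n. 1)" using u(1) by (intro sum_norm_le) (simp add: norm_power)
      then show ?thesis by simp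
    qed
    ultimately show ?thesis by simp
  qed
  show ?thesis
  proof (rule that[of \<epsilon> r "\<eta> / 2"])
    fix u l m
    assume u: "\<And>j. j < n \<Longrightarrow> cmod (u j) = 1" "cmod ((\<Sum>j<n. u j) - P) < \<epsilon>"
      and lm: "cmod l \<le> r" "cmod m \<le> r"
    show "\<eta> / 2 * cmod (l - m) \<le> cmod (moebius_sum n u l - moebius_sum n u m)"
      using moebius_sum_lower_bound[OF u(1) r(2) lm \<eta>[OF u] r_le] .
  next
    fix u Q
    assume u: "\<And>j. j < n \<Longrightarrow> cmod (u j) = 1" "cmod ((\<Sum>j<n. u j) - P) < \<epsilon>" and Q: "cmod (Q - P) < \<epsilon>"
    have "cmod (Q - (\<Sum>j<n. u j)) \<le> cmod (Q - P) + cmod ((\<Sum>j<n. u j) - P)"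
      using norm_triangle_ineq4[of "Q - P" "(\<Sum>j<n. u j) - P"] by simp
    then have "cmod (Q - (\<Sum>j<n. u j)) \<le> \<eta> * r / 2" using u(2) Q \<epsilon>(3) by linarith
    then show "\<exists>l. cmod l \<le> r \<and> moebius_sum n u l = Q"
      using moebius_sum_surjective[OF u(1) r(1,2) \<eta>0 \<eta>[OF u] r_le] by blast
  qed (use \<epsilon> r \<eta>0 in auto)
qed

section \<open>Local triviality of the endpoint map of a chain\<close>

lemma continuous_on_apply_fun [continuous_intros]:
  "continuous_on S (\<lambda>y. (y :: 'i \<Rightarrow> 'b::topological_space) i)"
  by (rule continuous_on_subset[OF continuous_on_product_coordinates]) auto

definition chain_fibre :: "nat \<Rightarrow> complex \<Rightarrow> vertices set" where
  "chain_fibre n P = {y \<in> linkage_configs (replicate n 1). y 0 = 0 \<and> y n = P}"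

definition edge :: "vertices \<Rightarrow> nat \<Rightarrow> complex" where
  "edge y j = y (Suc j) - y j"

definition chain_of_edges :: "nat \<Rightarrow> (nat \<Rightarrow> complex) \<Rightarrow> vertices" where
  "chain_of_edges n u = (\<lambda>i\<in>{..n}. \<Sum>j<i. u j)"

lemma chain_fibre_iff:
  "y \<in> chain_fibre n P \<longleftrightarrow>
     y \<in> extensional {..n} \<and> (\<forall>j<n. cmod (edge y j) = 1) \<and> y 0 = 0 \<and> y n = P"
  by (auto simp: chain_fibre_def linkage_configs_def edge_def PiE_def dist_norm norm_minus_commute)

lemma edge_chain_of_edges: "j < n \<Longrightarrow> edge (chain_of_edges n u) j = u j"
  by (simp add: edge_def chain_of_edges_def)

lemma chain_of_edges_in_fibre:
  assumes "\<And>j. j < n \<Longrightarrow> cmod (u j) = 1"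
  shows "chain_of_edges n u \<in> chain_fibre n (\<Sum>j<n. u j)"
  unfolding chain_fibre_iff using assms by (auto simp: edge_chain_of_edges) (auto simp: chain_of_edges_def)

lemma sum_edges: "y 0 = 0 \<Longrightarrow> (\<Sum>j<i. edge y j) = y i"
  by (simp add: edge_def sum_lessThan_telescope)

lemma chain_of_edges_edge:
  assumes "y \<in> chain_fibre n P" "\<And>j. j < n \<Longrightarrow> u j = edge y j"
  shows "chain_of_edges n u = y"
proof
  fix i
  have "(\<Sum>j<i. u j) = y i" if "i \<le> n"
    using assms that by (subst sum_edges[symmetric]) (auto simp: chain_fibre_iff intro!: sum.cong)
  then show "chain_of_edges n u i = y i"
    using assms(1) by (auto simp: chain_of_edges_def chain_fibre_iff extensional_def)
qed

text \<open>
  A closed subset of a product of discs; the coordinates above \<open>n\<close> are frozen at \<^const>\<open>undefined\<close>.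
\<close>

lemma compact_chain_fibre: "compact (chain_fibre n P)"
proof -
  define B :: "nat \<Rightarrow> complex set" where "B i = (if i \<le> n then cball 0 (real n) else {undefined})" for i
  have "compactin (product_topology (\<lambda>_. euclidean) UNIV) (PiE UNIV B)"
    by (simp add: compactin_PiE B_def)
  then have comp: "compact (PiE UNIV B)" by (simp add: euclidean_product_topology)
  have "closed ({y. \<forall>j<n. cmod (edge y j) = 1} \<inter> {y. y 0 = 0} \<inter> {y. y n = P})"
    unfolding edge_def
    by (intro closed_Int closed_Collect_all closed_Collect_imp closed_Collect_eq open_Collect_const
        continuous_intros)
  then have "compact (PiE UNIV B \<inter> ({y. \<forall>j<n. cmod (edge y j) = 1} \<inter> {y. y 0 = 0} \<inter> {y. y n = P}))"
    by (rule compact_Int_closed[OF comp])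
  also have "PiE UNIV B \<inter> ({y. \<forall>j<n. cmod (edge y j) = 1} \<inter> {y. y 0 = 0} \<inter> {y. y n = P}) = chain_fibre n P"
  proof -
    have "y \<in> PiE UNIV B" if y: "y \<in> chain_fibre n P" for y
    proof -
      have "cmod (y i) \<le> real n" if "i \<le> n" for i
      proof -
        have "cmod (\<Sum>j<i. edge y j) \<le> (\<Sum>j<i. 1)"
          using y that by (intro sum_norm_le) (auto simp: chain_fibre_iff)
        then show ?thesis using y that by (simp add: chain_fibre_iff sum_edges)
      qed
      then show ?thesis using y by (auto simp: B_def chain_fibre_iff extensional_def)
    qed
    moreover have "y \<in> extensional {..n}" if "y \<in> PiE UNIV B" for y
      unfolding extensional_def
    proof (intro CollectI allI impI)
      fix i assume "i \<notin> {..n}"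
      then show "y i = undefined" using PiE_mem[OF that, of i] by (simp add: B_def)
    qed
    ultimately show ?thesis
      unfolding set_eq_iff Int_iff mem_Collect_eq chain_fibre_iff by blast
  qed
  finally show ?thesis .
qed

text \<open>
  The map \<open>\<rho>\<close> retracts an open set of arbitrary vertex sequences onto the fibre over \<open>P0\<close>, and it carries
  every nearby fibre homeomorphically onto that one; the inverse on the fibre over \<open>Q\<close> is
  \<open>\<lambda>w. \<sigma> (Q, w)\<close>. Both apply to all edges the Moebius map whose parameter is determined by the desired
  endpoint. Composing the two takes the parameters \<open>l\<close> and \<open>-l\<close>, again by uniqueness of the parameter.
\<close>

theorem chain_fibre_chart:
  assumes n: "n > 0" and P0: "noncollinear_value n P0"
  obtains \<epsilon> W \<rho> \<sigma> where "\<epsilon> > 0" "open W"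
    "\<And>y Q. y \<in> chain_fibre n Q \<Longrightarrow> Q \<in> ball P0 \<epsilon> \<Longrightarrow> y \<in> W"
    "continuous_on W \<rho>" "\<rho> ` W \<subseteq> chain_fibre n P0"
    "\<And>y. y \<in> chain_fibre n P0 \<Longrightarrow> \<rho> y = y"
    "continuous_on (ball P0 \<epsilon> \<times> chain_fibre n P0) \<sigma>"
    "\<And>Q w. Q \<in> ball P0 \<epsilon> \<Longrightarrow> w \<in> chain_fibre n P0 \<Longrightarrow> \<sigma> (Q, w) \<in> chain_fibre n Q \<and> \<rho> (\<sigma> (Q, w)) = w"
    "\<And>Q y. Q \<in> ball P0 \<epsilon> \<Longrightarrow> y \<in> chain_fibre n Q \<Longrightarrow> \<sigma> (Q, \<rho> y) = y"
proof -
  obtain \<epsilon> r \<kappa> where \<epsilon>: "\<epsilon> > 0" and r: "0 < r" "r < 1" and \<kappa>: "\<kappa> > 0"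
    and lower: "\<And>u l m. (\<And>j. j < n \<Longrightarrow> cmod (u j) = 1) \<Longrightarrow> cmod ((\<Sum>j<n. u j) - P0) < \<epsilon> \<Longrightarrow>
       cmod l \<le> r \<Longrightarrow> cmod m \<le> r \<Longrightarrow>
       \<kappa> * cmod (l - m) \<le> cmod (moebius_sum n u l - moebius_sum n u m)"
    and solve: "\<And>u Q. (\<And>j. j < n \<Longrightarrow> cmod (u j) = 1) \<Longrightarrow> cmod ((\<Sum>j<n. u j) - P0) < \<epsilon> \<Longrightarrow>
       cmod (Q - P0) < \<epsilon> \<Longrightarrow> \<exists>l. cmod l \<le> r \<and> moebius_sum n u l = Q"
    by (fact moebius_chart[OF n P0])
  define D where "D = {u. (\<forall>j<n. cmod (u j) = 1) \<and> cmod ((\<Sum>j<n. u j) - P0) < \<epsilon>}"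
  define par where "par u Q = (SOME l. cmod l \<le> r \<and> moebius_sum n u l = Q)" for u Q
  define bend where "bend u Q j = moebius (par u Q) (u j)" for u Q j
  have par: "cmod (par u Q) \<le> r" "moebius_sum n u (par u Q) = Q"
    if "u \<in> D" "cmod (Q - P0) < \<epsilon>" for u Q
    using someI_ex[OF solve[of u Q]] that unfolding par_def D_def by auto
  \<comment> \<open>The lower bound makes the parameter unique, and below it makes the parameter continuous.\<close>
  have par_unique: "par u Q = l"
    if "u \<in> D" "cmod (Q - P0) < \<epsilon>" "cmod l \<le> r" "moebius_sum n u l = Q" for u Q l
  proof -
    have "\<kappa> * cmod (par u Q - l) \<le> cmod (moebius_sum n u (par u Q) - moebius_sum n u l)"
      using that par(1)[OF that(1,2)] by (intro lower) (auto simp: D_def)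
    then have "\<kappa> * cmod (par u Q - l) \<le> 0" using that par(2)[OF that(1,2)] by simp
    then show ?thesis using \<kappa> by (simp add: mult_le_0_iff)
  qed
  have par_cong: "par u Q = par v Q" if "\<And>j. j < n \<Longrightarrow> u j = v j" for u v Q
  proof -
    have "moebius_sum n u = moebius_sum n v" using that by (auto simp: moebius_sum_def fun_eq_iff)
    then show ?thesis by (simp add: par_def)
  qed
  have bend_cong: "bend u Q j = bend v Q j" if "\<And>j. j < n \<Longrightarrow> u j = v j" "j < n" for u v Q j
    using par_cong[OF that(1)] that by (simp add: bend_def)
  have bend_unit: "cmod (bend u Q j) = 1" if "u \<in> D" "cmod (Q - P0) < \<epsilon>" "j < n" for u Q j
    using that par(1)[OF that(1,2)] r unfolding bend_def by (intro norm_moebius) (auto simp: D_def)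
  have bend_sum: "(\<Sum>j<n. bend u Q j) = Q" if "u \<in> D" "cmod (Q - P0) < \<epsilon>" for u Q
    using par(2)[OF that] by (simp add: bend_def moebius_sum_def)
  have bend_D: "bend u Q \<in> D" if "u \<in> D" "cmod (Q - P0) < \<epsilon>" for u Q
    using bend_unit[OF that] bend_sum[OF that] that by (simp add: D_def)
  have bend_back: "bend (bend u Q) (\<Sum>j<n. u j) j = u j" if "u \<in> D" "cmod (Q - P0) < \<epsilon>" "j < n" for u Q j
  proof -
    have inv: "moebius (- par u Q) (bend u Q j) = u j" if "j < n" for j
      unfolding bend_def using par(1)[OF \<open>u \<in> D\<close> \<open>cmod (Q - P0) < \<epsilon>\<close>] r \<open>u \<in> D\<close> that
      by (intro moebius_inverse) (auto simp: D_def)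
    have "par (bend u Q) (\<Sum>j<n. u j) = - par u Q"
    proof (rule par_unique[OF bend_D[OF that(1,2)]])
      show "moebius_sum n (bend u Q) (- par u Q) = (\<Sum>j<n. u j)"
        by (simp add: moebius_sum_def inv)
    qed (use par(1)[OF that(1,2)] that(1) in \<open>auto simp: D_def\<close>)
    then show ?thesis using inv[OF that(3)] by (simp add: bend_def[of "bend u Q"])
  qed
  have bend_id: "bend u (\<Sum>j<n. u j) j = u j" if "u \<in> D" "j < n" for u j
  proof -
    have "par u (\<Sum>j<n. u j) = 0"
      using that r by (intro par_unique) (auto simp: D_def moebius_sum_def)
    then show ?thesis by (simp add: bend_def)
  qed
  have cont_par: "continuous_on X (\<lambda>t. par (u t) (Q t))"
    if u: "\<And>j. j < n \<Longrightarrow> continuous_on X (\<lambda>t. u t j)" and Q: "continuous_on X Q"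
      and D: "\<And>t. t \<in> X \<Longrightarrow> u t \<in> D \<and> cmod (Q t - P0) < \<epsilon>"
    for X and u :: "'x::topological_space \<Rightarrow> nat \<Rightarrow> complex" and Q
    unfolding continuous_on_def
  proof
    fix a assume a: "a \<in> X"
    let ?l = "par (u a) (Q a)"
    have l: "cmod ?l \<le> r" "cmod ?l < 1" using par(1)[of "u a" "Q a"] D[OF a] r by auto
    have "continuous_on X (\<lambda>t. (Q t - moebius_sum n (u t) ?l) / of_real \<kappa>)"
      unfolding moebius_sum_def moebius_def
      using D l \<kappa> moebius_denominator_nonzero by (intro continuous_intros u Q) (auto simp: D_def)
    then have "((\<lambda>t. (Q t - moebius_sum n (u t) ?l) / of_real \<kappa>) \<longlongrightarrow>
        (Q a - moebius_sum n (u a) ?l) / of_real \<kappa>) (at a within X)"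
      using a by (simp add: continuous_on_def)
    moreover have "(Q a - moebius_sum n (u a) ?l) / of_real \<kappa> = 0"
      using par(2)[of "u a" "Q a"] D[OF a] by simp
    ultimately have lim: "((\<lambda>t. (Q t - moebius_sum n (u t) ?l) / of_real \<kappa>) \<longlongrightarrow> 0) (at a within X)" by simp
    have "dist (par (u t) (Q t)) ?l \<le> dist ((Q t - moebius_sum n (u t) ?l) / of_real \<kappa>) 0" if "t \<in> X" for t
    proof -
      have "\<kappa> * cmod (par (u t) (Q t) - ?l) \<le>
          cmod (moebius_sum n (u t) (par (u t) (Q t)) - moebius_sum n (u t) ?l)"
        using D[OF that] par(1)[of "u t" "Q t"] l by (intro lower) (auto simp: D_def)
      also have "moebius_sum n (u t) (par (u t) (Q t)) = Q t" using par(2) D[OF that] by blast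
      finally show ?thesis using \<kappa> by (simp add: dist_norm norm_divide field_simps)
    qed
    then have "\<forall>\<^sub>F t in at a within X. dist (par (u t) (Q t)) ?l \<le>
        dist ((Q t - moebius_sum n (u t) ?l) / of_real \<kappa>) 0"
      by (auto simp: eventually_at_topological intro!: exI[of _ UNIV])
    with lim show "((\<lambda>t. par (u t) (Q t)) \<longlongrightarrow> ?l) (at a within X)"
      by (rule metric_tendsto_imp_tendsto)
  qed
  have cont_chain: "continuous_on X (\<lambda>t. chain_of_edges n (bend (u t) (Q t)))"
    if u: "\<And>j. j < n \<Longrightarrow> continuous_on X (\<lambda>t. u t j)" and Q: "continuous_on X Q"
      and D: "\<And>t. t \<in> X \<Longrightarrow> u t \<in> D \<and> cmod (Q t - P0) < \<epsilon>"
    for X and u :: "'x::topological_space \<Rightarrow> nat \<Rightarrow> complex" and Q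
  proof (rule continuous_on_coordinatewise_then_product)
    fix i
    have "continuous_on X (\<lambda>t. bend (u t) (Q t) j)" if "j < n" for j
    proof -
      have "1 + cnj (par (u t) (Q t)) * u t j \<noteq> 0" if "t \<in> X" for t
        using D[OF that] par(1)[of "u t" "Q t"] r \<open>j < n\<close>
        by (intro moebius_denominator_nonzero) (auto simp: D_def)
      then show ?thesis unfolding bend_def moebius_def using that
        by (intro continuous_intros cont_par u Q D) auto
    qed
    then show "continuous_on X (\<lambda>t. chain_of_edges n (bend (u t) (Q t)) i)"
      by (cases "i \<le> n") (auto simp: chain_of_edges_def intro!: continuous_intros)
  qed
  \<comment> \<open>Normalized edges, so that \<open>\<rho>\<close> is defined on an open set and not only on chains of unit edges.\<close>
  define E where "E y j = sgn (edge y j)" for y j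
  define W where "W = {y. \<forall>j<n. edge y j \<noteq> 0} \<inter> {y. cmod ((\<Sum>j<n. E y j) - P0) < \<epsilon>}"
  define \<rho> where "\<rho> y = chain_of_edges n (bend (E y) P0)" for y
  define \<sigma> where "\<sigma> = (\<lambda>(Q, w). chain_of_edges n (bend (edge w) Q))"
  have E_D: "E y \<in> D" if "y \<in> W" for y
    using that by (auto simp: W_def D_def E_def norm_sgn)
  have E_eq: "E y j = edge y j" if "y \<in> chain_fibre n Q" "j < n" for y Q j
    using that by (simp add: E_def chain_fibre_iff sgn_eq)
  have sum_fibre: "(\<Sum>j<n. edge y j) = Q" if "y \<in> chain_fibre n Q" for y Q
    using that by (simp add: chain_fibre_iff sum_edges)
  have edge_D: "edge y \<in> D" if "y \<in> chain_fibre n Q" "Q \<in> ball P0 \<epsilon>" for y Q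
    using that sum_fibre[OF that(1)] by (simp add: D_def chain_fibre_iff dist_norm norm_minus_commute)
  have \<rho>_eq: "\<rho> y = chain_of_edges n (bend (edge y) P0)" if "y \<in> chain_fibre n Q" for y Q
    unfolding \<rho>_def chain_of_edges_def using E_eq[OF that]
    by (intro restrict_ext sum.cong bend_cong) auto
  have fibre_W: "y \<in> W" if y: "y \<in> chain_fibre n Q" "Q \<in> ball P0 \<epsilon>" for y Q
  proof -
    have "edge y j \<noteq> 0" if "j < n" for j using y(1) that by (auto simp: chain_fibre_iff)
    then show ?thesis using edge_D[OF y] E_eq[OF y(1)] by (simp add: W_def D_def)
  qed
  have P0e: "cmod (P0 - P0) < \<epsilon>" "P0 \<in> ball P0 \<epsilon>" using \<epsilon> by auto
  have in_fibre: "chain_of_edges n (bend u Q) \<in> chain_fibre n Q"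
    if "u \<in> D" "cmod (Q - P0) < \<epsilon>" for u Q
    using chain_of_edges_in_fibre[of n "bend u Q"] bend_unit[OF that] bend_sum[OF that] by simp
  show ?thesis
  proof (rule that[of \<epsilon> W \<rho> \<sigma>])
    have 1: "open {y. \<forall>j<n. edge y j \<noteq> 0}"
    proof -
      have "open (\<Inter>j\<in>{..<n}. {y. edge y j \<noteq> 0})"
        unfolding edge_def by (intro open_INT ballI open_Collect_neq continuous_intros) auto
      also have "(\<Inter>j\<in>{..<n}. {y. edge y j \<noteq> 0}) = {y. \<forall>j<n. edge y j \<noteq> 0}" by auto
      finally show ?thesis .
    qed
    have "continuous_on {y. \<forall>j<n. edge y j \<noteq> 0} (\<lambda>y. cmod ((\<Sum>j<n. E y j) - P0))"
      unfolding E_def edge_def sgn_div_norm by (intro continuous_intros) auto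
    from continuous_open_preimage[OF this 1 open_lessThan[of \<epsilon>]]
    show "open W" by (simp add: W_def vimage_def lessThan_def)
    show "continuous_on W \<rho>" unfolding \<rho>_def
    proof (rule cont_chain)
      show "continuous_on W (\<lambda>y. E y j)" if "j < n" for j
        unfolding E_def edge_def sgn_div_norm using that
        by (intro continuous_intros) (auto simp: W_def edge_def)
    qed (use E_D P0e in auto)
    show "\<rho> ` W \<subseteq> chain_fibre n P0"
      unfolding \<rho>_def by (intro image_subsetI in_fibre E_D P0e)
    show "\<rho> y = y" if y: "y \<in> chain_fibre n P0" for y
      unfolding \<rho>_eq[OF y] using bend_id[OF edge_D[OF y P0e(2)]] sum_fibre[OF y]
      by (intro chain_of_edges_edge[OF y]) auto
    have D': "edge (snd t) \<in> D \<and> cmod (fst t - P0) < \<epsilon>" if "t \<in> ball P0 \<epsilon> \<times> chain_fibre n P0" for t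
      using that edge_D[of "snd t" P0] P0e by (auto simp: dist_norm norm_minus_commute)
    show "continuous_on (ball P0 \<epsilon> \<times> chain_fibre n P0) \<sigma>"
      unfolding \<sigma>_def case_prod_beta
    proof (rule cont_chain)
      have "continuous_on (ball P0 \<epsilon> \<times> chain_fibre n P0) (\<lambda>t. snd t i)" for i
        by (rule continuous_on_product_then_coordinatewise[OF continuous_on_snd[OF continuous_on_id]])
      then show "continuous_on (ball P0 \<epsilon> \<times> chain_fibre n P0) (\<lambda>t. edge (snd t) j)" for j
        unfolding edge_def by (intro continuous_on_diff)
    qed (use D' in \<open>auto intro!: continuous_intros\<close>)
    show "\<sigma> (Q, w) \<in> chain_fibre n Q \<and> \<rho> (\<sigma> (Q, w)) = w"
      if Q: "Q \<in> ball P0 \<epsilon>" and w: "w \<in> chain_fibre n P0" for Q w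
    proof
      have D: "edge w \<in> D" "cmod (Q - P0) < \<epsilon>"
        using edge_D[OF w P0e(2)] Q by (auto simp: dist_norm norm_minus_commute)
      show s: "\<sigma> (Q, w) \<in> chain_fibre n Q" using in_fibre[OF D] by (simp add: \<sigma>_def)
      have "bend (edge (\<sigma> (Q, w))) P0 j = edge w j" if "j < n" for j
      proof -
        have "bend (edge (\<sigma> (Q, w))) P0 j = bend (bend (edge w) Q) P0 j"
          using that by (intro bend_cong) (auto simp: \<sigma>_def edge_chain_of_edges)
        then show ?thesis using bend_back[OF D that] sum_fibre[OF w] by simp
      qed
      then show "\<rho> (\<sigma> (Q, w)) = w"
        unfolding \<rho>_eq[OF s] by (intro chain_of_edges_edge[OF w])
    qed
    show "\<sigma> (Q, \<rho> y) = y" if Q: "Q \<in> ball P0 \<epsilon>" and y: "y \<in> chain_fibre n Q" for Q y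
    proof -
      have "bend (edge (\<rho> y)) Q j = edge y j" if "j < n" for j
      proof -
        have "bend (edge (\<rho> y)) Q j = bend (bend (edge y) P0) Q j"
          using that by (intro bend_cong) (auto simp: \<rho>_eq[OF y] edge_chain_of_edges)
        then show ?thesis using bend_back[OF edge_D[OF y Q] P0e(1) that] sum_fibre[OF y] by simp
      qed
      then show ?thesis
        unfolding \<sigma>_def prod.case by (intro chain_of_edges_edge[OF y])
    qed
  qed (use \<epsilon> fibre_W in auto)
qed

section \<open>Compact neighbourhood retracts\<close>

text \<open>
  Closure under intersection replaces convexity: it is all that a finite union needs for its
  Euler characteristic to be computed from contractible pieces.
\<close>

definition contractible_basis :: "'a::topological_space set set \<Rightarrow> bool" where
  "contractible_basis \<B> \<longleftrightarrow>
     (\<forall>B\<in>\<B>. open B \<and> contractible_space (top_of_set B)) \<and> (\<forall>A\<in>\<B>. \<forall>B\<in>\<B>. A \<inter> B \<in> \<B>) \<and>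
     (\<forall>W x. open W \<and> x \<in> W \<longrightarrow> (\<exists>B\<in>\<B>. x \<in> B \<and> B \<subseteq> W))"

lemma contractible_basisD:
  assumes "contractible_basis \<B>"
  shows "B \<in> \<B> \<Longrightarrow> open B" "B \<in> \<B> \<Longrightarrow> contractible_space (top_of_set B)"
    "A \<in> \<B> \<Longrightarrow> B \<in> \<B> \<Longrightarrow> A \<inter> B \<in> \<B>" "open W \<Longrightarrow> x \<in> W \<Longrightarrow> \<exists>B\<in>\<B>. x \<in> B \<and> B \<subseteq> W"
  using assms unfolding contractible_basis_def by simp_all

text \<open>
  Finitely many basic sets inside \<open>W\<close> cover \<open>K\<close>, and \<open>K\<close> is a retract of their union.
\<close>

theorem euler_characteristic_compact_neighbourhood_retract:
  fixes K W :: "'a::topological_space set" and \<B> :: "'a set set"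
  assumes \<B>: "contractible_basis \<B>" and K: "compact K" and W: "open W" "K \<subseteq> W"
    and r: "continuous_on W r" "r ` W \<subseteq> K" "\<And>x. x \<in> K \<Longrightarrow> r x = x"
  shows "\<exists>k. has_euler_characteristic (top_of_set K) k"
proof -
  let ?\<D> = "{B \<in> \<B>. B \<subseteq> W}"
  have "K \<subseteq> \<Union>?\<D>"
  proof
    fix x assume "x \<in> K"
    then obtain B where "B \<in> \<B>" "x \<in> B" "B \<subseteq> W"
      using contractible_basisD(4)[OF \<B> W(1)] W(2) by blast
    then show "x \<in> \<Union>?\<D>" by blast
  qed
  moreover have "\<And>B. B \<in> ?\<D> \<Longrightarrow> open B" using contractible_basisD(1)[OF \<B>] by simp
  ultimately obtain \<F> where \<F>: "\<F> \<subseteq> ?\<D>" "finite \<F>" "K \<subseteq> \<Union>\<F>"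
    by (rule compactE[OF K])
  have "\<exists>k. has_euler_characteristic (top_of_set (\<Union>\<F>)) k"
  proof (rule euler_characteristic_finite_Union[of \<B>])
    show "openin euclidean C" if "C \<in> \<B>" for C
      using contractible_basisD(1)[OF \<B> that] by simp
    show "contractible_space (top_of_set C)" if "C \<in> \<B>" for C
      by (rule contractible_basisD(2)[OF \<B> that])
    show "C \<inter> D \<in> \<B>" if "C \<in> \<B>" "D \<in> \<B>" for C D
      by (rule contractible_basisD(3)[OF \<B> that])
  qed (use \<F> in auto)
  moreover have "section_map (top_of_set K) (top_of_set (\<Union>\<F>)) (\<lambda>x. x)"
  proof -
    have sub: "\<Union>\<F> \<subseteq> W" using \<F>(1) by blast
    then have "continuous_on (\<Union>\<F>) r" "r ` \<Union>\<F> \<subseteq> K"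
      using r(2) by (auto intro: continuous_on_subset[OF r(1)])
    then have "retraction_maps (top_of_set (\<Union>\<F>)) (top_of_set K) r (\<lambda>x. x)"
      using r(3) \<F>(3) by (auto simp: retraction_maps_def)
    then show ?thesis unfolding section_map_def by blast
  qed
  ultimately show ?thesis using euler_characteristic_retract by blast
qed

definition open_boxes :: "('i \<Rightarrow> 'a::real_normed_vector) set set" where
  "open_boxes = {PiE UNIV A | A. (\<forall>i. open (A i) \<and> convex (A i)) \<and> finite {i. A i \<noteq> UNIV}}"

lemma contractible_basis_open_boxes:
  "contractible_basis (open_boxes :: ('i \<Rightarrow> 'a::real_normed_vector) set set)"
  unfolding contractible_basis_def
proof (intro conjI ballI allI impI)
  fix B :: "('i \<Rightarrow> 'a) set" assume "B \<in> open_boxes"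
  then obtain A where A: "B = PiE UNIV A" "\<And>i. open (A i)" "\<And>i. convex (A i)" "finite {i. A i \<noteq> UNIV}"
    by (auto simp: open_boxes_def)
  show "open B" unfolding A(1) using A(2,4) by (rule open_PiE)
  have "top_of_set B = product_topology (\<lambda>i. top_of_set (A i)) UNIV"
    unfolding A(1) subtopology_product_topology[symmetric] euclidean_product_topology ..
  moreover have "\<forall>i. contractible_space (top_of_set (A i))"
    using A(3) by (simp add: convex_imp_contractible)
  ultimately show "contractible_space (top_of_set B)"
    by (simp add: contractible_space_product_topology)
next
  fix B C :: "('i \<Rightarrow> 'a) set" assume "B \<in> open_boxes" "C \<in> open_boxes"
  then obtain A D where A: "B = PiE UNIV A" "\<And>i. open (A i)" "\<And>i. convex (A i)" "finite {i. A i \<noteq> UNIV}"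
    and D: "C = PiE UNIV D" "\<And>i. open (D i)" "\<And>i. convex (D i)" "finite {i. D i \<noteq> UNIV}"
    by (auto simp: open_boxes_def)
  have "B \<inter> C = PiE UNIV (\<lambda>i. A i \<inter> D i)" by (simp add: A(1) D(1) PiE_Int)
  moreover have "finite {i. A i \<inter> D i \<noteq> UNIV}"
    by (rule finite_subset[OF _ finite_UnI[OF A(4) D(4)]]) auto
  ultimately show "B \<inter> C \<in> open_boxes"
    using A(2,3) D(2,3) unfolding open_boxes_def
    by (intro CollectI exI[of _ "\<lambda>i. A i \<inter> D i"]) (auto intro: convex_Int)
next
  fix W :: "('i \<Rightarrow> 'a) set" and x assume W: "open W \<and> x \<in> W"
  then have "openin (product_topology (\<lambda>_. euclidean) UNIV) W"
    by (simp add: euclidean_product_topology)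
  from product_topology_open_contains_basis[OF this conjunct2[OF W]]
  obtain X where X: "x \<in> PiE UNIV X" "\<And>i. open (X i)" "finite {i. X i \<noteq> UNIV}" "PiE UNIV X \<subseteq> W"
    by auto
  have "\<exists>e>0. ball (x i) e \<subseteq> X i" for i
    using X(1,2) by (auto simp: open_contains_ball PiE_iff)
  then obtain e where e: "\<And>i. e i > 0" "\<And>i. ball (x i) (e i) \<subseteq> X i" by metis
  define A where "A i = (if X i = UNIV then UNIV else ball (x i) (e i))" for i
  have "PiE UNIV A \<in> open_boxes"
    unfolding open_boxes_def using finite_subset[OF _ X(3)]
    by (intro CollectI exI[of _ A]) (auto simp: A_def)
  moreover have "x \<in> PiE UNIV A" using e(1) by (simp add: A_def PiE_iff)
  moreover have "PiE UNIV A \<subseteq> W"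
  proof -
    have "PiE UNIV A \<subseteq> PiE UNIV X" using e(2) by (intro PiE_mono) (auto simp: A_def)
    then show ?thesis using X(4) by blast
  qed
  ultimately show "\<exists>B\<in>open_boxes. x \<in> B \<and> B \<subseteq> W" by blast
qed

lemma contractible_basis_Times:
  assumes "contractible_basis \<A>" "contractible_basis \<B>"
  shows "contractible_basis {A \<times> B | A B. A \<in> \<A> \<and> B \<in> \<B>}"
  unfolding contractible_basis_def
proof (intro conjI ballI allI impI)
  fix C assume "C \<in> {A \<times> B | A B. A \<in> \<A> \<and> B \<in> \<B>}"
  then obtain A B where C: "C = A \<times> B" "A \<in> \<A>" "B \<in> \<B>" by blast
  note D = contractible_basisD(1,2)[OF assms(1) C(2)] contractible_basisD(1,2)[OF assms(2) C(3)]
  then show "open C" "contractible_space (top_of_set C)"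
    unfolding C(1) prod_topology_subtopology_eu[symmetric] contractible_space_prod_topology
    by (simp_all add: open_Times)
next
  fix C D assume "C \<in> {A \<times> B | A B. A \<in> \<A> \<and> B \<in> \<B>}" "D \<in> {A \<times> B | A B. A \<in> \<A> \<and> B \<in> \<B>}"
  then obtain A B A' B' where C: "C = A \<times> B" "A \<in> \<A>" "B \<in> \<B>" "D = A' \<times> B'" "A' \<in> \<A>" "B' \<in> \<B>" by blast
  have "C \<inter> D = (A \<inter> A') \<times> (B \<inter> B')" unfolding C by blast
  moreover have "A \<inter> A' \<in> \<A>" "B \<inter> B' \<in> \<B>"
    using contractible_basisD(3)[OF assms(1)] contractible_basisD(3)[OF assms(2)] C by simp_all
  ultimately show "C \<inter> D \<in> {A \<times> B | A B. A \<in> \<A> \<and> B \<in> \<B>}" by blast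
next
  fix W :: "('a \<times> 'b) set" and x assume W: "open W \<and> x \<in> W"
  obtain U V where UV: "open U" "open V" "x \<in> U \<times> V" "U \<times> V \<subseteq> W"
    by (rule open_prod_elim[OF conjunct1[OF W] conjunct2[OF W]])
  have "\<exists>A\<in>\<A>. fst x \<in> A \<and> A \<subseteq> U" "\<exists>B\<in>\<B>. snd x \<in> B \<and> B \<subseteq> V"
    using contractible_basisD(4)[OF assms(1) UV(1)] contractible_basisD(4)[OF assms(2) UV(2)]
      UV(3)[unfolded mem_Times_iff] by simp_all
  then obtain A B where A: "A \<in> \<A>" "fst x \<in> A" "A \<subseteq> U" and B: "B \<in> \<B>" "snd x \<in> B" "B \<subseteq> V"
    by blast
  moreover have "x \<in> A \<times> B" using A B by (simp add: mem_Times_iff)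
  moreover have "A \<times> B \<subseteq> W" using A B UV by blast
  ultimately show "\<exists>C\<in>{A \<times> B | A B. A \<in> \<A> \<and> B \<in> \<B>}. x \<in> C \<and> C \<subseteq> W"
    by (intro bexI[of _ "A \<times> B"] conjI CollectI exI[of _ A] exI[of _ B]) simp_all
qed

section \<open>Pairs of chains with a common endpoint\<close>

lemma euler_characteristic_chain_fibres:
  assumes "m > 0" "n > 0" "noncollinear_value m P" "noncollinear_value n P"
  shows "\<exists>k. has_euler_characteristic (top_of_set (chain_fibre m P \<times> chain_fibre n P)) k"
proof -
  obtain \<epsilon>1 W1 \<rho>1 \<sigma>1 where 1: "\<epsilon>1 > (0::real)" "open W1"
    "\<And>y Q. y \<in> chain_fibre m Q \<Longrightarrow> Q \<in> ball P \<epsilon>1 \<Longrightarrow> y \<in> W1"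
    "continuous_on W1 \<rho>1" "\<rho>1 ` W1 \<subseteq> chain_fibre m P"
    "\<And>y. y \<in> chain_fibre m P \<Longrightarrow> \<rho>1 y = y"
    "continuous_on (ball P \<epsilon>1 \<times> chain_fibre m P) \<sigma>1"
    "\<And>Q w. Q \<in> ball P \<epsilon>1 \<Longrightarrow> w \<in> chain_fibre m P \<Longrightarrow> \<sigma>1 (Q, w) \<in> chain_fibre m Q \<and> \<rho>1 (\<sigma>1 (Q, w)) = w"
    "\<And>Q y. Q \<in> ball P \<epsilon>1 \<Longrightarrow> y \<in> chain_fibre m Q \<Longrightarrow> \<sigma>1 (Q, \<rho>1 y) = y"
    by (fact chain_fibre_chart[OF assms(1,3)])
  obtain \<epsilon>2 W2 \<rho>2 \<sigma>2 where 2: "\<epsilon>2 > (0::real)" "open W2"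
    "\<And>y Q. y \<in> chain_fibre n Q \<Longrightarrow> Q \<in> ball P \<epsilon>2 \<Longrightarrow> y \<in> W2"
    "continuous_on W2 \<rho>2" "\<rho>2 ` W2 \<subseteq> chain_fibre n P"
    "\<And>y. y \<in> chain_fibre n P \<Longrightarrow> \<rho>2 y = y"
    "continuous_on (ball P \<epsilon>2 \<times> chain_fibre n P) \<sigma>2"
    "\<And>Q w. Q \<in> ball P \<epsilon>2 \<Longrightarrow> w \<in> chain_fibre n P \<Longrightarrow> \<sigma>2 (Q, w) \<in> chain_fibre n Q \<and> \<rho>2 (\<sigma>2 (Q, w)) = w"
    "\<And>Q y. Q \<in> ball P \<epsilon>2 \<Longrightarrow> y \<in> chain_fibre n Q \<Longrightarrow> \<sigma>2 (Q, \<rho>2 y) = y"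
    by (fact chain_fibre_chart[OF assms(2,4)])
  show ?thesis
  proof (rule euler_characteristic_compact_neighbourhood_retract)
    show "contractible_basis {A \<times> B | A B. A \<in> (open_boxes :: vertices set set) \<and> B \<in> (open_boxes :: vertices set set)}"
      by (intro contractible_basis_Times contractible_basis_open_boxes)
    show "compact (chain_fibre m P \<times> chain_fibre n P)"
      by (intro compact_Times compact_chain_fibre)
    show "open (W1 \<times> W2)" using 1 2 by (intro open_Times)
    show "chain_fibre m P \<times> chain_fibre n P \<subseteq> W1 \<times> W2"
      using 1(1) 2(1) by (auto intro: 1(3)[of _ P] 2(3)[of _ P])
    show "continuous_on (W1 \<times> W2) (\<lambda>t. (\<rho>1 (fst t), \<rho>2 (snd t)))"
      by (intro continuous_on_Pair continuous_on_compose2[OF 1(4)] continuous_on_compose2[OF 2(4)]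
          continuous_on_fst continuous_on_snd continuous_on_id) auto
  qed (use 1(5,6) 2(5,6) in \<open>auto\<close>)
qed

text \<open>
  The configurations in normal position, with the two-bar linkage replaced by the value \<open>c\<close> of the
  projection. If \<open>\<theta>\<close> is the angle of the second edge, then \<open>c = cis (pi - \<theta>)\<close>, so that this edge is
  \<open>- b * cnj c\<close>.
\<close>

definition closed_chain_pairs :: "real \<Rightarrow> real \<Rightarrow> nat \<Rightarrow> nat \<Rightarrow> (complex \<times> vertices \<times> vertices) set" where
  "closed_chain_pairs a b m n = {(c, y, z). c \<in> sphere 0 1 \<and>
     y \<in> chain_fibre m (of_real a - of_real b * cnj c) \<and> z \<in> chain_fibre n (of_real a - of_real b * cnj c)}"

text \<open>
  Over the \<open>c\<close> whose endpoint lies in the domains of both charts around the endpoint of \<open>c0\<close>, the two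
  charts act side by side.
\<close>

theorem locally_trivial_closed_chain_pairs:
  assumes mn: "m > 0" "n > 0"
    and generic: "\<And>c. c \<in> sphere 0 1 \<Longrightarrow> noncollinear_value m (of_real a - of_real b * cnj c)"
      "\<And>c. c \<in> sphere 0 1 \<Longrightarrow> noncollinear_value n (of_real a - of_real b * cnj c)"
  shows "locally_trivial_fibration (top_of_set (closed_chain_pairs a b m n)) (top_of_set (sphere 0 1)) fst"
  unfolding locally_trivial_fibration_def
proof (intro conjI ballI)
  let ?N = "closed_chain_pairs a b m n" and ?B = "top_of_set (sphere 0 1 :: complex set)"
  define E where "E c = of_real a - of_real b * cnj c" for c
  have N: "(c, y, z) \<in> ?N \<longleftrightarrow> c \<in> sphere 0 1 \<and> y \<in> chain_fibre m (E c) \<and> z \<in> chain_fibre n (E c)" for c y z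
    by (simp add: closed_chain_pairs_def E_def)
  show "continuous_map (top_of_set ?N) ?B fst"
    by (auto simp: closed_chain_pairs_def intro!: continuous_intros)
  fix c0 assume "c0 \<in> topspace ?B"
  then have c0: "c0 \<in> sphere 0 1" by simp
  obtain \<epsilon>1 W1 \<rho>1 \<sigma>1 where 1: "\<epsilon>1 > (0::real)" "open W1"
    "\<And>y Q. y \<in> chain_fibre m Q \<Longrightarrow> Q \<in> ball (E c0) \<epsilon>1 \<Longrightarrow> y \<in> W1"
    "continuous_on W1 \<rho>1" "\<rho>1 ` W1 \<subseteq> chain_fibre m (E c0)"
    "\<And>y. y \<in> chain_fibre m (E c0) \<Longrightarrow> \<rho>1 y = y"
    "continuous_on (ball (E c0) \<epsilon>1 \<times> chain_fibre m (E c0)) \<sigma>1"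
    "\<And>Q w. Q \<in> ball (E c0) \<epsilon>1 \<Longrightarrow> w \<in> chain_fibre m (E c0) \<Longrightarrow> \<sigma>1 (Q, w) \<in> chain_fibre m Q \<and> \<rho>1 (\<sigma>1 (Q, w)) = w"
    "\<And>Q y. Q \<in> ball (E c0) \<epsilon>1 \<Longrightarrow> y \<in> chain_fibre m Q \<Longrightarrow> \<sigma>1 (Q, \<rho>1 y) = y"
    by (fact chain_fibre_chart[OF mn(1) generic(1)[OF c0], folded E_def])
  obtain \<epsilon>2 W2 \<rho>2 \<sigma>2 where 2: "\<epsilon>2 > (0::real)" "open W2"
    "\<And>y Q. y \<in> chain_fibre n Q \<Longrightarrow> Q \<in> ball (E c0) \<epsilon>2 \<Longrightarrow> y \<in> W2"
    "continuous_on W2 \<rho>2" "\<rho>2 ` W2 \<subseteq> chain_fibre n (E c0)"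
    "\<And>y. y \<in> chain_fibre n (E c0) \<Longrightarrow> \<rho>2 y = y"
    "continuous_on (ball (E c0) \<epsilon>2 \<times> chain_fibre n (E c0)) \<sigma>2"
    "\<And>Q w. Q \<in> ball (E c0) \<epsilon>2 \<Longrightarrow> w \<in> chain_fibre n (E c0) \<Longrightarrow> \<sigma>2 (Q, w) \<in> chain_fibre n Q \<and> \<rho>2 (\<sigma>2 (Q, w)) = w"
    "\<And>Q y. Q \<in> ball (E c0) \<epsilon>2 \<Longrightarrow> y \<in> chain_fibre n Q \<Longrightarrow> \<sigma>2 (Q, \<rho>2 y) = y"
    by (fact chain_fibre_chart[OF mn(2) generic(2)[OF c0], folded E_def])
  define V where "V = ball (E c0) \<epsilon>1 \<inter> ball (E c0) \<epsilon>2"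
  define U where "U = sphere 0 1 \<inter> E -` V"
  have "open V" by (simp add: V_def open_Int)
  moreover have contE: "continuous_on UNIV E" unfolding E_def by (intro continuous_intros)
  ultimately have "open (E -` V)" by (rule open_vimage)
  then have U: "openin ?B U" unfolding U_def by (rule openin_open_Int)
  have c0U: "c0 \<in> U" using c0 1(1) 2(1) by (simp add: U_def V_def)
  let ?T = "{e \<in> ?N. fst e \<in> U}" and ?F = "{e \<in> ?N. fst e = c0}"
  define h where "h = (\<lambda>e :: complex \<times> vertices \<times> vertices. (fst e, (c0, \<rho>1 (fst (snd e)), \<rho>2 (snd (snd e)))))"
  define g where "g = (\<lambda>(c :: complex, (c' :: complex, y :: vertices, z :: vertices)). (c, \<sigma>1 (E c, y), \<sigma>2 (E c, z)))"
  have T: "(c, y, z) \<in> ?T \<longleftrightarrow> c \<in> U \<and> y \<in> chain_fibre m (E c) \<and> z \<in> chain_fibre n (E c)" for c y z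
    by (auto simp: N U_def)
  have F: "(c, y, z) \<in> ?F \<longleftrightarrow> c = c0 \<and> y \<in> chain_fibre m (E c0) \<and> z \<in> chain_fibre n (E c0)" for c y z
    using c0 by (auto simp: N)
  have UE: "E c \<in> ball (E c0) \<epsilon>1" "E c \<in> ball (E c0) \<epsilon>2" if "c \<in> U" for c
    using that by (auto simp: U_def V_def)
  have "homeomorphic_maps (top_of_set ?T) (top_of_set (U \<times> ?F)) h g"
    unfolding homeomorphic_maps_def
  proof (intro conjI ballI)
    have T_W: "fst (snd e) \<in> W1" "snd (snd e) \<in> W2" if "e \<in> ?T" for e
    proof -
      obtain c y z where e: "e = (c, y, z)" by (cases e) auto
      then show "fst (snd e) \<in> W1" "snd (snd e) \<in> W2"
        using that T[of c y z] 1(3)[of y "E c"] 2(3)[of z "E c"] UE[of c] by auto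
    qed
    have "continuous_on ?T h" unfolding h_def
      by (intro continuous_on_Pair continuous_on_compose2[OF 1(4)] continuous_on_compose2[OF 2(4)]
          continuous_on_fst continuous_on_snd continuous_on_id continuous_on_const) (use T_W in auto)
    moreover have "h e \<in> U \<times> ?F" if "e \<in> ?T" for e
    proof -
      obtain c y z where e: "e = (c, y, z)" by (cases e) auto
      then have "c \<in> U" using that T by blast
      moreover have "(c0, \<rho>1 y, \<rho>2 z) \<in> ?F"
        unfolding F using T_W[OF that] 1(5) 2(5) e by auto
      ultimately show ?thesis by (simp add: h_def e)
    qed
    ultimately show "continuous_map (top_of_set ?T) (top_of_set (U \<times> ?F)) h"
      unfolding continuous_map_subtopology_eu by blast
    have F_mem: "fst (snd t) \<in> chain_fibre m (E c0)" "snd (snd t) \<in> chain_fibre n (E c0)"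
      if "t \<in> ?F" for t
      using that F[of "fst t" "fst (snd t)" "snd (snd t)"] by auto
    have "g = (\<lambda>t. (fst t, \<sigma>1 (E (fst t), fst (snd (snd t))), \<sigma>2 (E (fst t), snd (snd (snd t)))))"
      by (auto simp: g_def)
    moreover have "continuous_on (U \<times> ?F) \<dots>"
      by (intro continuous_on_Pair continuous_on_compose2[OF 1(7)] continuous_on_compose2[OF 2(7)]
          continuous_on_compose2[OF contE] continuous_on_fst continuous_on_snd continuous_on_id)
        (use UE F_mem in auto)
    ultimately have "continuous_on (U \<times> ?F) g" by simp
    moreover have "g t \<in> ?T" if "t \<in> U \<times> ?F" for t
    proof -
      obtain c c' y z where t: "t = (c, c', y, z)" by (cases t) auto
      then have "c \<in> U" "y \<in> chain_fibre m (E c0)" "z \<in> chain_fibre n (E c0)" using that F by auto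
      then have "(c, \<sigma>1 (E c, y), \<sigma>2 (E c, z)) \<in> ?T"
        unfolding T using UE 1(8) 2(8) by blast
      then show ?thesis by (simp add: t g_def)
    qed
    ultimately show "continuous_map (top_of_set (U \<times> ?F)) (top_of_set ?T) g"
      unfolding continuous_map_subtopology_eu by blast
    fix e assume "e \<in> topspace (top_of_set ?T)"
    then have eT: "e \<in> ?T" by simp
    obtain c y z where e: "e = (c, y, z)" by (cases e) auto
    have "c \<in> U" "y \<in> chain_fibre m (E c)" "z \<in> chain_fibre n (E c)" using eT T unfolding e by blast+
    then show "g (h e) = e" using UE[of c] 1(9) 2(9) by (simp add: h_def g_def e)
  next
    fix t assume "t \<in> topspace (top_of_set (U \<times> ?F))"
    then have tU: "t \<in> U \<times> ?F" by simp
    obtain c c' y z where t: "t = (c, c', y, z)" by (cases t) auto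
    have "c \<in> U" "c' = c0" "y \<in> chain_fibre m (E c0)" "z \<in> chain_fibre n (E c0)"
      using tU F unfolding t by auto
    then show "h (g t) = t" using UE[of c] 1(8) 2(8) by (simp add: h_def g_def t)
  qed
  then have "homeomorphic_map (top_of_set ?T) (top_of_set (U \<times> ?F)) h"
    using homeomorphic_maps_imp_map by blast
  moreover have "top_of_set (U \<times> ?F) = prod_topology (subtopology ?B U) (subtopology (top_of_set ?N) ?F)"
  proof -
    have "sphere 0 1 \<inter> U = U" "?N \<inter> ?F = ?F" by (auto simp: U_def)
    then show ?thesis by (simp only: subtopology_subtopology prod_topology_subtopology_eu)
  qed
  moreover have "top_of_set ?T = subtopology (top_of_set ?N) ?T"
  proof -
    have "?N \<inter> ?T = ?T" by auto
    then show ?thesis by (simp only: subtopology_subtopology)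
  qed
  ultimately have "homeomorphic_map (subtopology (top_of_set ?N) ?T)
      (prod_topology (subtopology ?B U) (subtopology (top_of_set ?N) ?F)) h"
    by (simp only:)
  then show "\<exists>U h. openin ?B U \<and> c0 \<in> U \<and>
      homeomorphic_map (subtopology (top_of_set ?N) {e \<in> topspace (top_of_set ?N). fst e \<in> U})
        (prod_topology (subtopology ?B U)
          (subtopology (top_of_set ?N) {e \<in> topspace (top_of_set ?N). fst e = c0})) h \<and>
      (\<forall>e\<in>topspace (top_of_set ?N). fst e \<in> U \<longrightarrow> fst (h e) = fst e)"
    using U c0U by (intro exI[of _ U] exI[of _ h]) (simp add: h_def)
qed

theorem euler_characteristic_closed_chain_pairs:
  assumes mn: "m > 0" "n > 0"
    and generic: "\<And>c. c \<in> sphere 0 1 \<Longrightarrow> noncollinear_value m (of_real a - of_real b * cnj c)"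
      "\<And>c. c \<in> sphere 0 1 \<Longrightarrow> noncollinear_value n (of_real a - of_real b * cnj c)"
  shows "has_euler_characteristic (top_of_set (closed_chain_pairs a b m n)) 0"
proof (rule euler_characteristic_fibration_over_circle)
  let ?N = "closed_chain_pairs a b m n"
  show "locally_trivial_fibration (top_of_set ?N) (top_of_set (sphere 0 1)) fst"
    using assms by (rule locally_trivial_closed_chain_pairs)
  fix c :: complex assume c: "c \<in> sphere 0 1"
  define P where "P = of_real a - of_real b * cnj c"
  let ?F = "{e \<in> topspace (top_of_set ?N). fst e = c}"
  have F: "?F = {c} \<times> (chain_fibre m P \<times> chain_fibre n P)"
    using c by (auto simp: closed_chain_pairs_def P_def)
  have "?N \<inter> ?F = ?F" by auto
  then have eq: "subtopology (top_of_set ?N) ?F = top_of_set ({c} \<times> (chain_fibre m P \<times> chain_fibre n P))"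
    unfolding subtopology_subtopology F by simp
  have "homeomorphic_maps (top_of_set (chain_fibre m P \<times> chain_fibre n P))
      (top_of_set ({c} \<times> (chain_fibre m P \<times> chain_fibre n P))) (\<lambda>t. (c, t)) snd"
    by (auto simp: homeomorphic_maps_def intro!: continuous_intros)
  then have hs: "top_of_set (chain_fibre m P \<times> chain_fibre n P) homeomorphic_space
      top_of_set ({c} \<times> (chain_fibre m P \<times> chain_fibre n P))"
    unfolding homeomorphic_space_def by blast
  obtain k where k: "has_euler_characteristic (top_of_set (chain_fibre m P \<times> chain_fibre n P)) k"
    using euler_characteristic_chain_fibres[OF mn generic[OF c]] unfolding P_def by (elim exE)
  have "has_euler_characteristic (subtopology (top_of_set ?N) ?F) k"
    unfolding eq by (rule has_euler_characteristic_homeomorphic[OF hs k])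
  then show "\<exists>k. has_euler_characteristic (subtopology (top_of_set ?N) ?F) k" ..
qed

lemma locally_trivial_fibration_homeomorphic:
  assumes f: "homeomorphic_maps E E' f g" and p: "\<And>e. e \<in> topspace E \<Longrightarrow> p' (f e) = p e"
    and lt: "locally_trivial_fibration E' B p'"
  shows "locally_trivial_fibration E B p"
  unfolding locally_trivial_fibration_def
proof (intro conjI ballI)
  have cf: "continuous_map E E' f" and cg: "continuous_map E' E g"
    and gf: "\<And>e. e \<in> topspace E \<Longrightarrow> g (f e) = e" and fg: "\<And>e. e \<in> topspace E' \<Longrightarrow> f (g e) = e"
    using f by (auto simp: homeomorphic_maps_def)
  have ft: "f e \<in> topspace E'" if "e \<in> topspace E" for e
    using cf that by (auto simp: continuous_map_def)
  have gt: "g e \<in> topspace E" if "e \<in> topspace E'" for e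
    using cg that by (auto simp: continuous_map_def)
  have pg: "p (g e) = p' e" if "e \<in> topspace E'" for e
    using p[OF gt[OF that]] fg[OF that] by simp
  have "continuous_map E B (p' \<circ> f)"
    using continuous_map_compose[OF cf] lt by (auto simp: locally_trivial_fibration_def)
  then show "continuous_map E B p" by (rule continuous_map_eq) (simp add: p)
  have restrict: "homeomorphic_maps (subtopology E {e \<in> topspace E. p e \<in> S})
      (subtopology E' {e \<in> topspace E'. p' e \<in> S}) f g" for S
    using f ft gt p pg by (intro homeomorphic_maps_subtopologies_alt) auto
  fix b assume b: "b \<in> topspace B"
  note bspec[OF conjunct2[OF lt[unfolded locally_trivial_fibration_def]] b]
  then obtain U h where U: "openin B U" "b \<in> U"
    and h: "homeomorphic_map (subtopology E' {e \<in> topspace E'. p' e \<in> U})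
      (prod_topology (subtopology B U) (subtopology E' {e \<in> topspace E'. p' e = b})) h"
    and fst_h: "\<And>e. e \<in> topspace E' \<Longrightarrow> p' e \<in> U \<Longrightarrow> fst (h e) = p' e"
    by blast
  let ?k = "(\<lambda>(x, y). (x, g y)) \<circ> (h \<circ> f)"
  have "homeomorphic_maps (subtopology E' {e \<in> topspace E'. p' e = b}) (subtopology E {e \<in> topspace E. p e = b}) g f"
    using homeomorphic_maps_sym[THEN iffD1, OF restrict[of "{b}"]] by simp
  moreover have "homeomorphic_maps (subtopology B U) (subtopology B U) (\<lambda>x. x) (\<lambda>x. x)"
    by (simp add: homeomorphic_maps_def)
  ultimately have "homeomorphic_maps (prod_topology (subtopology B U) (subtopology E' {e \<in> topspace E'. p' e = b}))
      (prod_topology (subtopology B U) (subtopology E {e \<in> topspace E. p e = b}))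
      (\<lambda>(x, y). (x, g y)) (\<lambda>(x, y). (x, f y))"
    by (simp add: homeomorphic_maps_prod)
  note homeomorphic_map_compose[OF homeomorphic_map_compose[OF homeomorphic_maps_imp_map[OF restrict[of U]] h]
      homeomorphic_maps_imp_map[OF this]]
  moreover have "fst (?k e) = p e" if "e \<in> topspace E" "p e \<in> U" for e
    using fst_h ft[OF that(1)] that p[OF that(1)] by (simp add: case_prod_beta)
  ultimately show "\<exists>U h. openin B U \<and> b \<in> U \<and>
      homeomorphic_map (subtopology E {e \<in> topspace E. p e \<in> U})
        (prod_topology (subtopology B U) (subtopology E {e \<in> topspace E. p e = b})) h \<and>
      (\<forall>e\<in>topspace E. p e \<in> U \<longrightarrow> fst (h e) = p e)"
    using U by blast
qed

section \<open>The configuration space of a two-bar linkage and two chains\<close>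

text \<open>
  This turns configuration spaces into sets of the function space over all naturals, where continuity
  on sets can be used.
\<close>

lemma product_topology_eq_top_of_set:
  "product_topology (\<lambda>_. euclidean :: 'a::topological_space topology) I = top_of_set (extensional I)"
    (is "?P = ?T")
proof -
  have top: "topspace ?P = topspace ?T" by (simp add: PiE_UNIV_domain PiE_def)
  have TP: "continuous_map ?T ?P id"
    unfolding continuous_map_componentwise
    by (auto intro!: continuous_map_subtopology_eu[THEN iffD2] continuous_intros)
  have PT: "continuous_map ?P ?T id"
  proof -
    have "continuous_map ?P euclidean (\<lambda>y. y i)" for i
    proof (cases "i \<in> I")
      case True
      then show ?thesis by (rule continuous_map_product_projection)
    next
      case False
      have "continuous_map ?P euclidean (\<lambda>y. undefined)" by simp
      then show ?thesis by (rule continuous_map_eq) (use False in \<open>auto simp: PiE_def extensional_def\<close>)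
    qed
    then have "continuous_map ?P (product_topology (\<lambda>_. euclidean) UNIV) id"
      unfolding continuous_map_componentwise_UNIV by simp
    then show ?thesis
      by (simp add: euclidean_product_topology continuous_map_in_subtopology PiE_def)
  qed
  show ?thesis
    unfolding topology_eq
  proof (intro allI iffI)
    fix U
    assume U: "openin ?P U"
    then have "U \<subseteq> topspace ?T" using openin_subset unfolding top[symmetric] by blast
    then have "{y \<in> topspace ?T. id y \<in> U} = U" unfolding id_apply by blast
    then show "openin ?T U" using openin_continuous_map_preimage[OF TP U] by simp
  next
    fix U
    assume U: "openin ?T U"
    then have "U \<subseteq> topspace ?P" using openin_subset unfolding top by blast
    then have "{y \<in> topspace ?P. id y \<in> U} = U" unfolding id_apply by blast
    then show "openin ?P U" using openin_continuous_map_preimage[OF PT U] by simp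
  qed
qed

lemma C_space_eq_top_of_set: "C_space d1 d2 d3 = top_of_set (C_set d1 d2 d3)"
proof -
  have "C_set d1 d2 d3 \<subseteq> extensional {..length d1} \<times> extensional {..length d2} \<times> extensional {..length d3}"
    by (auto simp: C_set_def linkage_configs_def PiE_def)
  then show ?thesis
    unfolding C_space_def plane_power_def product_topology_eq_top_of_set
    by (simp add: subtopology_subtopology Int_absorb1)
qed

lemma continuous_on_restrict_family:
  assumes "\<And>i. i \<in> I \<Longrightarrow> continuous_on S (\<lambda>t. f t i)"
  shows "continuous_on S (\<lambda>t. \<lambda>i\<in>I. f t i)"
proof (rule continuous_on_coordinatewise_then_product)
  fix i show "continuous_on S (\<lambda>t. (\<lambda>i\<in>I. f t i) i)"
    using assms by (cases "i \<in> I") auto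
qed

text \<open>
  Turns the configuration so that its first edge becomes positive and records the projection and the two
  chains. As a function of the configuration it is constant on orbits.
\<close>

definition straighten :: "real \<Rightarrow> nat \<Rightarrow> nat \<Rightarrow> triple \<Rightarrow> complex \<times> vertices \<times> vertices" where
  "straighten b m n = (\<lambda>(x, y, z). let w = cnj (sgn (x 1)) in
     (- cnj (w * (x 2 - x 1) / of_real b), \<lambda>i\<in>{..m}. w * y i, \<lambda>i\<in>{..n}. w * z i))"

definition two_bar :: "real \<Rightarrow> real \<Rightarrow> complex \<Rightarrow> vertices" where
  "two_bar a b c = (\<lambda>i\<in>{..2}. if i = 0 then 0 else if i = 1 then of_real a else of_real a - of_real b * cnj c)"

lemma linkage_configs_rotate:
  assumes "x \<in> linkage_configs d" "cmod w = 1"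
  shows "(\<lambda>i\<in>{..length d}. w * x i) \<in> linkage_configs d"
  using assms by (auto simp: linkage_configs_def dist_norm norm_mult right_diff_distrib[symmetric])

locale two_bar_linkage =
  fixes a b :: real and m n :: nat
  assumes a: "a > 0" and b: "b > 0"
begin

abbreviation "ones k \<equiv> replicate k (1::real)"
abbreviation "C \<equiv> C_set [a, b] (ones m) (ones n)"
abbreviation "N \<equiv> closed_chain_pairs a b m n"
abbreviation "rot \<equiv> rotate_triple [a, b] (ones m) (ones n)"
abbreviation "q \<equiv> orbit [a, b] (ones m) (ones n)"

lemma C_iff: "(x, y, z) \<in> C \<longleftrightarrow> x \<in> extensional {..2} \<and> x 0 = 0 \<and> cmod (x 1) = a \<and> cmod (x 2 - x 1) = b \<and>
   y \<in> chain_fibre m (x 2) \<and> z \<in> chain_fibre n (x 2)"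
  by (auto simp: C_set_def linkage_configs_def[of "[a, b]"] chain_fibre_def PiE_def less_Suc_eq dist_norm
      norm_minus_commute numeral_2_eq_2)

lemma N_iff: "(c, y, z) \<in> N \<longleftrightarrow> cmod c = 1 \<and>
   y \<in> chain_fibre m (of_real a - of_real b * cnj c) \<and> z \<in> chain_fibre n (of_real a - of_real b * cnj c)"
  by (simp add: closed_chain_pairs_def)

lemma chain_fibre_rotate:
  assumes "y \<in> chain_fibre k P" "cmod w = 1"
  shows "(\<lambda>i\<in>{..k}. w * y i) \<in> chain_fibre k (w * P)"
  using assms linkage_configs_rotate[of y "ones k" w] by (auto simp: chain_fibre_def)

lemma straighten_rotate:
  assumes "t \<in> C" "cmod w = 1" shows "straighten b m n (rot w t) = straighten b m n t"
proof -
  obtain x y z where t: "t = (x, y, z)" by (cases t) auto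
  have "cnj w * w = 1" using assms(2) complex_norm_square[of w] by (simp add: mult.commute)
  moreover have "cnj (sgn (w * x 1)) = cnj w * cnj (sgn (x 1))"
    using assms(2) by (simp add: sgn_mult sgn_eq norm_mult)
  ultimately have w: "cnj (sgn (w * x 1)) * (w * s) = cnj (sgn (x 1)) * s" for s
    by (simp add: mult.left_commute[of _ w] mult.assoc[symmetric] mult.commute[of w])
  have "cnj (sgn (w * x 1)) * (w * x 2 - w * x 1) = cnj (sgn (x 1)) * (x 2 - x 1)"
    using w[of "x 2 - x 1"] by (simp add: right_diff_distrib)
  then show ?thesis
    unfolding t straighten_def rotate_triple_def prod.case Let_def
    by (intro arg_cong2[where f = Pair] arg_cong[where f = uminus] arg_cong[where f = cnj]
        arg_cong2[where f = "(/)"] restrict_ext refl)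
      (simp_all add: w w[of 1, simplified])
qed

text \<open>
  The two-bar linkage can be recovered from the projection, so the straightened data represent the orbit
  of the given configuration.
\<close>

lemma straighten_in_N:
  assumes "t \<in> C" shows "straighten b m n t \<in> N"
    and "(two_bar a b (fst (straighten b m n t)), snd (straighten b m n t)) = rot (cnj (sgn (fst t 1))) t"
proof -
  obtain x y z where t: "t = (x, y, z)" by (cases t) auto
  have x: "x \<in> extensional {..2}" "x 0 = 0" "cmod (x 1) = a" "cmod (x 2 - x 1) = b"
    and y: "y \<in> chain_fibre m (x 2)" and z: "z \<in> chain_fibre n (x 2)"
    using assms C_iff unfolding t by auto
  define w where "w = cnj (sgn (x 1))"
  have w: "cmod w = 1" using x(3) a by (auto simp: w_def norm_sgn)
  have wx: "w * x 1 = of_real a"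
  proof -
    have "w * x 1 = (x 1 * cnj (x 1)) / of_real a" using x(3) by (simp add: w_def sgn_eq)
    also have "\<dots> = of_real ((cmod (x 1))\<^sup>2) / of_real a" by (simp only: complex_norm_square)
    finally show ?thesis using x(3) a by (simp add: power2_eq_square)
  qed
  define c where "c = - cnj (w * (x 2 - x 1) / of_real b)"
  have c: "cmod c = 1"
    unfolding c_def norm_minus_cancel complex_mod_cnj norm_divide norm_mult using w x(4) b by simp
  have end_eq: "of_real a - of_real b * cnj c = w * x 2"
  proof -
    have "of_real b * cnj c = - (w * (x 2 - x 1))"
      unfolding c_def complex_cnj_minus complex_cnj_cnj using b by simp
    then show ?thesis using wx by (simp add: right_diff_distrib)
  qed
  have s: "straighten b m n t = (c, \<lambda>i\<in>{..m}. w * y i, \<lambda>i\<in>{..n}. w * z i)"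
    by (simp add: straighten_def t Let_def c_def w_def)
  show "straighten b m n t \<in> N"
    unfolding s N_iff end_eq using c w chain_fibre_rotate y z by blast
  have "two_bar a b c = (\<lambda>i\<in>{..2}. w * x i)"
    unfolding two_bar_def using x(2) wx end_eq by (intro restrict_ext) (auto simp: le_Suc_eq numeral_2_eq_2)
  then show "(two_bar a b (fst (straighten b m n t)), snd (straighten b m n t)) = rot (cnj (sgn (fst t 1))) t"
    unfolding s by (simp add: t rotate_triple_def w_def numeral_2_eq_2)
qed

lemma two_bar_in_C:
  assumes "(c, y, z) \<in> N" shows "(two_bar a b c, y, z) \<in> C"
    and "straighten b m n (two_bar a b c, y, z) = (c, y, z)"
proof -
  have c: "cmod c = 1" and y: "y \<in> chain_fibre m (of_real a - of_real b * cnj c)"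
    and z: "z \<in> chain_fibre n (of_real a - of_real b * cnj c)"
    using assms N_iff by auto
  have v: "two_bar a b c 0 = 0" "two_bar a b c 1 = of_real a" "two_bar a b c 2 = of_real a - of_real b * cnj c"
    by (simp_all add: two_bar_def)
  show "(two_bar a b c, y, z) \<in> C"
    unfolding C_iff v using y z c a b by (simp add: norm_mult two_bar_def)
  have r: "(\<lambda>i\<in>{..k}. f i) = f" if "f \<in> chain_fibre k P" for k f P
    using that by (simp add: chain_fibre_iff extensional_restrict)
  have "sgn (complex_of_real a) = 1" using a by (simp add: sgn_eq)
  then show "straighten b m n (two_bar a b c, y, z) = (c, y, z)"
    unfolding straighten_def prod.case v Let_def using b r[OF y] r[OF z] by simp
qed

lemma topspace_M: "topspace (M_space [a, b] (ones m) (ones n)) = q ` C"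
  by (simp add: M_space_def C_space_eq_top_of_set)

lemma orbit_refl: "t \<in> C \<Longrightarrow> t \<in> q t"
proof -
  assume "t \<in> C"
  then obtain x y z where t: "t = (x, y, z)" and "x \<in> extensional {..2}" "y \<in> extensional {..m}" "z \<in> extensional {..n}"
    by (cases t) (auto simp: C_iff chain_fibre_iff)
  then have "t = rot 1 t" by (simp add: rotate_triple_def extensional_restrict numeral_2_eq_2)
  then show "t \<in> q t" unfolding orbit_def by (intro CollectI exI[of _ 1]) simp
qed

lemma orbit_rotate: "t \<in> C \<Longrightarrow> cmod w = 1 \<Longrightarrow> q (rot w t) = q t"
proof -
  assume w: "cmod w = 1"
  have comp: "rot v (rot u t) = rot (v * u) t" for u v
    by (cases t) (auto simp: rotate_triple_def mult.assoc)
  have "w * cnj w = 1" using w complex_norm_square[of w] by simp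
  then have undo_rot: "rot v t = rot (v * cnj w) (rot w t)" for v
    unfolding comp by (simp add: mult.assoc mult.commute[of "cnj w" w])
  have unit: "v * cnj w \<in> sphere 0 1" "v * w \<in> sphere 0 1" if "v \<in> sphere 0 1" for v
    using that w by (simp_all add: norm_mult)
  show "q (rot w t) = q t"
  proof
    show "q (rot w t) \<subseteq> q t" unfolding orbit_def comp using unit(2) by blast
    show "q t \<subseteq> q (rot w t)"
    proof
      fix s assume "s \<in> q t"
      then obtain v where "v \<in> sphere 0 1" "s = rot v t" unfolding orbit_def by blast
      then show "s \<in> q (rot w t)" unfolding orbit_def using undo_rot unit(1) by blast
    qed
  qed
qed

text \<open>
  The straightening map descends to the orbit space because it is constant on orbits; completing the data
  by the two-bar linkage and passing to the orbit gives the inverse.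
\<close>

theorem M_space_homeomorphic:
  obtains f g where "homeomorphic_maps (M_space [a, b] (ones m) (ones n)) (top_of_set N) f g"
    "\<And>u. u \<in> topspace (M_space [a, b] (ones m) (ones n)) \<Longrightarrow> fst (f u) = p_map u"
proof -
  let ?M = "M_space [a, b] (ones m) (ones n)"
  have qm: "quotient_map (top_of_set C) ?M q"
    using quotient_map_quotient_topology[of "top_of_set C" q] by (simp add: M_space_def C_space_eq_top_of_set)
  have x1: "fst t 1 \<noteq> 0" if "t \<in> C" for t
    using that a by (cases t) (auto simp: C_iff)
  have coord: "continuous_on C (\<lambda>t. fst t i)" "continuous_on C (\<lambda>t. fst (snd t) i)" "continuous_on C (\<lambda>t. snd (snd t) i)" for i
    by (rule continuous_on_product_then_coordinatewise, intro continuous_on_fst continuous_on_snd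
        continuous_on_id)+
  have "continuous_on C (straighten b m n)"
    unfolding straighten_def Let_def case_prod_beta sgn_div_norm using x1 b
    by (intro continuous_on_Pair continuous_on_restrict_family continuous_intros coord) auto
  then have cont: "continuous_map (top_of_set C) (top_of_set N) (straighten b m n)"
    unfolding continuous_map_subtopology_eu using straighten_in_N(1) by blast
  have inv: "straighten b m n s = straighten b m n t" if st: "s \<in> C" "t \<in> C" "q s = q t" for s t
  proof -
    have "t \<in> q s" using orbit_refl[OF st(2)] st(3) by simp
    then obtain w where "cmod w = 1" "t = rot w s" unfolding orbit_def by auto
    then show ?thesis using straighten_rotate[OF st(1)] by simp
  qed
  obtain f where f: "continuous_map ?M (top_of_set N) f" "\<And>t. t \<in> C \<Longrightarrow> f (q t) = straighten b m n t"
    using quotient_map_lift_exists[OF qm cont] inv by (metis topspace_euclidean_subtopology)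
  define \<Psi> where "\<Psi> e = (two_bar a b (fst e), snd e)" for e :: "complex \<times> vertices \<times> vertices"
  have \<Psi>C: "\<Psi> e \<in> C" and s\<Psi>: "straighten b m n (\<Psi> e) = e" if "e \<in> N" for e
    using that two_bar_in_C by (cases e; simp add: \<Psi>_def)+
  have \<Psi>s: "\<Psi> (straighten b m n t) = rot (cnj (sgn (fst t 1))) t" if "t \<in> C" for t
    using straighten_in_N(2)[OF that] by (simp add: \<Psi>_def)
  have unit: "cmod (cnj (sgn (fst t 1))) = 1" if "t \<in> C" for t using x1[OF that] by (simp add: norm_sgn)
  have "continuous_on N \<Psi>"
    unfolding \<Psi>_def two_bar_def
  proof (intro continuous_on_Pair continuous_on_restrict_family)
    fix i :: nat
    show "continuous_on N (\<lambda>e. if i = 0 then 0 else if i = 1 then of_real a else of_real a - of_real b * cnj (fst e))"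
      by (cases "i = 0"; cases "i = 1") (auto intro!: continuous_intros)
  qed (auto intro!: continuous_intros)
  then have "continuous_map (top_of_set N) (top_of_set C) \<Psi>"
    unfolding continuous_map_subtopology_eu using \<Psi>C by blast
  then have contg: "continuous_map (top_of_set N) ?M (q \<circ> \<Psi>)"
    using quotient_imp_continuous_map[OF qm] by (rule continuous_map_compose)
  have "homeomorphic_maps ?M (top_of_set N) f (q \<circ> \<Psi>)"
    unfolding homeomorphic_maps_def
  proof (intro conjI ballI f contg)
    fix u assume "u \<in> topspace ?M"
    then obtain t where t: "t \<in> C" "u = q t" by (auto simp: topspace_M)
    show "(q \<circ> \<Psi>) (f u) = u"
      using orbit_rotate[OF t(1) unit[OF t(1)]] by (simp add: t f(2) \<Psi>s)
  next
    fix e assume "e \<in> topspace (top_of_set N)"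
    then show "f ((q \<circ> \<Psi>) e) = e" using f(2) \<Psi>C s\<Psi> by simp
  qed
  moreover have "fst (f u) = p_map u" if u: "u \<in> topspace ?M" for u
  proof -
    obtain t where t: "t \<in> C" "u = q t" using u by (auto simp: topspace_M)
    obtain c y z where e: "straighten b m n t = (c, y, z)" by (cases "straighten b m n t") auto
    then have eN: "(c, y, z) \<in> N" using straighten_in_N(1)[OF t(1)] by simp
    then have c: "cmod c = 1" by (simp add: N_iff)
    let ?t = "(two_bar a b c, y, z)"
    have "?t \<in> u"
      using \<Psi>s[OF t(1)] unit[OF t(1)] unfolding t orbit_def by (auto simp: e \<Psi>_def)
    moreover have "normalized ?t" using a by (simp add: normalized_def two_bar_def)
    moreover have "\<exists>!t. t \<in> u \<and> normalized t" using ex1_normalized[OF _ _ u] a by simp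
    ultimately have "{t \<in> u. normalized t} = {?t}" by auto
    then have "theta u = Arg (of_real b * (- cnj c))"
      by (simp add: theta_def two_bar_def)
    also have "\<dots> = Arg (- cnj c)" using b by (rule Arg_times_of_real)
    finally have "p_map u = cis pi * cis (- Arg (- cnj c))"
      by (simp only: p_map_def cis_mult diff_conv_add_uminus)
    also have "\<dots> = - cnj (cis (Arg (- cnj c)))" by (simp add: cis_cnj)
    also have "cis (Arg (- cnj c)) = - cnj c"
    proof -
      have "c \<noteq> 0" using c by auto
      then show ?thesis using c cis_Arg[of "- cnj c"] by (simp add: sgn_eq)
    qed
    finally show ?thesis using f(2)[OF t(1)] by (simp add: t e)
  qed
  ultimately show ?thesis by (rule that)
qed

end

theorem theorem6p2:
  fixes a b :: real and n2 n3 :: nat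
  assumes "a > 0" and "b > 0" and "n2 > 0" and "n3 > 0"
    and "((\<forall>k::int. odd k \<longrightarrow> real_of_int k \<notin> {\<bar>a - b\<bar>..a + b}) \<and> odd n2 \<and> odd n3)
       \<or> ((\<forall>k::int. even k \<longrightarrow> real_of_int k \<notin> {\<bar>a - b\<bar>..a + b}) \<and> even n2 \<and> even n3)
       \<or> ((\<forall>k::int. real_of_int k \<notin> {\<bar>a - b\<bar>..a + b}) \<and> (odd n2 \<longleftrightarrow> even n3))"
  shows "locally_trivial_fibration
           (M_space [a, b] (replicate n2 1) (replicate n3 1)) (top_of_set (sphere 0 1)) p_map
       \<and> has_euler_characteristic (M_space [a, b] (replicate n2 1) (replicate n3 1)) 0"
proof -
  interpret two_bar_linkage a b n2 n3 using assms(1,2) by unfold_locales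
  have range: "cmod (of_real a - of_real b * cnj c) \<in> {\<bar>a - b\<bar>..a + b}" if "c \<in> sphere 0 1" for c
  proof -
    have "cmod (of_real b * cnj c) = b" "cmod (of_real a) = a" using that assms(1,2) by (simp_all add: norm_mult)
    then show ?thesis
      using norm_triangle_ineq4[of "of_real a" "of_real b * cnj c"]
        norm_triangle_ineq3[of "of_real a" "of_real b * cnj c"] by simp
  qed
  have generic: "noncollinear_value n2 (of_real a - of_real b * cnj c)"
    "noncollinear_value n3 (of_real a - of_real b * cnj c)" if "c \<in> sphere 0 1" for c
    using range[OF that] assms(5) unfolding noncollinear_value_def by metis+
  obtain f g where fg: "homeomorphic_maps (M_space [a, b] (ones n2) (ones n3)) (top_of_set N) f g"
    and p: "\<And>u. u \<in> topspace (M_space [a, b] (ones n2) (ones n3)) \<Longrightarrow> fst (f u) = p_map u"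
    by (fact M_space_homeomorphic)
  have lt: "locally_trivial_fibration (top_of_set N) (top_of_set (sphere 0 1)) fst"
    using assms(3,4) generic by (rule locally_trivial_closed_chain_pairs)
  have "locally_trivial_fibration (M_space [a, b] (ones n2) (ones n3)) (top_of_set (sphere 0 1)) p_map"
    using fg p lt by (rule locally_trivial_fibration_homeomorphic[where p' = fst and p = p_map])
  moreover have "has_euler_characteristic (top_of_set N) 0"
    using assms(3,4) generic by (rule euler_characteristic_closed_chain_pairs)
  moreover have "top_of_set N homeomorphic_space M_space [a, b] (ones n2) (ones n3)"
    using fg homeomorphic_maps_sym unfolding homeomorphic_space_def by blast
  ultimately show ?thesis using has_euler_characteristic_homeomorphic by blast
qed

end
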